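(* Let $p\nmid N$ be a prime and let $f,g\in S_k(N,\chi)$ be eigenfunctions of the Hecke operator $T_p$ with eigenvalues $\lambda_f(p)$ and $\lambda_g(p)$ respectively. Then \[\langle U_pf,U_pg\rangle_{Np}=\left(p^{k-2}+\frac{(p-1)\lambda_f(p)\overline{\lambda_g(p)}}{p+1}\right)\langle f,g\rangle_{Np}.\]
   Context: $S_k(N,\chi)$ is the space of holomorphic cusp forms of weight $k$ on $\Gamma_0(N)$ with Dirichlet character $\chi$ mod $N$. For $\gamma=\begin{psmallmatrix}a&b\\c&d\end{psmallmatrix}\in\mathrm{GL}_2^+(\mathbf Q)$, $(f|\gamma)(\tau)=\det(\gamma)^{k/2}(c\tau+d)^{-k}f(\gamma\tau)$. For $(n,N)=1$, $T_nf=n^{k/2-1}\sum_{ad=n,\,a>0}\chi(a)\sum_{b=0}^{d-1}f|\begin{psmallmatrix}a&b\\0&d\end{psmallmatrix}$; for any $n\ge1$, $U_nf=n^{k/2-1}\sum_{b=0}^{n-1}f|\begin{psmallmatrix}1&b\\0&n\end{psmallmatrix}$ (so $U_nf=\sum_m a(f,nm)e^{2\pi im\tau}$, and $U_nf\in S_k(Nn,\chi)$). For cusp forms of level dividing $L$, $\langle f,g\rangle_L=\int_{\Gamma_0(L)\backslash\mathcal H}f(\tau)\overline{g(\tau)}y^{k-2}\,dx\,dy$. *)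

theory Defs
  imports "HOL-Analysis.Analysis" "HOL-Computational_Algebra.Primes"
begin

definition upper_half_plane :: "complex set" where
  "upper_half_plane = {\<tau>. Im \<tau> > 0}"

definition mat2 :: "'a::zero \<Rightarrow> 'a \<Rightarrow> 'a \<Rightarrow> 'a \<Rightarrow> 'a ^ 2 ^ 2" where
  "mat2 a b c d = vector [vector [a, b], vector [c, d]]"

definition mobius :: "real ^ 2 ^ 2 \<Rightarrow> complex \<Rightarrow> complex" where
  "mobius \<gamma> \<tau> =
     (of_real (\<gamma>$1$1) * \<tau> + of_real (\<gamma>$1$2)) / (of_real (\<gamma>$2$1) * \<tau> + of_real (\<gamma>$2$2))"

definition slash :: "int \<Rightarrow> (complex \<Rightarrow> complex) \<Rightarrow> real ^ 2 ^ 2 \<Rightarrow> complex \<Rightarrow> complex" where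
  "slash k f \<gamma> \<tau> =
     of_real (det \<gamma> powr (of_int k / 2)) *
     (of_real (\<gamma>$2$1) * \<tau> + of_real (\<gamma>$2$2)) powi (- k) * f (mobius \<gamma> \<tau>)"

abbreviation real_mat :: "int ^ 2 ^ 2 \<Rightarrow> real ^ 2 ^ 2" where
  "real_mat \<equiv> map_matrix real_of_int"

definition SL2Z :: "(int ^ 2 ^ 2) set" where
  "SL2Z = {\<gamma>. det \<gamma> = 1}"

definition Gamma0 :: "nat \<Rightarrow> (int ^ 2 ^ 2) set" where
  "Gamma0 N = {\<gamma> \<in> SL2Z. int N dvd \<gamma>$2$1}"

definition dirichlet_character :: "nat \<Rightarrow> (int \<Rightarrow> complex) \<Rightarrow> bool" where
  "dirichlet_character N chi \<longleftrightarrow>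
     (\<forall>a b. chi (a * b) = chi a * chi b) \<and>
     (\<forall>a. chi (a + int N) = chi a) \<and>
     (\<forall>a. chi a \<noteq> 0 \<longleftrightarrow> coprime a (int N))"

(* A form is a function on all of complex of which only the values on the upper half
   plane matter. The filter in the last clause is Im \<tau> -> \<infinity>, uniformly in Re \<tau>;
   letting \<gamma> range over SL2Z expresses vanishing at every cusp. *)
definition cusp_forms :: "int \<Rightarrow> nat \<Rightarrow> (int \<Rightarrow> complex) \<Rightarrow> (complex \<Rightarrow> complex) set" where
  "cusp_forms k N chi = {f.
     f holomorphic_on upper_half_plane \<and>
     (\<forall>\<gamma>\<in>Gamma0 N. \<forall>\<tau>\<in>upper_half_plane. slash k f (real_mat \<gamma>) \<tau> = chi (\<gamma>$2$2) * f \<tau>) \<and>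
     (\<forall>\<gamma>\<in>SL2Z. (slash k f (real_mat \<gamma>) \<longlongrightarrow> 0) (filtercomap Im at_top))}"

definition hecke_T ::
    "int \<Rightarrow> (int \<Rightarrow> complex) \<Rightarrow> nat \<Rightarrow> (complex \<Rightarrow> complex) \<Rightarrow> complex \<Rightarrow> complex" where
  "hecke_T k chi n f \<tau> =
     of_real (real n powr (of_int k / 2 - 1)) *
     (\<Sum>(a, d) \<in> {(a, d). a * d = n}.
        chi (int a) * (\<Sum>b<d. slash k f (mat2 (real a) (real b) 0 (real d)) \<tau>))"

definition hecke_U :: "int \<Rightarrow> nat \<Rightarrow> (complex \<Rightarrow> complex) \<Rightarrow> complex \<Rightarrow> complex" where
  "hecke_U k n f \<tau> =
     of_real (real n powr (of_int k / 2 - 1)) *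
     (\<Sum>b<n. slash k f (mat2 1 (real b) 0 (real n)) \<tau>)"

definition eigenfunction ::
    "((complex \<Rightarrow> complex) \<Rightarrow> complex \<Rightarrow> complex) \<Rightarrow> (complex \<Rightarrow> complex) \<Rightarrow> complex \<Rightarrow> bool" where
  "eigenfunction T f ev \<longleftrightarrow>
     (\<exists>\<tau>\<in>upper_half_plane. f \<tau> \<noteq> 0) \<and> (\<forall>\<tau>\<in>upper_half_plane. T f \<tau> = ev * f \<tau>)"

(* The elements of SL2Z acting trivially on the upper half plane are 1 and -1. *)
definition fundamental_domain :: "(int ^ 2 ^ 2) set \<Rightarrow> complex set \<Rightarrow> bool" where
  "fundamental_domain \<Gamma> D \<longleftrightarrow>
     D \<in> sets borel \<and> D \<subseteq> upper_half_plane \<and>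
     (\<Union>\<gamma>\<in>\<Gamma>. mobius (real_mat \<gamma>) ` D) = upper_half_plane \<and>
     (\<forall>\<gamma>\<in>\<Gamma>. \<gamma> \<noteq> mat 1 \<and> \<gamma> \<noteq> - mat 1 \<longrightarrow> negligible (D \<inter> mobius (real_mat \<gamma>) ` D))"

(* The integral over the quotient of the upper half plane by Gamma0 L is the integral over
   a fundamental domain; for an integrand invariant with respect to dx dy / y^2, as here,
   it does not depend on which one. *)
definition petersson ::
    "int \<Rightarrow> nat \<Rightarrow> (complex \<Rightarrow> complex) \<Rightarrow> (complex \<Rightarrow> complex) \<Rightarrow> complex" where
  "petersson k L f g =
     (LINT \<tau> : (SOME D. fundamental_domain (Gamma0 L) D) | lborel.
        f \<tau> * cnj (g \<tau>) * of_real (Im \<tau> powi (k - 2)))"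

end

theory Submission
  imports Defs "HOL-Complex_Analysis.Cauchy_Integral_Formula" "HOL-Number_Theory.Residues"
begin

text \<open>Write \<open>f\<^sub>p\<close> for \<open>f\<close> slashed with \<open>diag(p, 1)\<close>, so that \<open>U\<^sub>p f = T\<^sub>p f - \<chi>(p) p^(k/2 - 1) f\<^sub>p\<close>.
  The pairing of \<open>U\<^sub>p f\<close> and \<open>U\<^sub>p g\<close> then expands into four pairings. The Atkin--Lehner matrix
  normalizes \<open>\<Gamma>\<^sub>0(Np)\<close>, which gives \<open>\<langle>f\<^sub>p, g\<^sub>p\<rangle> = \<langle>f, g\<rangle>\<close>. Averaging over the \<open>p + 1\<close> cosets of
  \<open>\<Gamma>\<^sub>0(Np)\<close> in \<open>\<Gamma>\<^sub>0(N)\<close> turns \<open>g\<^sub>p\<close> into a multiple of \<open>T\<^sub>p g\<close>, so that \<open>(p + 1) \<langle>f, g\<^sub>p\<rangle>\<close> is a multiple of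
  \<open>\<langle>f, g\<rangle>\<close>.

  The choice of the fundamental domain \<open>D\<close> is handled through weights: nonnegative \<open>w\<close> such that the
  sum of \<open>w(\<gamma> \<tau>)\<close> over the group is almost everywhere a fixed constant. Integrals of invariant functions
  against any two weights with the same constant agree, by Tonelli and the invariance of the
  hyperbolic measure. The indicator of \<open>D\<close> is a weight with constant \<open>2\<close>, since \<open>\<gamma>\<close> and \<open>-\<gamma>\<close>
  act equally.\<close>

section \<open>Moebius transformations and the slash operator\<close>

text \<open>Two features of \<open>petersson\<close> shape the proof. Its domain is a Hilbert
  choice, so a fundamental domain has to be exhibited before anything is known about D, and even
  then D is an arbitrary Borel set that need not be a tidy union of translates; this is why images
  of D are compared as weights and never cut and reassembled. Its integral is a Bochner integral,
  which is 0 for a non-integrable function, so linearity requires all four densities to be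
  integrable; this is where vanishing at the cusps enters. The unfolding is therefore done for
  nonnegative extended integrals, where Tonelli asks for no integrability, and carried over to
  complex integrals by testing against all nonnegative Borel functions of the density. The
  constants: p^(k-2) is the square of the factor p^(k/2 - 1) in front of \<open>f\<^sub>p\<close>,
  and (p - 1)/(p + 1) is 1 - 2/(p + 1), each of the two mixed pairings taking away 1/(p +
  1).\<close>

lemma mat2_nth [simp]:
  "mat2 a b c d $ 1 $ 1 = a" "mat2 a b c d $ 1 $ 2 = b"
  "mat2 a b c d $ 2 $ 1 = c" "mat2 a b c d $ 2 $ 2 = d"
  by (simp_all add: mat2_def)

lemma mat2_eq_iff: "A = B \<longleftrightarrow> A$1$1 = B$1$1 \<and> A$1$2 = B$1$2 \<and> A$2$1 = B$2$1 \<and> A$2$2 = B$2$2"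
  for A B :: "'a ^ 2 ^ 2"
  by (auto simp: vec_eq_iff forall_2)

lemma matrix_mult_nth_2:
  "(A ** B) $ i $ j = A$i$1 * B$1$j + A$i$2 * B$2$j" for A B :: "'a::semiring_1 ^ 2 ^ 2"
  by (simp add: matrix_matrix_mult_def sum_2)

lemma mat_nth_2 [simp]:
  "(mat c :: 'a::zero ^ 2 ^ 2) $ 1 $ 1 = c" "(mat c :: 'a::zero ^ 2 ^ 2) $ 1 $ 2 = 0"
  "(mat c :: 'a::zero ^ 2 ^ 2) $ 2 $ 1 = 0" "(mat c :: 'a::zero ^ 2 ^ 2) $ 2 $ 2 = c"
  by (simp_all add: mat_def)

lemma real_mat_nth [simp]: "real_mat A $ i $ j = of_int (A $ i $ j)"
  by (simp add: map_matrix_def)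

lemma real_mat_mult: "real_mat (A ** B) = real_mat A ** real_mat B"
  by (simp add: mat2_eq_iff matrix_mult_nth_2)

lemma real_mat_one [simp]: "real_mat (mat 1) = mat 1"
  by (simp add: mat2_eq_iff)

lemma det_real_mat [simp]: "det (real_mat A) = of_int (det A)" for A :: "int ^ 2 ^ 2"
  by (simp add: det_2)

definition automorphy :: "real ^ 2 ^ 2 \<Rightarrow> complex \<Rightarrow> complex" where
  "automorphy \<gamma> \<tau> = of_real (\<gamma>$2$1) * \<tau> + of_real (\<gamma>$2$2)"

lemma automorphy_nonzero:
  assumes "det \<gamma> \<noteq> 0" "Im \<tau> > 0"
  shows "automorphy \<gamma> \<tau> \<noteq> 0"
proof
  assume "automorphy \<gamma> \<tau> = 0"
  then have *: "\<gamma>$2$1 * Im \<tau> = 0" "\<gamma>$2$1 * Re \<tau> + \<gamma>$2$2 = 0"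
    by (simp_all add: automorphy_def complex_eq_iff)
  from *(1) assms have "\<gamma>$2$1 = 0" by simp
  with *(2) assms(1) show False by (simp add: det_2)
qed

lemma Im_mobius:
  assumes "det \<gamma> \<noteq> 0" "Im \<tau> > 0"
  shows "Im (mobius \<gamma> \<tau>) = det \<gamma> * Im \<tau> / (cmod (automorphy \<gamma> \<tau>))\<^sup>2"
proof -
  have "Im (mobius \<gamma> \<tau>) = Im ((of_real (\<gamma>$1$1) * \<tau> + of_real (\<gamma>$1$2)) * cnj (automorphy \<gamma> \<tau>)) / (cmod (automorphy \<gamma> \<tau>))\<^sup>2"
    unfolding mobius_def automorphy_def[symmetric] by (subst complex_div_cnj) simp
  then show ?thesis
    by (simp add: automorphy_def det_2 algebra_simps)
qed

lemma mobius_in_upper_half_plane: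
  assumes "det \<gamma> > 0" "Im \<tau> > 0"
  shows "Im (mobius \<gamma> \<tau>) > 0"
  using assms automorphy_nonzero[of \<gamma> \<tau>] by (simp add: Im_mobius)

lemma automorphy_mult:
  assumes "det B > 0" "Im \<tau> > 0"
  shows "automorphy (A ** B) \<tau> = automorphy A (mobius B \<tau>) * automorphy B \<tau>"
  using automorphy_nonzero[of B \<tau>] assms
  unfolding mobius_def automorphy_def[of B, symmetric]
  by (simp add: automorphy_def[of A] automorphy_def[of "A ** B"] matrix_mult_nth_2 distrib_right)
     (simp add: automorphy_def algebra_simps)

lemma mobius_mult:
  assumes "det A > 0" "det B > 0" "Im \<tau> > 0"
  shows "mobius (A ** B) \<tau> = mobius A (mobius B \<tau>)"
proof -
  define v where "v = automorphy B \<tau>"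
  have v: "v \<noteq> 0" using automorphy_nonzero[of B \<tau>] assms by (simp add: v_def)
  have "mobius A (mobius B \<tau>) =
    ((of_real (A$1$1) * mobius B \<tau> + of_real (A$1$2)) * v) / (automorphy A (mobius B \<tau>) * v)"
    using v by (simp add: mobius_def[of A] automorphy_def)
  also have "(of_real (A$1$1) * mobius B \<tau> + of_real (A$1$2)) * v
     = of_real ((A**B)$1$1) * \<tau> + of_real ((A**B)$1$2)"
    using v unfolding mobius_def automorphy_def[of B, symmetric]
    unfolding v_def[symmetric]
    by (simp add: matrix_mult_nth_2 distrib_right)
       (simp add: v_def automorphy_def algebra_simps)
  also have "automorphy A (mobius B \<tau>) * v = automorphy (A ** B) \<tau>"
    unfolding v_def using automorphy_mult assms by simp
  finally show ?thesis by (simp add: mobius_def automorphy_def)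
qed

lemma mobius_one [simp]: "mobius (mat 1) \<tau> = \<tau>"
  by (simp add: mobius_def)

lemma slash_mult:
  assumes "det A > 0" "det B > 0" "Im \<tau> > 0"
  shows "slash k f (A ** B) \<tau> = slash k (slash k f A) B \<tau>"
  using assms
  by (simp add: slash_def automorphy_def[symmetric] automorphy_mult mobius_mult det_mul powr_mult
        power_int_mult_distrib)

lemma slash_cong:
  assumes "det B > 0" "Im \<tau> > 0" "\<And>\<tau>. Im \<tau> > 0 \<Longrightarrow> f \<tau> = g \<tau>"
  shows "slash k f B \<tau> = slash k g B \<tau>"
  using assms mobius_in_upper_half_plane[of B \<tau>] by (simp add: slash_def)

text \<open>The two slashes together contribute det^k |j|^(-2k), which is exactly the factor between
  the k-th powers of the two imaginary parts. A positive determinant suffices, so diag(p, 1) is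
  covered along with the modular group.\<close>

lemma norm_slash:
  assumes "det \<gamma> > 0" "Im \<tau> > 0"
  shows "slash k f \<gamma> \<tau> * cnj (slash k g \<gamma> \<tau>) * of_real (Im \<tau> powi k) =
         f (mobius \<gamma> \<tau>) * cnj (g (mobius \<gamma> \<tau>)) * of_real (Im (mobius \<gamma> \<tau>) powi k)"
proof -
  define j where "j = automorphy \<gamma> \<tau>"
  have j: "j \<noteq> 0" using automorphy_nonzero[of \<gamma> \<tau>] assms by (simp add: j_def)
  have 1: "j powi (-k) * cnj (j powi (-k)) = of_real ((cmod j)\<^sup>2 powi (- k))"
    by (simp only: complex_norm_square[symmetric] norm_power_int)
       (simp add: power_int_mult_distrib power2_eq_square)
  have 2: "(det \<gamma> powr (real_of_int k / 2)) * (det \<gamma> powr (real_of_int k / 2)) = det \<gamma> powi k"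
    using assms by (simp flip: powr_add add: powr_real_of_int')
  have 3: "Im (mobius \<gamma> \<tau>) powi k = det \<gamma> powi k * Im \<tau> powi k * (cmod j)\<^sup>2 powi (- k)"
    using assms j
    by (simp add: Im_mobius power_int_mult_distrib power_int_divide_distrib power_int_minus power_int_inverse divide_inverse flip: j_def)
  have "slash k f \<gamma> \<tau> * cnj (slash k g \<gamma> \<tau>) * of_real (Im \<tau> powi k) =
    f (mobius \<gamma> \<tau>) * cnj (g (mobius \<gamma> \<tau>)) * (of_real (Im \<tau> powi k) *
    of_real ((det \<gamma> powr (real_of_int k / 2)) * (det \<gamma> powr (real_of_int k / 2)))
    * (j powi (-k) * cnj (j powi (-k))))"
    by (simp add: slash_def automorphy_def[symmetric] j_def[symmetric])
  also have "\<dots> = f (mobius \<gamma> \<tau>) * cnj (g (mobius \<gamma> \<tau>)) * of_real (Im (mobius \<gamma> \<tau>) powi k)"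
    unfolding 1 2 3 by simp
  finally show ?thesis .
qed

section \<open>The hyperbolic measure\<close>

text \<open>Bridge to \<open>real ^ 2\<close>, the setting of the change of variables theorem
  \<open>has_measure_differentiable_image\<close>.\<close>

definition complex_of_vec :: "real ^ 2 \<Rightarrow> complex" where
  "complex_of_vec v = Complex (v $ 1) (v $ 2)"

definition vec_of_complex :: "complex \<Rightarrow> real ^ 2" where
  "vec_of_complex z = vector [Re z, Im z]"

lemma complex_of_vec_inverse [simp]:
  "complex_of_vec (vec_of_complex z) = z" "vec_of_complex (complex_of_vec v) = v"
  by (simp_all add: complex_of_vec_def vec_of_complex_def vec_eq_iff forall_2)

lemma bounded_linear_complex_of_vec: "bounded_linear complex_of_vec"
  unfolding linear_conv_bounded_linear[symmetric]
  by (rule linearI) (simp_all add: complex_of_vec_def complex_eq_iff)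

lemma bounded_linear_vec_of_complex: "bounded_linear vec_of_complex"
  unfolding linear_conv_bounded_linear[symmetric]
  by (rule linearI) (simp_all add: vec_of_complex_def vec_eq_iff forall_2)

lemma measurable_complex_of_vec [measurable]: "complex_of_vec \<in> borel_measurable borel"
  by (intro borel_measurable_continuous_onI linear_continuous_on bounded_linear_complex_of_vec)

lemma lborel_complex: "(lborel :: complex measure) = distr lborel borel complex_of_vec"
proof (rule lborel_eqI)
  fix l u :: complex
  assume le: "\<And>b. b \<in> Basis \<Longrightarrow> l \<bullet> b \<le> u \<bullet> b"
  have "complex_of_vec -` box l u = box (vec_of_complex l) (vec_of_complex u)"
    by (auto simp: in_box_complex_iff mem_box_cart forall_2 complex_of_vec_def vec_of_complex_def)
  then have "emeasure (distr lborel borel complex_of_vec) (box l u) =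
      emeasure lborel (box (vec_of_complex l) (vec_of_complex u))"
    by (simp add: emeasure_distr)
  also have "vec_of_complex l $ i \<le> vec_of_complex u $ i" for i
    using le[of 1] le[of \<i>] exhaust_2[of i] by (auto simp: vec_of_complex_def Basis_complex_def)
  then have "emeasure lborel (box (vec_of_complex l) (vec_of_complex u)) =
      ennreal (\<Prod>b\<in>Basis. (vec_of_complex u - vec_of_complex l) \<bullet> b)"
    by (subst emeasure_lborel_box) (auto simp: Basis_vec_def inner_axis)
  also have "(\<Prod>b\<in>Basis. (vec_of_complex u - vec_of_complex l) \<bullet> b) = (\<Prod>b\<in>Basis. (u - l) \<bullet> b)"
    by (simp add: Basis_vec_def Basis_complex_def UNION_singleton_eq_range)
       (subst prod.reindex, auto simp: inj_on_def axis_eq_axis inner_axis vec_of_complex_def UNIV_2)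
  finally show "emeasure (distr lborel borel complex_of_vec) (box l u) = ennreal (\<Prod>b\<in>Basis. (u - l) \<bullet> b)" .
qed simp

text \<open>Multiplication by a complex number a has real determinant |a|^2, so the Jacobian of a
  holomorphic map is the squared modulus of its derivative.\<close>

lemma emeasure_lborel_holomorphic_image:
  fixes f f' :: "complex \<Rightarrow> complex"
  assumes S [measurable]: "S \<in> sets borel" and fS [measurable]: "f ` S \<in> sets borel"
    and deriv: "\<And>z. z \<in> S \<Longrightarrow> (f has_field_derivative f' z) (at z)"
    and inj: "inj_on f S" and f' [measurable]: "f' \<in> borel_measurable borel"
  shows "emeasure lborel (f ` S) = (\<integral>\<^sup>+z. ennreal ((cmod (f' z))\<^sup>2) * indicator S z \<partial>lborel)"
proof -
  define T where "T = complex_of_vec -` S"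
  define h where "h = (\<lambda>v. vec_of_complex (f (complex_of_vec v)))"
  define J where "J = (\<lambda>v. (cmod (f' (complex_of_vec v)))\<^sup>2)"
  define h' where "h' = (\<lambda>x v. vec_of_complex (f' (complex_of_vec x) * complex_of_vec v))"
  have T [measurable]: "T \<in> sets borel"
    using measurable_sets[OF measurable_complex_of_vec S] by (simp add: T_def)
  have hT: "complex_of_vec -` (f ` S) = h ` T"
  proof -
    have "v \<in> h ` T" if "complex_of_vec v = f z" "z \<in> S" for v z
      using that by (intro image_eqI[of _ _ "vec_of_complex z"]) (auto simp: h_def T_def simp flip: that(1))
    then show ?thesis by (auto simp: h_def T_def)
  qed
  have hTb [measurable]: "h ` T \<in> sets borel"
    using measurable_sets[OF measurable_complex_of_vec fS] by (simp add: hT)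
  have der: "(h has_derivative h' x) (at x within T)" if "x \<in> T" for x
  proof -
    have "(f has_derivative (\<lambda>w. f' (complex_of_vec x) * w)) (at (complex_of_vec x))"
      using deriv[of "complex_of_vec x"] that by (simp add: T_def has_field_derivative_def)
    from has_derivative_compose[OF bounded_linear_imp_has_derivative[OF bounded_linear_complex_of_vec] this]
    have "((\<lambda>v. f (complex_of_vec v)) has_derivative (\<lambda>v. f' (complex_of_vec x) * complex_of_vec v)) (at x within T)" .
    from bounded_linear.has_derivative[OF bounded_linear_vec_of_complex this]
    show ?thesis by (simp add: h_def h'_def)
  qed
  have injh: "inj_on h T"
    using inj by (auto simp: inj_on_def h_def T_def) (metis complex_of_vec_inverse)
  have det: "\<bar>det (matrix (h' x))\<bar> = J x" for x
    by (simp add: det_2 matrix_def h'_def J_def complex_of_vec_def vec_of_complex_def axis_def cmod_power2)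
       (simp add: power2_eq_square)
  have J [measurable]: "J \<in> borel_measurable borel" unfolding J_def by measurable
  note iff = has_measure_differentiable_image[OF _ der injh, unfolded det]
  have "emeasure lborel (h ` T) = (\<integral>\<^sup>+v. ennreal (J v) * indicator T v \<partial>lborel)" (is "_ = ?I")
  \<comment> \<open>The equivalence \<open>iff\<close> speaks of finite values. If the integral is
    infinite, it shows that the image cannot have finite measure.\<close>
  proof (cases "?I = \<infinity>")
    case True
    have "h ` T \<notin> lmeasurable"
    proof
      assume "h ` T \<in> lmeasurable"
      then have "(J has_integral measure lebesgue (h ` T)) T"
        using iff by auto
      from nn_integral_has_integral_lebesgue'[OF _ this] have "?I < \<infinity>"
        by (simp add: J_def)
      with True show False by simp
    qed
    then have "emeasure lborel (h ` T) = \<infinity>"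
      by (simp add: fmeasurable_def) (metis less_top)
    then show ?thesis using True by simp
  next
    case False
    then obtain r where r: "?I = ennreal r" "r \<ge> 0"
      by (cases ?I) (auto simp: top_unique)
    have "((\<lambda>v. J v * indicator T v) has_integral r) UNIV"
      by (rule nn_integral_has_integral) (use r in \<open>auto simp: J_def ennreal_mult ennreal_indicator\<close>)
    then have "(J has_integral r) T"
      by (subst has_integral_restrict_UNIV[symmetric]) (simp add: indicator_def of_bool_def if_distrib cong: if_cong)
    then have "h ` T \<in> lmeasurable \<and> measure lebesgue (h ` T) = r"
      using iff by auto
    then have "emeasure lebesgue (h ` T) = ennreal r"
      by (auto simp: emeasure_eq_measure2)
    then show ?thesis using r by simp
  qed
  then show ?thesis
    unfolding hT[symmetric]
    by (subst (1 2) lborel_complex) (simp add: emeasure_distr nn_integral_distr J_def T_def indicator_def)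
qed

text \<open>The density vanishes off the upper half plane, so identities valid for Im \<tau> > 0
  hold almost everywhere.\<close>

definition hyperbolic :: "complex measure" where
  "hyperbolic = density lborel (\<lambda>\<tau>. ennreal (indicator upper_half_plane \<tau> / (Im \<tau>)\<^sup>2))"

lemma upper_half_plane_borel [measurable]: "upper_half_plane \<in> sets borel"
  unfolding upper_half_plane_def by (intro borel_open open_halfspace_Im_gt)

lemma sets_hyperbolic [measurable_cong, simp]: "sets hyperbolic = sets borel"
  by (simp add: hyperbolic_def)

lemma space_hyperbolic [simp]: "space hyperbolic = UNIV"
  by (simp add: hyperbolic_def)

lemma measurable_mobius [measurable]: "mobius \<gamma> \<in> borel_measurable borel"
  unfolding mobius_def by measurable

lemma measurable_automorphy [measurable]: "automorphy \<gamma> \<in> borel_measurable borel"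
  unfolding automorphy_def by measurable

lemma nn_integral_hyperbolic:
  assumes [measurable]: "F \<in> borel_measurable borel"
  shows "(\<integral>\<^sup>+\<tau>. F \<tau> \<partial>hyperbolic) =
    (\<integral>\<^sup>+\<tau>. ennreal (indicator upper_half_plane \<tau> / (Im \<tau>)\<^sup>2) * F \<tau> \<partial>lborel)"
  unfolding hyperbolic_def by (subst nn_integral_density) auto

lemma AE_hyperbolic_upper_half_plane: "AE \<tau> in hyperbolic. Im \<tau> > 0"
  unfolding hyperbolic_def
  by (subst AE_density) (auto simp: upper_half_plane_def indicator_def intro!: AE_I2 split: if_splits)

lemma AE_hyperbolicI:
  assumes "AE \<tau> in lborel. Im \<tau> > 0 \<longrightarrow> P \<tau>"
  shows "AE \<tau> in hyperbolic. P \<tau>"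
  unfolding hyperbolic_def using assms by (subst AE_density) (auto simp: upper_half_plane_def elim!: eventually_mono)

text \<open>An inverse up to the scalar \<open>det A\<close>, which Moebius maps do not see. It
  keeps integer entries, also for the Atkin--Lehner matrix of determinant p.\<close>

definition adjugate2 :: "'a::ring_1 ^ 2 ^ 2 \<Rightarrow> 'a ^ 2 ^ 2" where
  "adjugate2 A = mat2 (A$2$2) (- A$1$2) (- A$2$1) (A$1$1)"

lemma det_adjugate2 [simp]: "det (adjugate2 A) = det A" for A :: "'a::comm_ring_1 ^ 2 ^ 2"
  by (simp add: adjugate2_def det_2 algebra_simps)

lemma adjugate2_adjugate2 [simp]: "adjugate2 (adjugate2 A) = A"
  by (simp add: adjugate2_def mat2_eq_iff)

lemma mobius_adjugate2:
  assumes "det A > 0" "Im \<tau> > 0"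
  shows "mobius (adjugate2 A) (mobius A \<tau>) = \<tau>" "mobius A (mobius (adjugate2 A) \<tau>) = \<tau>"
proof -
  have scal: "mobius (mat c) \<tau> = \<tau>" if "c \<noteq> 0" for c
    using that by (simp add: mobius_def)
  have "adjugate2 A ** A = mat (det A)" "A ** adjugate2 A = mat (det A)"
    by (simp_all add: adjugate2_def mat2_eq_iff matrix_mult_nth_2 det_2 algebra_simps)
  then show "mobius (adjugate2 A) (mobius A \<tau>) = \<tau>" "mobius A (mobius (adjugate2 A) \<tau>) = \<tau>"
    using assms by (simp_all add: scal flip: mobius_mult)
qed

lemma has_field_derivative_mobius:
  assumes "det \<gamma> > 0" "Im \<tau> > 0"
  shows "(mobius \<gamma> has_field_derivative of_real (det \<gamma>) / (automorphy \<gamma> \<tau>)\<^sup>2) (at \<tau>)"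
proof -
  have nz: "of_real (\<gamma>$2$1) * \<tau> + of_real (\<gamma>$2$2) \<noteq> 0"
    using automorphy_nonzero[of \<gamma> \<tau>] assms by (simp add: automorphy_def)
  show ?thesis
    unfolding mobius_def[abs_def] automorphy_def
    by (rule derivative_eq_intros refl nz)+ (simp add: power2_eq_square det_2 algebra_simps)
qed

text \<open>The Jacobian is det^2 / |j|^4 and the imaginary part scales by det / |j|^2, so the
  factors cancel in dx dy / y^2.\<close>

lemma nn_integral_hyperbolic_mobius:
  assumes det: "det \<gamma> > 0" and F [measurable]: "F \<in> borel_measurable borel"
  shows "(\<integral>\<^sup>+\<tau>. F (mobius \<gamma> \<tau>) \<partial>hyperbolic) = (\<integral>\<^sup>+\<tau>. F \<tau> \<partial>hyperbolic)"
proof -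
  define J where "J = (\<lambda>\<tau>. (cmod (of_real (det \<gamma>) / (automorphy \<gamma> \<tau>)\<^sup>2))\<^sup>2)"
  define M where "M = density lborel (\<lambda>\<tau>. ennreal (J \<tau>) * indicator upper_half_plane \<tau>)"
  define L where "L = density lborel (indicator upper_half_plane :: complex \<Rightarrow> ennreal)"
  have J [measurable]: "J \<in> borel_measurable borel" unfolding J_def by measurable
  have [measurable_cong]: "sets M = sets borel" "sets L = sets borel" by (simp_all add: M_def L_def)
  \<comment> \<open>Lebesgue measure on the half plane is the image of its Jacobian-weighted copy,
    because the Moebius map is a bijection of the half plane.\<close>
  have "distr M borel (mobius \<gamma>) = L"
  proof (rule measure_eqI)
    fix A assume "A \<in> sets (distr M borel (mobius \<gamma>))"
    then have A [measurable]: "A \<in> sets borel" by simp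
    define S where "S = upper_half_plane \<inter> mobius \<gamma> -` A"
    have img: "mobius \<gamma> ` S = upper_half_plane \<inter> A"
    proof (intro equalityI subsetI)
      fix w assume w: "w \<in> upper_half_plane \<inter> A"
      then show "w \<in> mobius \<gamma> ` S"
        using det mobius_adjugate2[of \<gamma> w] mobius_in_upper_half_plane[of "adjugate2 \<gamma>" w]
        by (intro image_eqI[of _ _ "mobius (adjugate2 \<gamma>) w"]) (auto simp: S_def upper_half_plane_def)
    qed (use det mobius_in_upper_half_plane in \<open>auto simp: S_def upper_half_plane_def\<close>)
    have [measurable]: "S \<in> sets borel"
      unfolding S_def using measurable_sets[OF measurable_mobius A] by auto
    have inj: "inj_on (mobius \<gamma>) S"
      by (rule inj_on_inverseI[of _ "mobius (adjugate2 \<gamma>)"])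
         (use det mobius_adjugate2 in \<open>auto simp: S_def upper_half_plane_def\<close>)
    have "emeasure lborel (mobius \<gamma> ` S) = (\<integral>\<^sup>+\<tau>. ennreal (J \<tau>) * indicator S \<tau> \<partial>lborel)"
      unfolding J_def
      by (rule emeasure_lborel_holomorphic_image[OF _ _ _ inj])
         (use det has_field_derivative_mobius in \<open>auto simp: img\<close>, auto simp: S_def upper_half_plane_def)
    also have "(\<lambda>\<tau>. ennreal (J \<tau>) * indicator S \<tau>) =
      (\<lambda>\<tau>. ennreal (J \<tau>) * indicator upper_half_plane \<tau> * indicator (mobius \<gamma> -` A) \<tau>)"
      by (auto simp: S_def indicator_def)
    finally have "emeasure lborel (mobius \<gamma> ` S) = emeasure (distr M borel (mobius \<gamma>)) A"
      using measurable_sets[OF measurable_mobius A]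
      by (simp add: emeasure_distr emeasure_density M_def)
    moreover have "emeasure L A = emeasure lborel (upper_half_plane \<inter> A)"
      unfolding L_def by (simp add: emeasure_density flip: indicator_inter_arith)
    ultimately show "emeasure (distr M borel (mobius \<gamma>)) A = emeasure L A"
      by (simp add: img)
  qed (simp add: L_def)
  note eq = this
  have "(\<integral>\<^sup>+\<tau>. F \<tau> \<partial>hyperbolic) = (\<integral>\<^sup>+\<tau>. ennreal (1 / (Im \<tau>)\<^sup>2) * F \<tau> \<partial>L)"
    unfolding L_def
    by (subst nn_integral_density) (auto simp: nn_integral_hyperbolic indicator_def intro!: nn_integral_cong)
  also have "\<dots> = (\<integral>\<^sup>+\<tau>. ennreal (1 / (Im (mobius \<gamma> \<tau>))\<^sup>2) * F (mobius \<gamma> \<tau>) \<partial>M)"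
    unfolding eq[symmetric] by (subst nn_integral_distr) auto
  also have "\<dots> = (\<integral>\<^sup>+\<tau>. ennreal (indicator upper_half_plane \<tau> / (Im \<tau>)\<^sup>2) * F (mobius \<gamma> \<tau>) \<partial>lborel)"
    unfolding M_def
  proof (subst nn_integral_density; (rule nn_integral_cong)?)
    fix \<tau>
    have J0: "J \<tau> \<ge> 0" by (simp add: J_def)
    have "J \<tau> / (Im (mobius \<gamma> \<tau>))\<^sup>2 = 1 / (Im \<tau>)\<^sup>2" if "Im \<tau> > 0"
      using that det automorphy_nonzero[of \<gamma> \<tau>]
      by (simp add: J_def Im_mobius norm_divide norm_power power_divide power_mult_distrib flip: power_mult)
    then show "ennreal (J \<tau>) * indicator upper_half_plane \<tau> * (ennreal (1 / (Im (mobius \<gamma> \<tau>))\<^sup>2) * F (mobius \<gamma> \<tau>)) =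
       ennreal (indicator upper_half_plane \<tau> / (Im \<tau>)\<^sup>2) * F (mobius \<gamma> \<tau>)"
      by (cases "Im \<tau> > 0") (simp_all add: upper_half_plane_def J0 divide_inverse flip: mult.assoc ennreal_mult)
  qed auto
  also have "\<dots> = (\<integral>\<^sup>+\<tau>. F (mobius \<gamma> \<tau>) \<partial>hyperbolic)"
    by (subst nn_integral_hyperbolic) auto
  finally show ?thesis ..
qed

text \<open>The exceptional set is enclosed in a Borel null set, and invariance of the measure makes
  the preimage of that set null.\<close>

lemma AE_hyperbolic_mobius:
  assumes "det \<gamma> > 0" "AE \<tau> in hyperbolic. P \<tau>"
  shows "AE \<tau> in hyperbolic. P (mobius \<gamma> \<tau>)"
proof -
  from assms(2) obtain Z where Z: "{\<tau>. \<not> P \<tau>} \<subseteq> Z" "emeasure hyperbolic Z = 0" "Z \<in> sets borel"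
    by (auto elim!: AE_E)
  note [measurable] = Z(3)
  have "(\<integral>\<^sup>+\<tau>. indicator Z (mobius \<gamma> \<tau>) \<partial>hyperbolic) = 0"
    using Z by (subst nn_integral_hyperbolic_mobius[OF assms(1)]) auto
  then have "AE \<tau> in hyperbolic. mobius \<gamma> \<tau> \<notin> Z"
    by (subst (asm) nn_integral_0_iff_AE) (auto simp: indicator_def split: if_splits)
  then show ?thesis using Z(1) by (auto elim!: eventually_mono)
qed

section \<open>Unfolding over the congruence subgroup\<close>

abbreviation act :: "int ^ 2 ^ 2 \<Rightarrow> complex \<Rightarrow> complex" where
  "act \<gamma> \<equiv> mobius (real_mat \<gamma>)"

lemma det_Gamma0: "\<gamma> \<in> Gamma0 L \<Longrightarrow> det \<gamma> = 1"
  by (simp add: Gamma0_def SL2Z_def)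

lemma Gamma0_one [simp]: "mat 1 \<in> Gamma0 L"
  by (simp add: Gamma0_def SL2Z_def det_2)

lemma Gamma0_mult: "\<lbrakk>\<gamma> \<in> Gamma0 L; \<delta> \<in> Gamma0 L\<rbrakk> \<Longrightarrow> \<gamma> ** \<delta> \<in> Gamma0 L"
  by (simp add: Gamma0_def SL2Z_def det_mul matrix_mult_nth_2)

lemma Gamma0_adjugate2: "\<gamma> \<in> Gamma0 L \<Longrightarrow> adjugate2 \<gamma> \<in> Gamma0 L"
  by (simp add: Gamma0_def SL2Z_def) (simp add: adjugate2_def)

lemma Gamma0_uminus: "\<gamma> \<in> Gamma0 L \<Longrightarrow> - \<gamma> \<in> Gamma0 L"
  by (simp add: Gamma0_def SL2Z_def det_2)

lemma SL2Z_eq_Gamma0: "SL2Z = Gamma0 1"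
  by (simp add: Gamma0_def)

lemma real_mat_adjugate2: "real_mat (adjugate2 \<gamma>) = adjugate2 (real_mat \<gamma>)"
  by (simp add: mat2_eq_iff adjugate2_def)

lemma matrix_adjugate2:
  fixes \<gamma> :: "int ^ 2 ^ 2"
  assumes "det \<gamma> = 1"
  shows "adjugate2 \<gamma> ** \<gamma> = mat 1" "\<gamma> ** adjugate2 \<gamma> = mat 1"
  using assms by (simp_all add: adjugate2_def mat2_eq_iff matrix_mult_nth_2 det_2 algebra_simps)

lemma adjugate2_mult: "adjugate2 (A ** B) = adjugate2 B ** adjugate2 A" for A B :: "int ^ 2 ^ 2"
  by (simp add: adjugate2_def mat2_eq_iff matrix_mult_nth_2 algebra_simps)

lemma bij_betw_adjugate2_Gamma0: "bij_betw adjugate2 (Gamma0 L) (Gamma0 L)"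
  by (rule bij_betwI[of _ _ _ adjugate2]) (auto simp: Gamma0_adjugate2)

lemma countable_int_matrices: "countable (S :: (int ^ 2 ^ 2) set)"
proof -
  have "inj (\<lambda>\<gamma> :: int ^ 2 ^ 2. (\<gamma>$1$1, \<gamma>$1$2, \<gamma>$2$1, \<gamma>$2$2))"
    by (auto simp: inj_on_def mat2_eq_iff)
  then have "countable (UNIV :: (int ^ 2 ^ 2) set)"
    by (rule countableI')
  then show ?thesis by (rule countable_subset[rotated]) simp
qed

lemma act_in_upper_half_plane: "\<lbrakk>\<gamma> \<in> Gamma0 L; Im \<tau> > 0\<rbrakk> \<Longrightarrow> Im (act \<gamma> \<tau>) > 0"
  by (rule mobius_in_upper_half_plane) (simp_all add: det_Gamma0)

lemma act_mult: "\<lbrakk>\<gamma> \<in> Gamma0 L; \<delta> \<in> Gamma0 M; Im \<tau> > 0\<rbrakk> \<Longrightarrow> act (\<gamma> ** \<delta>) \<tau> = act \<gamma> (act \<delta> \<tau>)"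
  unfolding real_mat_mult by (rule mobius_mult) (simp_all add: det_Gamma0)

lemma act_adjugate2:
  assumes "\<gamma> \<in> Gamma0 L" "Im \<tau> > 0"
  shows "act (adjugate2 \<gamma>) (act \<gamma> \<tau>) = \<tau>" "act \<gamma> (act (adjugate2 \<gamma>) \<tau>) = \<tau>"
  unfolding real_mat_adjugate2 using mobius_adjugate2[of "real_mat \<gamma>" \<tau>] assms
  by (simp_all add: det_Gamma0)

lemma act_uminus: "act (- \<gamma>) = act \<gamma>"
proof
  fix \<tau>
  have "act (- \<gamma>) \<tau> = (- (of_int (\<gamma>$1$1) * \<tau> + of_int (\<gamma>$1$2))) / (- (of_int (\<gamma>$2$1) * \<tau> + of_int (\<gamma>$2$2)))"
    by (simp add: mobius_def)
  also have "\<dots> = act \<gamma> \<tau>"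
    unfolding minus_divide_divide by (simp add: mobius_def)
  finally show "act (- \<gamma>) \<tau> = act \<gamma> \<tau>" .
qed

lemma measurable_nn_integral_Gamma0 [measurable]:
  assumes [measurable]: "w \<in> borel_measurable borel"
  shows "(\<lambda>\<tau>. \<integral>\<^sup>+\<gamma>. w (act \<gamma> \<tau>) \<partial>count_space (Gamma0 L)) \<in> borel_measurable borel"
proof -
  interpret sigma_finite_measure "count_space (Gamma0 L)"
    by (rule sigma_finite_measure_count_space_countable[OF countable_int_matrices])
  have "(\<lambda>p. w (act (fst p) (snd p))) \<in> borel_measurable (count_space (Gamma0 L) \<Otimes>\<^sub>M borel)"
    by (rule measurable_pair_measure_countable1[OF countable_int_matrices]) simp
  then have "(\<lambda>p. w (act (snd p) (fst p))) \<in> borel_measurable (borel \<Otimes>\<^sub>M count_space (Gamma0 L))"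
    by (subst measurable_pair_swap_iff) (simp add: case_prod_unfold)
  then show ?thesis
    by (intro borel_measurable_nn_integral) (simp add: case_prod_unfold)
qed

text \<open>Tonelli moves the sum over the group outside, the substitution of \<gamma>\<tau> for
  \<tau> shifts the group element from one factor to the other, and inversion permutes the
  group.\<close>

lemma nn_integral_unfold_swap:
  assumes [measurable]: "v \<in> borel_measurable borel" "w \<in> borel_measurable borel"
  shows "(\<integral>\<^sup>+\<tau>. v \<tau> * (\<integral>\<^sup>+\<gamma>. w (act \<gamma> \<tau>) \<partial>count_space (Gamma0 L)) \<partial>hyperbolic) =
         (\<integral>\<^sup>+\<tau>. w \<tau> * (\<integral>\<^sup>+\<gamma>. v (act \<gamma> \<tau>) \<partial>count_space (Gamma0 L)) \<partial>hyperbolic)"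
proof -
  have expand: "(\<integral>\<^sup>+\<tau>. v \<tau> * (\<integral>\<^sup>+\<gamma>. w (act \<gamma> \<tau>) \<partial>count_space (Gamma0 L)) \<partial>hyperbolic) =
      (\<integral>\<^sup>+\<gamma>. \<integral>\<^sup>+\<tau>. v \<tau> * w (act \<gamma> \<tau>) \<partial>hyperbolic \<partial>count_space (Gamma0 L))"
    if [measurable]: "v \<in> borel_measurable borel" "w \<in> borel_measurable borel" for v w
    by (subst nn_integral_count_space_nn_integral[OF countable_int_matrices, symmetric])
       (simp_all add: nn_integral_cmult)
  have "(\<integral>\<^sup>+\<tau>. v \<tau> * w (act \<gamma> \<tau>) \<partial>hyperbolic) = (\<integral>\<^sup>+\<tau>. w \<tau> * v (act (adjugate2 \<gamma>) \<tau>) \<partial>hyperbolic)"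
    if "\<gamma> \<in> Gamma0 L" for \<gamma>
  proof -
    have "(\<integral>\<^sup>+\<tau>. w \<tau> * v (act (adjugate2 \<gamma>) \<tau>) \<partial>hyperbolic) =
        (\<integral>\<^sup>+\<tau>. w (act \<gamma> \<tau>) * v (act (adjugate2 \<gamma>) (act \<gamma> \<tau>)) \<partial>hyperbolic)"
      using that by (subst nn_integral_hyperbolic_mobius) (auto simp: det_Gamma0)
    also have "\<dots> = (\<integral>\<^sup>+\<tau>. v \<tau> * w (act \<gamma> \<tau>) \<partial>hyperbolic)"
      using AE_hyperbolic_upper_half_plane
      by (intro nn_integral_cong_AE) (auto elim!: eventually_mono simp: act_adjugate2[OF that] mult.commute)
    finally show ?thesis ..
  qed
  then have "(\<integral>\<^sup>+\<gamma>. \<integral>\<^sup>+\<tau>. v \<tau> * w (act \<gamma> \<tau>) \<partial>hyperbolic \<partial>count_space (Gamma0 L)) =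
    (\<integral>\<^sup>+\<gamma>. \<integral>\<^sup>+\<tau>. w \<tau> * v (act (adjugate2 \<gamma>) \<tau>) \<partial>hyperbolic \<partial>count_space (Gamma0 L))"
    by (rule nn_integral_cong) simp
  also have "\<dots> = (\<integral>\<^sup>+\<gamma>. \<integral>\<^sup>+\<tau>. w \<tau> * v (act \<gamma> \<tau>) \<partial>hyperbolic \<partial>count_space (Gamma0 L))"
    by (rule nn_integral_bij_count_space[OF bij_betw_adjugate2_Gamma0])
  finally show ?thesis by (simp add: expand)
qed

text \<open>Inserting the orbit sum of \<open>w\<close>, which is the constant \<open>c\<close>, and
  unfolding it against \<open>v * F\<close> leaves the orbit sum of \<open>v\<close>, as
  \<open>F\<close> is invariant. Both integrals thus agree after multiplication by \<open>c\<close>,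
  which cancels as it is neither 0 nor infinite.\<close>

lemma nn_integral_invariant_eq:
  assumes [measurable]: "v \<in> borel_measurable borel" "w \<in> borel_measurable borel" "F \<in> borel_measurable borel"
    and v: "AE \<tau> in hyperbolic. (\<integral>\<^sup>+\<gamma>. v (act \<gamma> \<tau>) \<partial>count_space (Gamma0 L)) = c"
    and w: "AE \<tau> in hyperbolic. (\<integral>\<^sup>+\<gamma>. w (act \<gamma> \<tau>) \<partial>count_space (Gamma0 L)) = c"
    and c: "c \<noteq> 0" "c \<noteq> \<infinity>"
    and F: "\<And>\<gamma> \<tau>. \<lbrakk>\<gamma> \<in> Gamma0 L; Im \<tau> > 0\<rbrakk> \<Longrightarrow> F (act \<gamma> \<tau>) = F \<tau>"
  shows "(\<integral>\<^sup>+\<tau>. v \<tau> * F \<tau> \<partial>hyperbolic) = (\<integral>\<^sup>+\<tau>. w \<tau> * F \<tau> \<partial>hyperbolic)"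
proof -
  have "c * (\<integral>\<^sup>+\<tau>. v \<tau> * F \<tau> \<partial>hyperbolic) =
      (\<integral>\<^sup>+\<tau>. (v \<tau> * F \<tau>) * (\<integral>\<^sup>+\<gamma>. w (act \<gamma> \<tau>) \<partial>count_space (Gamma0 L)) \<partial>hyperbolic)"
    using w by (subst nn_integral_cmult[symmetric]) (auto intro!: nn_integral_cong_AE elim!: eventually_mono simp: mult_ac)
  also have "\<dots> = (\<integral>\<^sup>+\<tau>. w \<tau> * (\<integral>\<^sup>+\<gamma>. v (act \<gamma> \<tau>) * F (act \<gamma> \<tau>) \<partial>count_space (Gamma0 L)) \<partial>hyperbolic)"
    by (rule nn_integral_unfold_swap) auto
  also have "\<dots> = (\<integral>\<^sup>+\<tau>. c * (w \<tau> * F \<tau>) \<partial>hyperbolic)"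
    using v AE_hyperbolic_upper_half_plane
  proof (intro nn_integral_cong_AE, eventually_elim)
    fix \<tau> assume \<tau>: "(\<integral>\<^sup>+\<gamma>. v (act \<gamma> \<tau>) \<partial>count_space (Gamma0 L)) = c" "Im \<tau> > 0"
    have "(\<integral>\<^sup>+\<gamma>. v (act \<gamma> \<tau>) * F (act \<gamma> \<tau>) \<partial>count_space (Gamma0 L)) =
       (\<integral>\<^sup>+\<gamma>. v (act \<gamma> \<tau>) * F \<tau> \<partial>count_space (Gamma0 L))"
      using \<tau> F by (intro nn_integral_cong) simp
    also have "\<dots> = c * F \<tau>"
      using \<tau> by (simp add: nn_integral_multc)
    finally show "w \<tau> * (\<integral>\<^sup>+\<gamma>. v (act \<gamma> \<tau>) * F (act \<gamma> \<tau>) \<partial>count_space (Gamma0 L)) = c * (w \<tau> * F \<tau>)"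
      by (simp add: mult_ac)
  qed
  also have "\<dots> = c * (\<integral>\<^sup>+\<tau>. w \<tau> * F \<tau> \<partial>hyperbolic)"
    by (rule nn_integral_cmult) auto
  finally show ?thesis
    using c by (simp add: ennreal_mult_cancel_left)
qed

lemma AE_hyperbolic_not_negligible:
  assumes "negligible S"
  shows "AE \<tau> in hyperbolic. \<tau> \<notin> S"
proof (rule AE_hyperbolicI)
  have "AE \<tau> in lebesgue. \<tau> \<notin> S"
    using assms by (intro AE_not_in) (simp add: negligible_iff_null_sets)
  then show "AE \<tau> in lborel. 0 < Im \<tau> \<longrightarrow> \<tau> \<notin> S"
    by (auto simp: AE_completion_iff elim!: eventually_mono)
qed

text \<open>The covering property gives one group element that carries \<tau> into D. A second one
  puts an orbit point of \<tau> into an overlap of D with a translate, unless the two agree up to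
  sign. As orbit points and not \<tau> itself are concerned, the pullbacks of all overlaps along the
  whole group are discarded; these are countably many null sets.\<close>

lemma AE_orbit_meets_fundamental_domain_twice:
  assumes D: "fundamental_domain (Gamma0 L) D"
  shows "AE \<tau> in hyperbolic. (\<integral>\<^sup>+\<gamma>. indicator D (act \<gamma> \<tau>) \<partial>count_space (Gamma0 L)) = 2"
proof -
  define overlap where "overlap = (\<lambda>\<gamma>. D \<inter> act \<gamma> ` D)"
  have "AE \<tau> in hyperbolic. \<forall>\<gamma>\<in>Gamma0 L. \<forall>\<delta>\<in>Gamma0 L. \<gamma> \<noteq> mat 1 \<and> \<gamma> \<noteq> - mat 1 \<longrightarrow> act \<delta> \<tau> \<notin> overlap \<gamma>"
  proof (intro AE_ball_countable' countable_int_matrices)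
    fix \<gamma> \<delta> assume "\<gamma> \<in> Gamma0 L" "\<delta> \<in> Gamma0 L"
    show "AE \<tau> in hyperbolic. \<gamma> \<noteq> mat 1 \<and> \<gamma> \<noteq> - mat 1 \<longrightarrow> act \<delta> \<tau> \<notin> overlap \<gamma>"
    proof (cases "\<gamma> \<noteq> mat 1 \<and> \<gamma> \<noteq> - mat 1")
      case True
      then have "negligible (overlap \<gamma>)"
        using D \<open>\<gamma> \<in> Gamma0 L\<close> by (auto simp: fundamental_domain_def overlap_def)
      then have "AE \<tau> in hyperbolic. \<tau> \<notin> overlap \<gamma>"
        by (rule AE_hyperbolic_not_negligible)
      then have "AE \<tau> in hyperbolic. act \<delta> \<tau> \<notin> overlap \<gamma>"
        by (intro AE_hyperbolic_mobius[of "real_mat \<delta>" "\<lambda>\<tau>. \<tau> \<notin> overlap \<gamma>"])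
           (simp_all add: det_Gamma0[OF \<open>\<delta> \<in> _\<close>])
      then show ?thesis by (auto elim!: eventually_mono)
    qed auto
  qed
  then show ?thesis
    using AE_hyperbolic_upper_half_plane
  proof eventually_elim
    fix \<tau> assume Im: "Im \<tau> > 0"
      and good: "\<forall>\<gamma>\<in>Gamma0 L. \<forall>\<delta>\<in>Gamma0 L. \<gamma> \<noteq> mat 1 \<and> \<gamma> \<noteq> - mat 1 \<longrightarrow> act \<delta> \<tau> \<notin> overlap \<gamma>"
    have "\<tau> \<in> (\<Union>\<gamma>\<in>Gamma0 L. act \<gamma> ` D)"
      using D Im by (auto simp: fundamental_domain_def upper_half_plane_def)
    then obtain \<gamma>\<^sub>1 \<sigma> where \<gamma>\<^sub>1: "\<gamma>\<^sub>1 \<in> Gamma0 L" "\<sigma> \<in> D" "\<tau> = act \<gamma>\<^sub>1 \<sigma>"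
      by blast
    have "Im \<sigma> > 0"
      using D \<gamma>\<^sub>1(2) by (auto simp: fundamental_domain_def upper_half_plane_def)
    define \<gamma>\<^sub>0 where "\<gamma>\<^sub>0 = adjugate2 \<gamma>\<^sub>1"
    have \<gamma>\<^sub>0: "\<gamma>\<^sub>0 \<in> Gamma0 L" "act \<gamma>\<^sub>0 \<tau> \<in> D"
      using \<gamma>\<^sub>1 \<open>Im \<sigma> > 0\<close> by (simp_all add: \<gamma>\<^sub>0_def Gamma0_adjugate2 act_adjugate2[OF \<gamma>\<^sub>1(1)])
    have "{\<gamma> \<in> Gamma0 L. act \<gamma> \<tau> \<in> D} = {\<gamma>\<^sub>0, - \<gamma>\<^sub>0}"
    proof (intro equalityI subsetI)
      fix \<gamma> assume "\<gamma> \<in> {\<gamma> \<in> Gamma0 L. act \<gamma> \<tau> \<in> D}"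
      then have \<gamma>: "\<gamma> \<in> Gamma0 L" "act \<gamma> \<tau> \<in> D" by auto
      define \<epsilon> where "\<epsilon> = \<gamma> ** adjugate2 \<gamma>\<^sub>0"
      have \<epsilon>: "\<epsilon> \<in> Gamma0 L"
        unfolding \<epsilon>_def using \<gamma> \<gamma>\<^sub>0 by (intro Gamma0_mult Gamma0_adjugate2)
      have "\<gamma> = \<epsilon> ** \<gamma>\<^sub>0"
        by (simp add: \<epsilon>_def matrix_adjugate2 det_Gamma0[OF \<gamma>\<^sub>0(1)] flip: matrix_mul_assoc)
      then have "act \<gamma> \<tau> = act \<epsilon> (act \<gamma>\<^sub>0 \<tau>)"
        using act_mult[OF \<epsilon> \<gamma>\<^sub>0(1) Im] by simp
      then have "act \<gamma> \<tau> \<in> overlap \<epsilon>"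
        using \<gamma> \<gamma>\<^sub>0 by (auto simp: overlap_def)
      then have "\<epsilon> = mat 1 \<or> \<epsilon> = - mat 1"
        using good \<epsilon> \<gamma> by blast
      then show "\<gamma> \<in> {\<gamma>\<^sub>0, - \<gamma>\<^sub>0}"
        using \<open>\<gamma> = \<epsilon> ** \<gamma>\<^sub>0\<close> by (auto simp: mat2_eq_iff matrix_mult_nth_2)
    qed (use \<gamma>\<^sub>0 Gamma0_uminus act_uminus in auto)
    moreover have "\<gamma>\<^sub>0 \<noteq> - \<gamma>\<^sub>0"
      using det_Gamma0[OF \<gamma>\<^sub>0(1)] by (auto simp: mat2_eq_iff det_2)
    moreover have "(\<integral>\<^sup>+\<gamma>. indicator D (act \<gamma> \<tau>) \<partial>count_space (Gamma0 L)) =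
        (\<integral>\<^sup>+\<gamma>. indicator {\<gamma> \<in> Gamma0 L. act \<gamma> \<tau> \<in> D} \<gamma> \<partial>count_space (Gamma0 L))"
      by (intro nn_integral_cong) (simp add: indicator_def)
    ultimately show "(\<integral>\<^sup>+\<gamma>. indicator D (act \<gamma> \<tau>) \<partial>count_space (Gamma0 L)) = 2"
      using \<gamma>\<^sub>0 Gamma0_uminus[OF \<gamma>\<^sub>0(1)] by (simp add: card_insert_if)
  qed
qed

section \<open>A Ford fundamental domain\<close>

lemma Im_act:
  assumes "\<gamma> \<in> Gamma0 L" "Im \<tau> > 0"
  shows "Im (act \<gamma> \<tau>) = Im \<tau> / (cmod (automorphy (real_mat \<gamma>) \<tau>))\<^sup>2"
  using Im_mobius[of "real_mat \<gamma>" \<tau>] assms by (simp add: det_Gamma0)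

text \<open>The imaginary part bounds c by 1 / Im \<tau>, and then the modulus bounds d.\<close>

lemma finite_small_automorphy:
  assumes "Im \<tau> > 0"
  shows "finite {(c :: int, d :: int). cmod (of_int c * \<tau> + of_int d) \<le> 1}"
proof -
  define K where "K = \<lceil>1 / Im \<tau>\<rceil>"
  define M where "M = \<lceil>1 + K * cmod \<tau>\<rceil>"
  have "\<bar>c\<bar> \<le> K \<and> \<bar>d\<bar> \<le> M" if *: "cmod (of_int c * \<tau> + of_int d) \<le> 1" for c d :: int
  proof
    have "\<bar>of_int c\<bar> * Im \<tau> \<le> 1"
      using abs_Im_le_cmod[of "of_int c * \<tau> + of_int d"] * assms by (simp add: abs_mult)
    then have c: "\<bar>of_int c\<bar> \<le> 1 / Im \<tau>"
      using assms by (simp add: field_simps)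
    then show "\<bar>c\<bar> \<le> K"
      unfolding K_def by linarith
    then have "cmod (of_int c * \<tau>) \<le> K * cmod \<tau>"
      by (simp add: norm_mult mult_right_mono)
    moreover have "cmod (of_int d) \<le> cmod (of_int c * \<tau> + of_int d) + cmod (of_int c * \<tau>)"
      by (metis add_diff_cancel_left' norm_triangle_ineq4)
    ultimately have "\<bar>of_int d\<bar> \<le> 1 + K * cmod \<tau>"
      using * by simp
    then show "\<bar>d\<bar> \<le> M"
      unfolding M_def by linarith
  qed
  then have "{(c, d). cmod (of_int c * \<tau> + of_int d) \<le> 1} \<subseteq> {-K..K} \<times> {-M..M}"
    by (auto simp: abs_le_iff minus_le_iff)
  then show ?thesis by (rule finite_subset) simp
qed

text \<open>Orbit heights are Im \<tau> / |c \<tau> + d|^2, so the highest point comes from the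
  least |c \<tau> + d|. The identity has value 1, so it is enough to minimize over the finitely many
  bottom rows with value at most 1.\<close>

lemma Gamma0_orbit_has_max_Im:
  assumes \<tau>: "Im \<tau> > 0"
  obtains \<gamma> where "\<gamma> \<in> Gamma0 L" "\<And>\<delta>. \<delta> \<in> Gamma0 L \<Longrightarrow> Im (act \<delta> \<tau>) \<le> Im (act \<gamma> \<tau>)"
proof -
  define j where "j = (\<lambda>(c :: int, d :: int). cmod (of_int c * \<tau> + of_int d))"
  define P where "P = {p. j p \<le> 1} \<inter> (\<lambda>\<gamma>. (\<gamma>$2$1, \<gamma>$2$2)) ` Gamma0 L"
  have "finite {p. j p \<le> 1}"
    using finite_small_automorphy[OF \<tau>] by (simp add: j_def case_prod_unfold)
  then have "finite P" by (simp add: P_def)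
  have "(0, 1) \<in> P"
    unfolding P_def j_def by (auto intro!: image_eqI[of _ _ "mat 1"])
  then have "P \<noteq> {}" by blast
  then obtain p where p: "p \<in> P" "\<And>q. q \<in> P \<Longrightarrow> j p \<le> j q"
    using \<open>finite P\<close> arg_min_if_finite[of P j] by (meson not_le)
  then obtain \<gamma> where \<gamma>: "\<gamma> \<in> Gamma0 L" "p = (\<gamma>$2$1, \<gamma>$2$2)"
    by (auto simp: P_def)
  have j: "cmod (automorphy (real_mat \<delta>) \<tau>) = j (\<delta>$2$1, \<delta>$2$2)" for \<delta>
    by (simp add: j_def automorphy_def)
  show ?thesis
  proof (rule that[OF \<gamma>(1)])
    fix \<delta> assume \<delta>: "\<delta> \<in> Gamma0 L"
    have "j p \<le> j (\<delta>$2$1, \<delta>$2$2)"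
      using p \<delta> by (cases "j (\<delta>$2$1, \<delta>$2$2) \<le> 1") (auto simp: P_def)
    moreover have "j p > 0"
      using automorphy_nonzero[of "real_mat \<gamma>" \<tau>] \<gamma> \<tau> by (simp add: det_Gamma0 flip: j)
    ultimately show "Im (act \<delta> \<tau>) \<le> Im (act \<gamma> \<tau>)"
      using \<tau> \<gamma> \<delta> by (simp add: Im_act j frac_le power_mono)
  qed
qed

text \<open>The height condition amounts to |c \<tau> + d| >= 1 for every bottom row: the points lie
  inside no isometric circle. The strip is half-open so that no two of its points differ by a
  nonzero integer.\<close>

definition ford_domain :: "nat \<Rightarrow> complex set" where
  "ford_domain L = {\<tau>. Im \<tau> > 0 \<and> 0 \<le> Re \<tau> \<and> Re \<tau> < 1 \<and> (\<forall>\<gamma>\<in>Gamma0 L. Im (act \<gamma> \<tau>) \<le> Im \<tau>)}"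

lemma orbit_meets_ford_domain:
  assumes \<tau>: "Im \<tau> > 0"
  obtains \<gamma> where "\<gamma> \<in> Gamma0 L" "act \<gamma> \<tau> \<in> ford_domain L"
proof -
  obtain \<gamma> where \<gamma>: "\<gamma> \<in> Gamma0 L" "\<And>\<delta>. \<delta> \<in> Gamma0 L \<Longrightarrow> Im (act \<delta> \<tau>) \<le> Im (act \<gamma> \<tau>)"
    using Gamma0_orbit_has_max_Im[OF \<tau>] by blast
  define t where "t = (mat2 1 (- \<lfloor>Re (act \<gamma> \<tau>)\<rfloor>) 0 1 :: int ^ 2 ^ 2)"
  have t: "t \<in> Gamma0 L" by (simp add: t_def Gamma0_def SL2Z_def det_2)
  have act_t: "act t \<sigma> = \<sigma> - of_int \<lfloor>Re (act \<gamma> \<tau>)\<rfloor>" for \<sigma>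
    by (simp add: t_def mobius_def)
  show ?thesis
  proof (rule that[of "t ** \<gamma>"])
    show "t ** \<gamma> \<in> Gamma0 L" by (intro Gamma0_mult t \<gamma>)
    have eq: "act (t ** \<gamma>) \<tau> = act t (act \<gamma> \<tau>)"
      by (rule act_mult[OF t \<gamma>(1) \<tau>])
    have "Im (act \<delta> (act (t ** \<gamma>) \<tau>)) \<le> Im (act (t ** \<gamma>) \<tau>)" if "\<delta> \<in> Gamma0 L" for \<delta>
    proof -
      have "act \<delta> (act (t ** \<gamma>) \<tau>) = act (\<delta> ** (t ** \<gamma>)) \<tau>"
        using act_mult[OF that _ \<tau>] t \<gamma> Gamma0_mult by metis
      then show ?thesis
        using \<gamma>(2)[of "\<delta> ** (t ** \<gamma>)"] that t \<gamma>(1) by (simp add: Gamma0_mult eq act_t)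
    qed
    moreover have "Im (act (t ** \<gamma>) \<tau>) > 0"
      using act_in_upper_half_plane[OF \<gamma>(1) \<tau>] by (simp add: eq act_t)
    moreover have "0 \<le> Re (act (t ** \<gamma>) \<tau>)" "Re (act (t ** \<gamma>) \<tau>) < 1"
      by (simp_all add: eq act_t) linarith
    ultimately show "act (t ** \<gamma>) \<tau> \<in> ford_domain L"
      by (simp add: ford_domain_def)
  qed
qed

text \<open>Two points of the domain in one orbit have equal height, hence |c \<tau> + d| = 1. For
  nonzero c this is a circle, which is negligible; for c = 0 the element is an integer translation
  up to sign, and the half-open strip leaves only 1 and -1.\<close>

lemma fundamental_domain_ford_domain: "fundamental_domain (Gamma0 L) (ford_domain L)"
  unfolding fundamental_domain_def
proof (intro conjI ballI impI)
  have "ford_domain L = upper_half_plane \<inter> {\<tau>. 0 \<le> Re \<tau>} \<inter> {\<tau>. Re \<tau> < 1} \<inter>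
      (\<Inter>\<gamma>\<in>Gamma0 L. {\<tau>. Im (act \<gamma> \<tau>) \<le> Im \<tau>})"
    by (auto simp: ford_domain_def upper_half_plane_def)
  moreover have "Gamma0 L \<noteq> {}" using Gamma0_one by blast
  ultimately show "ford_domain L \<in> sets borel"
    by (auto intro!: sets.Int sets.countable_INT'' countable_int_matrices)
  show "ford_domain L \<subseteq> upper_half_plane"
    by (auto simp: ford_domain_def upper_half_plane_def)
  show "(\<Union>\<gamma>\<in>Gamma0 L. act \<gamma> ` ford_domain L) = upper_half_plane"
  proof (intro equalityI subsetI)
    fix \<tau> assume "\<tau> \<in> upper_half_plane"
    then have \<tau>: "Im \<tau> > 0" by (simp add: upper_half_plane_def)
    then obtain \<gamma> where \<gamma>: "\<gamma> \<in> Gamma0 L" "act \<gamma> \<tau> \<in> ford_domain L"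
      by (rule orbit_meets_ford_domain)
    then show "\<tau> \<in> (\<Union>\<gamma>\<in>Gamma0 L. act \<gamma> ` ford_domain L)"
      using Gamma0_adjugate2[OF \<gamma>(1)] act_adjugate2(1)[OF \<gamma>(1) \<tau>] by (metis UN_I image_eqI)
  qed (auto simp: upper_half_plane_def ford_domain_def intro: act_in_upper_half_plane)
next
  fix \<gamma> assume \<gamma>: "\<gamma> \<in> Gamma0 L" and ne: "\<gamma> \<noteq> mat 1 \<and> \<gamma> \<noteq> - mat 1"
  show "negligible (ford_domain L \<inter> act \<gamma> ` ford_domain L)"
  proof -
    define \<delta> where "\<delta> = adjugate2 \<gamma>"
    have \<delta>: "\<delta> \<in> Gamma0 L" unfolding \<delta>_def using \<gamma> by (rule Gamma0_adjugate2)
    have "cmod (automorphy (real_mat \<delta>) \<tau>) = 1 \<and> \<delta>$2$1 \<noteq> 0"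
      if "\<tau> \<in> ford_domain L" "\<tau> = act \<gamma> \<sigma>" "\<sigma> \<in> ford_domain L" for \<tau> \<sigma>
    proof
      have \<sigma>: "\<sigma> = act \<delta> \<tau>"
        using that \<gamma> by (simp add: \<delta>_def act_adjugate2[OF \<gamma>] ford_domain_def)
      have \<tau>: "Im \<tau> > 0" using that by (simp add: ford_domain_def)
      have "Im \<tau> \<le> Im \<sigma>"
        unfolding that(2) using that(3) \<gamma> by (simp add: ford_domain_def)
      moreover have "Im \<sigma> \<le> Im \<tau>"
        unfolding \<sigma> using that(1) \<delta> by (simp add: ford_domain_def)
      ultimately have "Im \<tau> = Im \<sigma>"
        by simp
      then have "Im \<tau> / (cmod (automorphy (real_mat \<delta>) \<tau>))\<^sup>2 = Im \<tau>"
        unfolding \<sigma> Im_act[OF \<delta> \<tau>] by simp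
      moreover have nz: "automorphy (real_mat \<delta>) \<tau> \<noteq> 0"
        using automorphy_nonzero[of "real_mat \<delta>" \<tau>] \<tau> \<delta> by (simp add: det_Gamma0)
      ultimately have "(cmod (automorphy (real_mat \<delta>) \<tau>))\<^sup>2 = 1"
        using \<tau> by (simp add: field_simps)
      then show "cmod (automorphy (real_mat \<delta>) \<tau>) = 1"
        by (simp add: power2_eq_1_iff) (metis norm_ge_zero not_one_le_zero neg_0_le_iff_le)
      show "\<delta>$2$1 \<noteq> 0"
      proof
        assume c: "\<delta>$2$1 = 0"
        with det_Gamma0[OF \<delta>] have "\<delta>$1$1 * \<delta>$2$2 = 1" by (simp add: det_2)
        then have ad: "(\<delta>$1$1 = 1 \<and> \<delta>$2$2 = 1) \<or> (\<delta>$1$1 = -1 \<and> \<delta>$2$2 = -1)"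
          by (auto simp: zmult_eq_1_iff)
        then have "\<sigma> = \<tau> + of_int (\<delta>$1$1 * \<delta>$1$2)"
          using c unfolding \<sigma> mobius_def by auto
        then have "Re \<sigma> = Re \<tau> + of_int (\<delta>$1$1 * \<delta>$1$2)" by simp
        moreover have "0 \<le> Re \<sigma>" "Re \<sigma> < 1" "0 \<le> Re \<tau>" "Re \<tau> < 1"
          using that by (auto simp: ford_domain_def)
        ultimately have "\<delta>$1$1 * \<delta>$1$2 = 0" by linarith
        then have "\<delta>$1$2 = 0" using ad by auto
        then have "\<delta> = mat 1 \<or> \<delta> = - mat 1"
          using ad c by (auto simp: mat2_eq_iff)
        then have "\<gamma> = mat 1 \<or> \<gamma> = - mat 1"
          unfolding \<delta>_def by (auto simp: adjugate2_def mat2_eq_iff)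
        with ne show False by blast
      qed
    qed
    then have sub: "ford_domain L \<inter> act \<gamma> ` ford_domain L \<subseteq>
       {\<tau>. cmod (automorphy (real_mat \<delta>) \<tau>) = 1 \<and> \<delta>$2$1 \<noteq> 0}"
      by blast
    show ?thesis
    proof (cases "\<delta>$2$1 = 0")
      case True
      then show ?thesis using sub by simp
    next
      case False
      define c d where "c = complex_of_int (\<delta>$2$1)" and "d = complex_of_int (\<delta>$2$2)"
      have "c \<noteq> 0" using False by (simp add: c_def)
      have "{\<tau>. cmod (automorphy (real_mat \<delta>) \<tau>) = 1 \<and> \<delta>$2$1 \<noteq> 0} \<subseteq> sphere (- d / c) (1 / cmod c)"
      proof (safe, goal_cases)
        case (1 \<tau>)
        have "cmod c * dist (- d / c) \<tau> = cmod (c * (\<tau> - (- d / c)))"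
          by (simp add: dist_norm norm_mult norm_minus_commute)
        also have "c * (\<tau> - (- d / c)) = automorphy (real_mat \<delta>) \<tau>"
          using \<open>c \<noteq> 0\<close> by (simp add: field_simps automorphy_def c_def d_def)
        finally show ?case using 1 \<open>c \<noteq> 0\<close> by (simp add: field_simps)
      qed
      then show ?thesis
        using sub negligible_sphere[of "- d / c" "1 / cmod c"] by (meson negligible_subset)
    qed
  qed
qed

lemma fundamental_domain_Eps:
  "fundamental_domain (Gamma0 L) (SOME D. fundamental_domain (Gamma0 L) D)"
  by (rule someI[of "fundamental_domain (Gamma0 L)", OF fundamental_domain_ford_domain])

section \<open>A strip that meets every orbit of the full modular group, and the cosets of the
  congruence subgroup\<close>

definition strip :: "complex set" where
  "strip = {\<tau>. 0 \<le> Re \<tau> \<and> Re \<tau> \<le> 1 \<and> 1 / 2 \<le> Im \<tau>}"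

text \<open>The bottom rows (1, 0) and (1, -1) give |\<tau>| >= 1 and |\<tau> - 1| >= 1, and one of
  Re \<tau>, 1 - Re \<tau> is at most 1/2. The sharp height is sqrt(3)/2; the cruder 1/2 suffices
  and suits a dyadic decomposition.\<close>

lemma ford_domain_SL2Z_subset_strip: "ford_domain 1 \<subseteq> strip"
proof
  fix \<tau> assume \<tau>: "\<tau> \<in> ford_domain 1"
  have ge1: "1 \<le> (Re \<tau> + of_int d)\<^sup>2 + (Im \<tau>)\<^sup>2" for d :: int
  proof -
    define \<gamma> where "\<gamma> = (mat2 0 (-1) 1 d :: int ^ 2 ^ 2)"
    have \<gamma>: "\<gamma> \<in> Gamma0 1" by (simp add: \<gamma>_def Gamma0_def SL2Z_def det_2)
    have "Im \<tau> / (cmod (\<tau> + of_int d))\<^sup>2 \<le> Im \<tau>" "Im \<tau> > 0"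
      using \<tau> \<gamma> Im_act[OF \<gamma>, of \<tau>] by (auto simp: ford_domain_def automorphy_def \<gamma>_def)
    moreover have "cmod (\<tau> + of_int d) > 0"
      using \<open>Im \<tau> > 0\<close> by (auto simp: complex_eq_iff)
    ultimately have "1 \<le> (cmod (\<tau> + of_int d))\<^sup>2"
      by (simp add: field_simps)
    then show ?thesis by (simp add: cmod_power2)
  qed
  have Re: "0 \<le> Re \<tau>" "Re \<tau> < 1" "0 < Im \<tau>" using \<tau> by (auto simp: ford_domain_def)
  have "(1/2)\<^sup>2 \<le> (Im \<tau>)\<^sup>2"
  proof (cases "Re \<tau> \<le> 1 / 2")
    case True
    then have "(Re \<tau>)\<^sup>2 \<le> (1/2)\<^sup>2" using Re by (intro power_mono) auto
    then show ?thesis using ge1[of 0] by (simp add: power2_eq_square)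
  next
    case False
    then have "(1 - Re \<tau>)\<^sup>2 \<le> (1/2)\<^sup>2" using Re by (intro power_mono) auto
    then show ?thesis using ge1[of "-1"] by (simp add: power2_eq_square algebra_simps)
  qed
  then have "1 / 2 \<le> Im \<tau>" using Re by (rule_tac power2_le_imp_le) auto
  then show "\<tau> \<in> strip" using Re by (simp add: strip_def)
qed

text \<open>The lower left entry of \<gamma> times the inverse of r is the 2 by 2 determinant of
  their bottom rows up to sign, so it is divisible by L when the rows agree modulo L. One matrix is
  chosen per residue pair; a coset may be met several times.\<close>

lemma Gamma0_finite_cosets:
  assumes "L > 0"
  obtains R where "finite R" "R \<subseteq> SL2Z" "\<And>\<gamma>. \<gamma> \<in> SL2Z \<Longrightarrow> \<exists>r\<in>R. \<gamma> ** adjugate2 r \<in> Gamma0 L"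
proof -
  define q where "q = (\<lambda>\<gamma> :: int ^ 2 ^ 2. (\<gamma>$2$1 mod int L, \<gamma>$2$2 mod int L))"
  define R where "R = inv_into SL2Z q ` q ` SL2Z"
  have "q ` SL2Z \<subseteq> {0..<int L} \<times> {0..<int L}"
    using assms by (auto simp: q_def)
  then have "finite (q ` SL2Z)" by (rule finite_subset) simp
  then have "finite R" by (simp add: R_def)
  moreover have "R \<subseteq> SL2Z" by (auto simp: R_def intro: inv_into_into)
  moreover have "\<exists>r\<in>R. \<gamma> ** adjugate2 r \<in> Gamma0 L" if \<gamma>: "\<gamma> \<in> SL2Z" for \<gamma>
  proof
    define r where "r = inv_into SL2Z q (q \<gamma>)"
    show "r \<in> R" using \<gamma> by (simp add: R_def r_def)
    then have "r \<in> SL2Z" using \<open>R \<subseteq> SL2Z\<close> by blast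
    have "q r = q \<gamma>" unfolding r_def using \<gamma> by (intro f_inv_into_f) simp
    then have "[\<gamma>$2$1 * r$2$2 - \<gamma>$2$2 * r$2$1 = r$2$1 * r$2$2 - r$2$2 * r$2$1] (mod int L)"
      by (intro cong_diff cong_mult) (auto simp: q_def cong_def)
    then have "int L dvd (\<gamma> ** adjugate2 r)$2$1"
      by (simp add: cong_0_iff mult.commute matrix_mult_nth_2 adjugate2_def)
    then show "\<gamma> ** adjugate2 r \<in> Gamma0 L"
      using \<gamma> \<open>r \<in> SL2Z\<close> by (simp add: Gamma0_def SL2Z_def det_mul)
  qed
  ultimately show ?thesis using that by blast
qed

section \<open>Decay at the cusps\<close>

lemma periodic_of_int:
  fixes f :: "complex \<Rightarrow> complex"
  assumes per: "\<And>\<tau>. Im \<tau> > 0 \<Longrightarrow> f (\<tau> + h) = f \<tau>" and h: "Im h = 0" and \<tau>: "Im \<tau> > 0"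
  shows "f (\<tau> + of_int n * h) = f \<tau>"
proof -
  have nat: "f (\<tau> + of_nat m * h) = f \<tau>" if "Im \<tau> > 0" for m \<tau>
    by (induction m) (use per[of "\<tau> + of_nat _ * h"] that h in \<open>simp_all add: algebra_simps\<close>)
  show ?thesis
  proof (cases "n \<ge> 0")
    case True
    then show ?thesis using nat[OF \<tau>, of "nat n"] by simp
  next
    case False
    then show ?thesis using nat[of "\<tau> + of_int n * h" "nat (- n)"] \<tau> h by (simp add: of_nat_nat)
  qed
qed

text \<open>The \<open>q\<close>-expansion argument: \<open>f\<close> factors through \<open>q = exp (2 pi i \<tau> / h)\<close>, and the
  induced function on the punctured disc extends holomorphically by \<open>0\<close> to the origin.\<close>

lemma periodic_vanishing_imp_exponential_decay:
  fixes f :: "complex \<Rightarrow> complex"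
  assumes hol: "f holomorphic_on upper_half_plane" and h: "h > 0"
    and per: "\<And>\<tau>. Im \<tau> > 0 \<Longrightarrow> f (\<tau> + of_real h) = f \<tau>"
    and lim: "(f \<longlongrightarrow> 0) (filtercomap Im at_top)"
  obtains C Y where "Y \<ge> 1" "C \<ge> 0" "\<And>\<tau>. Im \<tau> \<ge> Y \<Longrightarrow> cmod (f \<tau>) \<le> C * exp (- (2 * pi / h) * Im \<tau>)"
proof -
  \<comment> \<open>With u = 2 pi i \<tau> / h one has \<tau> = \<open>s * u\<close> and q = exp u,
    and the upper half plane becomes Re u < 0.\<close>
  define s where "s = of_real h / (2 * of_real pi * \<i>)"
  have Im_s: "Im (s * u) = - h * Re u / (2 * pi)" for u
    by (simp add: s_def Im_divide field_simps power2_eq_square)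
  have "s \<noteq> 0" using h by (simp add: s_def)
  define G where "G = (\<lambda>q. if q = 0 then 0 else f (s * Ln q))"
  have G0: "G 0 = 0" by (simp add: G_def)
  \<comment> \<open>Two logarithms of q differ by a multiple of 2 pi i, so the arguments of
    \<open>f\<close> differ by a multiple of the period.\<close>
  have same: "f (s * u) = f (s * v)" if uv: "exp u = exp v" "Re u < 0" for u v
  proof -
    have "Re v = Re u" using that by (metis exp_eq_polar norm_exp_eq_Re exp_inj_iff)
    then have Im: "Im (s * v) > 0"
      unfolding Im_s using that h by (simp add: divide_less_0_iff mult_less_0_iff)
    obtain n :: int where "u = v + (of_int (2 * n) * pi) * \<i>" using uv(1) unfolding exp_eq by blast
    then have "s * u = s * v + of_int n * of_real h"
      by (simp add: s_def field_simps)
    then show ?thesis using periodic_of_int[of f "of_real h" "s * v" n] per Im by simp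
  qed
  have G_exp: "G (exp u) = f (s * u)" if "Re u < 0" for u
    using same[of u "Ln (exp u)"] that by (simp add: G_def)
  have Re_Ln_neg: "Re (Ln q) < 0" if "q \<in> ball 0 1 - {0}" for q
    using that by simp
  \<comment> \<open>\<open>Ln\<close> jumps across the negative axis, so near \<open>q0\<close> it
    is replaced by the branch \<open>l\<close>. In the ball of radius |q0| about \<open>q0\<close>
    the quotient q / q0 stays in the right half plane.\<close>
  have "G analytic_on {q0}" if q0: "q0 \<in> ball 0 1 - {0}" for q0
  proof -
    define S where "S = (ball 0 1 - {0}) \<inter> ball q0 (cmod q0)"
    define l where "l = (\<lambda>q. Ln (q / q0) + Ln q0)"
    have l: "exp (l q) = q" "Re (l q) < 0" "q / q0 \<notin> \<real>\<^sub>\<le>\<^sub>0" if "q \<in> S" for q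
    proof -
      have "q \<noteq> 0" "cmod q < 1" "cmod (q0 - q) < cmod q0" using that by (auto simp: S_def dist_norm)
      then show "exp (l q) = q" using q0 by (simp add: l_def exp_add)
      then show "Re (l q) < 0" using \<open>cmod q < 1\<close> by (metis norm_exp_eq_Re exp_less_one_iff)
      have "cmod (1 - q / q0) < 1"
        using \<open>cmod (q0 - q) < cmod q0\<close> q0 by (simp add: diff_divide_eq_iff norm_divide)
      then have "Re (q / q0) > 0"
        using complex_Re_le_cmod[of "1 - q / q0"] by simp
      then show "q / q0 \<notin> \<real>\<^sub>\<le>\<^sub>0" by (auto simp: complex_nonpos_Reals_iff)
    qed
    have "l holomorphic_on S"
      unfolding l_def using l(3) q0 by (intro holomorphic_intros) auto
    moreover have "(\<lambda>u. f (s * u)) holomorphic_on {u. Re u < 0}"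
    proof -
      have "Im (s * u) > 0" if "Re u < 0" for u
        unfolding Im_s using that h by (simp add: divide_less_0_iff mult_less_0_iff)
      then have "(*) s ` {u. Re u < 0} \<subseteq> upper_half_plane"
        by (auto simp: upper_half_plane_def simp del: times_complex.sel)
      then show ?thesis
        using holomorphic_on_compose_gen[of "(*) s" "{u. Re u < 0}" f upper_half_plane] hol
        by (auto simp: o_def)
    qed
    ultimately have "(\<lambda>q. f (s * l q)) holomorphic_on S"
      using holomorphic_on_compose_gen[of l S "\<lambda>u. f (s * u)" "{u. Re u < 0}"] l by (auto simp: o_def)
    then have "G holomorphic_on S"
      by (rule holomorphic_transform) (metis G_exp l(1,2))
    moreover have "open S" "q0 \<in> S" using q0 by (auto simp: S_def)
    ultimately show ?thesis by (auto simp: analytic_at)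
  qed
  then have "G analytic_on ball 0 1 - {0}"
    by (subst analytic_on_analytic_at) blast
  then have "G holomorphic_on ball 0 1 - {0}"
    by (rule analytic_imp_holomorphic)
  moreover have "(G \<longlongrightarrow> G 0) (at 0 within ball 0 1)"
  proof (rule tendstoI)
    fix \<epsilon> :: real assume "\<epsilon> > 0"
    with lim have "\<forall>\<^sub>F \<tau> in filtercomap Im at_top. dist (f \<tau>) 0 < \<epsilon>"
      by (rule tendstoD)
    then obtain Y where Y: "\<And>\<tau>. Im \<tau> \<ge> Y \<Longrightarrow> cmod (f \<tau>) < \<epsilon>"
      by (auto simp: eventually_filtercomap eventually_at_top_linorder)
    define \<delta> where "\<delta> = exp (- (2 * pi / h) * Y)"
    have "cmod (G q) < \<epsilon>" if "cmod q < \<delta>" for q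
    proof (cases "q = 0")
      case False
      then have "ln (cmod q) < ln \<delta>"
        using that by (subst ln_less_cancel_iff) (auto simp: \<delta>_def)
      then have "Re (Ln q) < - (2 * pi / h) * Y"
        using False by (simp add: \<delta>_def)
      then have "Im (s * Ln q) \<ge> Y" unfolding Im_s using h by (simp add: field_simps)
      then show ?thesis using Y False by (simp add: G_def)
    qed (use \<open>\<epsilon> > 0\<close> in \<open>simp add: G_def\<close>)
    then show "\<forall>\<^sub>F q in at 0 within ball 0 1. dist (G q) (G 0) < \<epsilon>"
      unfolding eventually_at by (intro exI[of _ \<delta>]) (auto simp: G0, simp add: \<delta>_def)
  qed
  ultimately have "G holomorphic_on ball 0 1"
    by (rule_tac no_isolated_singularity'[where K = "{0}"]) simp_all
  \<comment> \<open>As G vanishes at 0, G(q) / q tends to the derivative at 0, so |G(q)| is at most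
    a constant times |q| = exp (- 2 pi Im \<tau> / h).\<close>
  then have "G field_differentiable at 0"
    by (rule holomorphic_on_imp_differentiable_at) auto
  then obtain D where "(G has_field_derivative D) (at 0)"
    by (auto simp: field_differentiable_def)
  then have "((\<lambda>q. G q / q) \<longlongrightarrow> D) (at 0)"
    by (simp add: has_field_derivative_iff G0)
  then have "((\<lambda>q. cmod (G q / q)) \<longlongrightarrow> cmod D) (at 0)"
    by (rule tendsto_norm)
  then have "\<forall>\<^sub>F q in at 0. cmod (G q / q) < cmod D + 1"
    by (rule order_tendstoD) simp
  then obtain \<delta> where \<delta>: "\<delta> > 0" "\<And>q. q \<noteq> 0 \<Longrightarrow> cmod q < \<delta> \<Longrightarrow> cmod (G q / q) < cmod D + 1"
    unfolding eventually_at by auto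
  \<comment> \<open>The summand 1 makes |q| < \<open>\<delta>\<close> strict; the maximum with 1
    serves the later bound on powers of Im \<tau>.\<close>
  define Y where "Y = max 1 (1 - ln \<delta> * h / (2 * pi))"
  show ?thesis
  proof (rule that[of Y "cmod D + 1"])
    fix \<tau> assume \<tau>: "Im \<tau> \<ge> Y"
    define u where "u = \<tau> / s"
    have u: "s * u = \<tau>" using \<open>s \<noteq> 0\<close> by (simp add: u_def)
    then have Re: "Re u = - (2 * pi / h) * Im \<tau>" using Im_s[of u] h by (simp add: field_simps)
    have "Im \<tau> > 0" "Im \<tau> > - ln \<delta> * h / (2 * pi)" using \<tau> by (auto simp: Y_def)
    then have "Re u < 0" "Re u < ln \<delta>" using h unfolding Re by (auto simp: field_simps)
    then have "cmod (exp u) < \<delta>"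
      using \<delta>(1) by (simp add: norm_exp_eq_Re) (metis exp_less_cancel_iff exp_ln)
    then have "cmod (G (exp u) / exp u) < cmod D + 1" by (intro \<delta>) auto
    then have "cmod (f \<tau>) < (cmod D + 1) * cmod (exp u)"
      using G_exp[OF \<open>Re u < 0\<close>] u by (simp add: norm_divide divide_less_eq)
    then show "cmod (f \<tau>) \<le> (cmod D + 1) * exp (- (2 * pi / h) * Im \<tau>)"
      by (simp only: norm_exp_eq_Re Re less_imp_le)
  qed (auto simp: Y_def)
qed

lemma power_int_le_const_mult_exp:
  fixes k :: int and c :: real
  assumes "c > 0"
  obtains B where "\<And>y. y \<ge> 1 \<Longrightarrow> y powi k \<le> B * exp (c * y)"
proof -
  define n where "n = nat k"
  show ?thesis
  \<comment> \<open>One term of the exponential series, (c y)^n / n! <= exp (c y). A negative k is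
    replaced by n = 0, which is harmless for y >= 1.\<close>
  proof (rule that[of "fact n / c ^ n"])
    fix y :: real assume y: "y \<ge> 1"
    have "y powi k \<le> y powi int n"
      using y by (intro power_int_increasing) (auto simp: n_def)
    moreover have "(c * y) ^ n / fact n \<le> exp (c * y)"
      using sum_le_suminf[OF sums_summable[OF exp_converges[of "c * y"]], of "{n}"] sums_unique[OF exp_converges[of "c * y"]] y assms
      by (simp add: divide_inverse mult.commute)
    moreover from this have "y ^ n \<le> fact n / c ^ n * exp (c * y)"
      using assms by (simp add: field_simps)
    ultimately show "y powi k \<le> fact n / c ^ n * exp (c * y)"
      by simp
  qed
qed

text \<open>Up to height Y the bound comes from continuity on a compact rectangle, above it from
  exponential decay against a power of Im \<tau>.\<close>

lemma bounded_on_strip: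
  assumes hol: "f holomorphic_on upper_half_plane" and h: "h > 0"
    and per: "\<And>\<tau>. Im \<tau> > 0 \<Longrightarrow> f (\<tau> + of_real h) = f \<tau>"
    and lim: "(f \<longlongrightarrow> 0) (filtercomap Im at_top)"
  obtains B where "\<And>\<tau>. \<tau> \<in> strip \<Longrightarrow> (cmod (f \<tau>))\<^sup>2 * Im \<tau> powi k \<le> B"
proof -
  obtain Y C where Y: "Y \<ge> 1" "C \<ge> 0" and decay: "\<And>\<tau>. Im \<tau> \<ge> Y \<Longrightarrow> cmod (f \<tau>) \<le> C * exp (- (2 * pi / h) * Im \<tau>)"
    by (rule periodic_vanishing_imp_exponential_decay[OF hol h]) (erule per, rule lim, rule that)
  \<comment> \<open>The rate is twice the decay rate of \<open>f\<close>, so it cancels the squared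
    decay exactly.\<close>
  obtain B where B: "\<And>y. y \<ge> 1 \<Longrightarrow> y powi k \<le> B * exp (4 * pi / h * y)"
    by (rule power_int_le_const_mult_exp[of "4 * pi / h" k]) (use h in auto)
  define K where "K = cbox (Complex 0 (1/2)) (Complex 1 Y)"
  have "K \<subseteq> upper_half_plane" by (auto simp: K_def in_cbox_complex_iff upper_half_plane_def)
  then have "continuous_on K f"
    using hol holomorphic_on_imp_continuous_on continuous_on_subset by blast
  moreover have "\<forall>\<tau>\<in>K. Im \<tau> \<noteq> 0" using \<open>K \<subseteq> _\<close> by (auto simp: upper_half_plane_def)
  ultimately have "continuous_on K (\<lambda>\<tau>. (cmod (f \<tau>))\<^sup>2 * Im \<tau> powi k)"
    by (intro continuous_intros) auto
  then have "bounded ((\<lambda>\<tau>. (cmod (f \<tau>))\<^sup>2 * Im \<tau> powi k) ` K)"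
    by (intro compact_imp_bounded compact_continuous_image) (auto simp: K_def)
  then obtain B' where bd: "\<forall>x \<in> (\<lambda>\<tau>. (cmod (f \<tau>))\<^sup>2 * Im \<tau> powi k) ` K. norm x \<le> B'"
    unfolding bounded_iff by blast
  have B': "(cmod (f \<tau>))\<^sup>2 * Im \<tau> powi k \<le> B'" if "\<tau> \<in> K" for \<tau>
    using bspec[OF bd imageI[OF that]] by (simp only: real_norm_def abs_le_iff)
  show ?thesis
  proof (rule that[of "max B' (C\<^sup>2 * B)"])
    fix \<tau> assume \<tau>: "\<tau> \<in> strip"
    show "(cmod (f \<tau>))\<^sup>2 * Im \<tau> powi k \<le> max B' (C\<^sup>2 * B)"
    proof (cases "Im \<tau> \<le> Y")
      case True
      then have "\<tau> \<in> K" using \<tau> by (auto simp: K_def strip_def in_cbox_complex_iff)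
      then show ?thesis using B' by (simp add: le_max_iff_disj)
    next
      case False
      have "(cmod (f \<tau>))\<^sup>2 * Im \<tau> powi k \<le> (C * exp (- (2 * pi / h) * Im \<tau>))\<^sup>2 * (B * exp (4 * pi / h * Im \<tau>))"
        using False Y by (intro mult_mono power_mono decay B) auto
      also have "\<dots> = C\<^sup>2 * B"
        by (simp add: power_mult_distrib power2_eq_square[of "exp _"] flip: exp_add)
      finally show ?thesis by simp
    qed
  qed
qed

text \<open>Dyadic boxes: the n-th has area 2^n / 2 and density at most 4 / 4^n, so the measures are
  dominated by the geometric series 2 / 2^n. The box n = 0 begins at height 1/2, where the strip
  begins.\<close>

lemma emeasure_hyperbolic_strip: "emeasure hyperbolic strip < \<infinity>"
proof -
  define b where "b = (\<lambda>n::nat. cbox (Complex 0 (2 ^ n / 2)) (Complex 1 (2 ^ n)))"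
  have "strip \<subseteq> (\<Union>n. b n)"
  proof
    fix \<tau> assume \<tau>: "\<tau> \<in> strip"
    define n where "n = (LEAST n::nat. Im \<tau> \<le> 2 ^ n)"
    obtain m :: nat where "Im \<tau> \<le> 2 ^ m"
      using real_arch_pow[of 2 "Im \<tau>"] by (auto intro: less_imp_le)
    then have n: "Im \<tau> \<le> 2 ^ n" unfolding n_def by (rule LeastI)
    have "2 ^ n / 2 \<le> Im \<tau>"
    proof (cases n)
      case 0
      then show ?thesis using \<tau> by (simp add: strip_def)
    next
      case (Suc m)
      then have "\<not> Im \<tau> \<le> 2 ^ m" using not_less_Least[of m "\<lambda>n. Im \<tau> \<le> 2 ^ n"] by (simp add: n_def)
      then show ?thesis by (simp add: Suc)
    qed
    then show "\<tau> \<in> (\<Union>n. b n)" using n \<tau> by (auto simp: b_def in_cbox_complex_iff strip_def)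
  qed
  then have "emeasure hyperbolic strip \<le> emeasure hyperbolic (\<Union>n. b n)"
    by (intro emeasure_mono) (auto simp: b_def)
  also have "\<dots> \<le> (\<Sum>n. emeasure hyperbolic (b n))"
    by (intro emeasure_subadditive_countably) (auto simp: b_def)
  also have "\<dots> \<le> (\<Sum>n. ennreal (2 * (1 / 2) ^ n))"
  proof (intro suminf_le)
    fix n
    have "emeasure hyperbolic (b n) = (\<integral>\<^sup>+\<tau>. ennreal (indicator upper_half_plane \<tau> / (Im \<tau>)\<^sup>2) * indicator (b n) \<tau> \<partial>lborel)"
      unfolding hyperbolic_def by (subst emeasure_density) (auto simp: b_def)
    also have "\<dots> \<le> (\<integral>\<^sup>+\<tau>. ennreal (4 / (2 ^ n)\<^sup>2) * indicator (b n) \<tau> \<partial>lborel)"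
    proof (intro nn_integral_mono)
      fix \<tau>
      have "1 / (Im \<tau>)\<^sup>2 \<le> 4 / (2 ^ n)\<^sup>2" if "\<tau> \<in> b n"
      proof -
        have "2 ^ n / 2 \<le> Im \<tau>" using that by (simp add: b_def in_cbox_complex_iff)
        then have "(2 ^ n / 2)\<^sup>2 \<le> (Im \<tau>)\<^sup>2" by (intro power_mono) auto
        then have "1 / (Im \<tau>)\<^sup>2 \<le> 1 / (2 ^ n / 2)\<^sup>2"
          by (intro divide_left_mono) (auto intro!: mult_pos_pos simp: zero_less_power2 dest!: order.strict_trans2[rotated])
        then show ?thesis by (simp add: power_divide)
      qed
      then show "ennreal (indicator upper_half_plane \<tau> / (Im \<tau>)\<^sup>2) * indicator (b n) \<tau>
          \<le> ennreal (4 / (2 ^ n)\<^sup>2) * indicator (b n) \<tau>"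
        by (auto simp: indicator_def intro!: ennreal_leI)
    qed
    also have "\<dots> = ennreal (4 / (2 ^ n)\<^sup>2) * emeasure lborel (b n)"
      by (subst nn_integral_cmult_indicator) (auto simp: b_def)
    also have "emeasure lborel (b n) = ennreal (2 ^ n / 2)"
      unfolding b_def by (subst emeasure_lborel_cbox) (auto simp: Basis_complex_def)
    also have "ennreal (4 / (2 ^ n)\<^sup>2) * ennreal (2 ^ n / 2) = ennreal (2 * (1 / 2) ^ n)"
      by (simp add: power_one_over field_simps power2_eq_square flip: ennreal_mult)
    finally show "emeasure hyperbolic (b n) \<le> ennreal (2 * (1 / 2) ^ n)" .
  qed auto
  also have "\<dots> = ennreal (\<Sum>n. 2 * (1 / 2) ^ n)"
    by (rule suminf_ennreal2) (auto intro!: summable_mult)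
  also have "\<dots> < \<infinity>" by simp
  finally show ?thesis .
qed

section \<open>Finiteness of the Petersson integral\<close>

lemma dirichlet_character_one:
  assumes "dirichlet_character N chi"
  shows "chi 1 = 1"
proof -
  have "chi 1 * chi 1 = chi (1 * 1)" "chi 1 \<noteq> 0"
    using assms unfolding dirichlet_character_def by (metis, simp)
  then show ?thesis by simp
qed

lemma dirichlet_character_add_mult:
  assumes "dirichlet_character N chi"
  shows "chi (a + int N * m) = chi a"
proof -
  have step: "chi (a + int N) = chi a" for a
    using assms by (simp add: dirichlet_character_def)
  have nat: "chi (a + int N * int m) = chi a" for a m
    by (induction m) (use step[of "a + int N * int _"] in \<open>simp_all add: algebra_simps\<close>)
  show ?thesis
  proof (cases "m \<ge> 0")
    case True
    then show ?thesis using nat[of a "nat m"] by simp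
  next
    case False
    then show ?thesis using nat[of "a + int N * m" "nat (- m)"] by simp
  qed
qed

lemma dirichlet_character_cong:
  assumes "dirichlet_character N chi" "[a = b] (mod int N)"
  shows "chi a = chi b"
proof -
  obtain m where "b = a + int N * m"
    using assms(2) by (auto simp: cong_iff_lin)
  then show ?thesis using dirichlet_character_add_mult[OF assms(1)] by simp
qed

text \<open>By Euler's theorem the value is a root of unity. It serves to make the product of one
  form with the conjugate of another invariant in spite of the character.\<close>

lemma norm_dirichlet_character:
  assumes chi: "dirichlet_character N chi" and N: "N > 0" and a: "coprime a (int N)"
  shows "cmod (chi a) = 1"
proof -
  define n where "n = nat (a mod int N)"
  have n: "int n = a mod int N" using N by (simp add: n_def)
  then have eq: "chi a = chi (int n)"
    by (intro dirichlet_character_cong[OF chi]) (simp add: cong_def)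
  have "coprime (a mod int N) (int N)"
    using a N by (simp add: coprime_iff_gcd_eq_1 gcd.commute flip: gcd_red_int)
  then have "coprime n N"
    by (simp flip: n)
  then have "[int n ^ totient N = 1] (mod int N)"
    using euler_theorem[of n N] by (simp flip: cong_int_iff)
  then have "chi (int n ^ totient N) = 1"
    using dirichlet_character_cong[OF chi] dirichlet_character_one[OF chi] by metis
  moreover have "chi (x ^ m) = chi x ^ m" for x m
    using chi by (induction m) (auto simp: dirichlet_character_one[OF chi] dirichlet_character_def)
  ultimately have "cmod (chi (int n)) ^ totient N = 1"
    by (metis norm_one norm_power)
  then have "cmod (chi (int n)) = 1"
    using N power_eq_imp_eq_base[of "cmod (chi (int n))" "totient N" 1] by simp
  then show ?thesis by (simp add: eq)
qed

lemma dirichlet_character_mult_cnj: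
  assumes "dirichlet_character N chi" "N > 0" "coprime a (int N)"
  shows "chi a * cnj (chi a) = 1"
  using norm_dirichlet_character[OF assms] by (simp add: complex_norm_square[symmetric])

lemma Gamma0_coprime:
  assumes "\<gamma> \<in> Gamma0 N"
  shows "coprime (\<gamma>$2$2) (int N)"
proof (rule coprimeI)
  fix c assume c: "c dvd \<gamma>$2$2" "c dvd int N"
  have \<gamma>: "int N dvd \<gamma>$2$1" "\<gamma>$1$1 * \<gamma>$2$2 - \<gamma>$1$2 * \<gamma>$2$1 = 1"
    using assms by (auto simp: Gamma0_def SL2Z_def det_2)
  have "c dvd \<gamma>$1$1 * \<gamma>$2$2 - \<gamma>$1$2 * \<gamma>$2$1"
    by (intro dvd_diff dvd_mult c(1) dvd_trans[OF c(2) \<gamma>(1)])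
  then show "is_unit c" by (simp add: \<gamma>(2))
qed

lemma Gamma0_mono: "N dvd M \<Longrightarrow> Gamma0 M \<subseteq> Gamma0 N"
  by (auto simp: Gamma0_def intro: dvd_trans[of "int N" "int M"])

text \<open>The exponent is k because \<open>hyperbolic\<close> carries the missing y^(-2). Values
  of forms off the upper half plane are arbitrary; setting the density to 0 there makes it Borel
  measurable.\<close>

definition petersson_density ::
    "int \<Rightarrow> (complex \<Rightarrow> complex) \<Rightarrow> (complex \<Rightarrow> complex) \<Rightarrow> complex \<Rightarrow> complex" where
  "petersson_density k f g \<tau> =
     (if Im \<tau> > 0 then f \<tau> * cnj (g \<tau>) * of_real (Im \<tau> powi k) else 0)"

lemma measurable_petersson_density:
  assumes "continuous_on upper_half_plane f" "continuous_on upper_half_plane g"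
  shows "petersson_density k f g \<in> borel_measurable borel"
proof -
  have "continuous_on upper_half_plane (\<lambda>\<tau>. f \<tau> * cnj (g \<tau>) * of_real (Im \<tau> powi k))"
    using assms by (auto intro!: continuous_intros simp: upper_half_plane_def)
  then have "(\<lambda>\<tau>. indicator upper_half_plane \<tau> *\<^sub>R (f \<tau> * cnj (g \<tau>) * of_real (Im \<tau> powi k))) \<in> borel_measurable borel"
    by (intro borel_measurable_continuous_on_indicator) auto
  also have "(\<lambda>\<tau>. indicator upper_half_plane \<tau> *\<^sub>R (f \<tau> * cnj (g \<tau>) * of_real (Im \<tau> powi k))) = petersson_density k f g"
    by (auto simp: petersson_density_def upper_half_plane_def fun_eq_iff)
  finally show ?thesis .
qed

lemma petersson_density_mobius:
  assumes "det \<gamma> > 0" "Im \<tau> > 0"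
  shows "petersson_density k f g (mobius \<gamma> \<tau>) = petersson_density k (slash k f \<gamma>) (slash k g \<gamma>) \<tau>"
  using norm_slash[OF assms] mobius_in_upper_half_plane[OF assms] assms
  by (simp add: petersson_density_def)

lemma cusp_formsD:
  assumes "f \<in> cusp_forms k N chi"
  shows "f holomorphic_on upper_half_plane"
    and "\<lbrakk>\<gamma> \<in> Gamma0 N; Im \<tau> > 0\<rbrakk> \<Longrightarrow> slash k f (real_mat \<gamma>) \<tau> = chi (\<gamma>$2$2) * f \<tau>"
    and "\<gamma> \<in> SL2Z \<Longrightarrow> (slash k f (real_mat \<gamma>) \<longlongrightarrow> 0) (filtercomap Im at_top)"
  using assms by (auto simp: cusp_forms_def upper_half_plane_def)

lemma petersson_density_invariant:
  assumes chi: "dirichlet_character N chi" "N > 0"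
    and f: "f \<in> cusp_forms k N chi" and g: "g \<in> cusp_forms k N chi"
    and \<gamma>: "\<gamma> \<in> Gamma0 N" "Im \<tau> > 0"
  shows "petersson_density k f g (act \<gamma> \<tau>) = petersson_density k f g \<tau>"
proof -
  have "chi (\<gamma>$2$2) * cnj (chi (\<gamma>$2$2)) = 1"
    by (intro dirichlet_character_mult_cnj[OF chi] Gamma0_coprime \<gamma>(1))
  moreover have "petersson_density k f g (act \<gamma> \<tau>) =
      petersson_density k (slash k f (real_mat \<gamma>)) (slash k g (real_mat \<gamma>)) \<tau>"
    using \<gamma> by (intro petersson_density_mobius) (simp_all add: det_Gamma0)
  moreover have "\<dots> = (chi (\<gamma>$2$2) * cnj (chi (\<gamma>$2$2))) * petersson_density k f g \<tau>"
    unfolding petersson_density_def by (simp add: cusp_formsD(2)[OF f \<gamma>] cusp_formsD(2)[OF g \<gamma>])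
  ultimately show ?thesis by simp
qed

lemma holomorphic_slash:
  assumes f: "f holomorphic_on upper_half_plane" and \<gamma>: "det \<gamma> > 0"
  shows "slash k f \<gamma> holomorphic_on upper_half_plane"
proof -
  have "mobius \<gamma> holomorphic_on upper_half_plane"
    using has_field_derivative_mobius[OF \<gamma>]
    by (auto simp: holomorphic_on_def upper_half_plane_def field_differentiable_def intro: has_field_derivative_at_within)
  then have "(\<lambda>\<tau>. f (mobius \<gamma> \<tau>)) holomorphic_on upper_half_plane"
    using holomorphic_on_compose_gen[OF _ f] mobius_in_upper_half_plane[OF \<gamma>]
    by (auto simp: o_def upper_half_plane_def)
  moreover have "of_real (\<gamma>$2$1) * \<tau> + of_real (\<gamma>$2$2) \<noteq> 0" if "\<tau> \<in> upper_half_plane" for \<tau>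
    using automorphy_nonzero[of \<gamma> \<tau>] that \<gamma> by (simp add: automorphy_def upper_half_plane_def)
  ultimately show ?thesis
    unfolding slash_def[abs_def] by (intro holomorphic_intros) auto
qed

text \<open>Conjugating the translation by N with r gives a matrix congruent to the identity modulo
  N, at which the character is 1. So N is a period at every cusp at once.\<close>

lemma slash_periodic:
  assumes chi: "dirichlet_character N chi" and f: "f \<in> cusp_forms k N chi"
    and r: "r \<in> SL2Z" and \<tau>: "Im \<tau> > 0"
  shows "slash k f (real_mat r) (\<tau> + of_real (real N)) = slash k f (real_mat r) \<tau>"
proof -
  define t where "t = (mat2 1 (int N) 0 1 :: int ^ 2 ^ 2)"
  define \<gamma> where "\<gamma> = r ** t ** adjugate2 r"
  have det: "det r = 1" "det t = 1" using r by (auto simp: SL2Z_def t_def det_2)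
  have r22: "\<gamma>$2$1 = int N * (- (r$2$1 * r$2$1))"
    by (simp add: \<gamma>_def t_def matrix_mult_nth_2 adjugate2_def algebra_simps)
  have "\<gamma>$2$2 = r$1$1 * r$2$2 - r$1$2 * r$2$1 + int N * (r$1$1 * r$2$1)"
    by (simp add: \<gamma>_def t_def matrix_mult_nth_2 adjugate2_def algebra_simps)
  then have "\<gamma>$2$2 = 1 + int N * (r$1$1 * r$2$1)"
    using det(1) by (simp add: det_2)
  then have chi1: "chi (\<gamma>$2$2) = 1"
    by (simp only: dirichlet_character_add_mult[OF chi] dirichlet_character_one[OF chi])
  have \<gamma>: "\<gamma> \<in> Gamma0 N"
    using det by (simp add: Gamma0_def SL2Z_def r22) (simp add: \<gamma>_def det_mul)
  have rt: "r ** t = \<gamma> ** r"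
    by (simp add: \<gamma>_def matrix_adjugate2[OF det(1)] flip: matrix_mul_assoc)
  have "slash k f (real_mat r) (\<tau> + of_real (real N)) = slash k (slash k f (real_mat r)) (real_mat t) \<tau>"
    by (simp add: slash_def[of k "slash k f _"] t_def det_2 mobius_def)
  also have "\<dots> = slash k f (real_mat r ** real_mat t) \<tau>"
    using det \<tau> by (intro slash_mult[symmetric]) auto
  also have "\<dots> = slash k (slash k f (real_mat \<gamma>)) (real_mat r) \<tau>"
    unfolding real_mat_mult[symmetric] rt unfolding real_mat_mult
    using det \<tau> det_Gamma0[OF \<gamma>] by (intro slash_mult) auto
  also have "\<dots> = slash k f (real_mat r) \<tau>"
    using det \<tau> cusp_formsD(2)[OF f \<gamma>] chi1 by (intro slash_cong) auto
  finally show ?thesis .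
qed

lemma cmod_petersson_density_diag:
  "Im \<tau> > 0 \<Longrightarrow> cmod (petersson_density k f f \<tau>) = (cmod (f \<tau>))\<^sup>2 * Im \<tau> powi k"
  by (simp add: petersson_density_def norm_mult power2_eq_square norm_power_int)

text \<open>D may reach into the cusps in any manner, so its integral is unfolded against the weight
  \<open>w\<close>, the sum of the indicators of the images of the strip under finitely many coset
  representatives. The orbit sum of \<open>w\<close> is at least 1, so the integral over D is at
  most 2 times the integral of \<open>w * F\<close>. Each of its terms is an integral over the strip
  of a slashed form, which is bounded there, and the strip has finite area.\<close>

lemma nn_integral_petersson_density_finite:
  assumes chi: "dirichlet_character N chi" "N > 0"
    and f: "f \<in> cusp_forms k N chi"
    and L: "N dvd L" "L > 0" and D: "fundamental_domain (Gamma0 L) D"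
  shows "(\<integral>\<^sup>+\<tau>. indicator D \<tau> * ennreal (cmod (petersson_density k f f \<tau>)) \<partial>hyperbolic) < \<infinity>"
proof -
  define F where "F = (\<lambda>\<tau>. ennreal (cmod (petersson_density k f f \<tau>)))"
  have cont: "continuous_on upper_half_plane f"
    using cusp_formsD(1)[OF f] by (rule holomorphic_on_imp_continuous_on)
  have F [measurable]: "F \<in> borel_measurable borel"
    unfolding F_def using measurable_petersson_density[OF cont cont] by measurable
  have D' [measurable]: "D \<in> sets borel" using D by (simp add: fundamental_domain_def)
  have strip [measurable]: "strip \<in> sets borel"
    unfolding strip_def by measurable
  have inv: "F (act \<gamma> \<tau>) = F \<tau>" if "\<gamma> \<in> Gamma0 L" "Im \<tau> > 0" for \<gamma> \<tau>
    using petersson_density_invariant[OF chi f f] that Gamma0_mono[OF L(1)] by (auto simp: F_def)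
  obtain R where R: "finite R" "R \<subseteq> SL2Z" "\<And>\<gamma>. \<gamma> \<in> SL2Z \<Longrightarrow> \<exists>r\<in>R. \<gamma> ** adjugate2 r \<in> Gamma0 L"
    using Gamma0_finite_cosets[OF L(2)] by blast
  define w :: "complex \<Rightarrow> ennreal" where "w = (\<lambda>\<tau>. \<Sum>r\<in>R. indicator strip (act (adjugate2 r) \<tau>))"
  have w [measurable]: "w \<in> borel_measurable borel"
    unfolding w_def by measurable
  have cover: "(\<integral>\<^sup>+\<delta>. w (act \<delta> \<tau>) \<partial>count_space (Gamma0 L)) \<ge> 1" if \<tau>: "Im \<tau> > 0" for \<tau>
  proof -
    obtain \<gamma> where \<gamma>: "\<gamma> \<in> Gamma0 1" "act \<gamma> \<tau> \<in> strip"
      using orbit_meets_ford_domain[OF \<tau>, of 1] ford_domain_SL2Z_subset_strip by blast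
    then obtain r where r: "r \<in> R" "adjugate2 \<gamma> ** adjugate2 r \<in> Gamma0 L"
      using R(3)[of "adjugate2 \<gamma>"] Gamma0_adjugate2[OF \<gamma>(1)] by (auto simp: SL2Z_eq_Gamma0)
    define \<delta> where "\<delta> = r ** \<gamma>"
    have r1: "r \<in> Gamma0 1" using r R(2) by (auto simp: SL2Z_eq_Gamma0)
    have \<delta>: "\<delta> \<in> Gamma0 L"
      using Gamma0_adjugate2[OF r(2)] by (simp add: \<delta>_def adjugate2_mult)
    have "act (adjugate2 r) (act \<delta> \<tau>) = act \<gamma> \<tau>"
      unfolding \<delta>_def act_mult[OF r1 \<gamma>(1) \<tau>]
      using act_adjugate2(1)[OF r1] act_in_upper_half_plane[OF \<gamma>(1) \<tau>] by simp
    then have "1 = (indicator strip (act (adjugate2 r) (act \<delta> \<tau>)) :: ennreal)"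
      using \<gamma>(2) by simp
    also have "\<dots> \<le> w (act \<delta> \<tau>)"
      unfolding w_def using R(1) r(1) by (intro member_le_sum) auto
    also have "\<dots> = (\<integral>\<^sup>+\<epsilon>. w (act \<delta> \<tau>) * indicator {\<delta>} \<epsilon> \<partial>count_space (Gamma0 L))"
      using \<delta> by (simp add: nn_integral_cmult_indicator)
    also have "\<dots> \<le> (\<integral>\<^sup>+\<epsilon>. w (act \<epsilon> \<tau>) \<partial>count_space (Gamma0 L))"
      by (intro nn_integral_mono) (auto simp: indicator_def)
    finally show ?thesis .
  qed
  have "(\<integral>\<^sup>+\<tau>. indicator D \<tau> * F \<tau> \<partial>hyperbolic) \<le>
      (\<integral>\<^sup>+\<tau>. (indicator D \<tau> * F \<tau>) * (\<integral>\<^sup>+\<delta>. w (act \<delta> \<tau>) \<partial>count_space (Gamma0 L)) \<partial>hyperbolic)"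
    using AE_hyperbolic_upper_half_plane
  proof (intro nn_integral_mono_AE, eventually_elim)
    fix \<tau> assume "Im \<tau> > 0"
    from mult_left_mono[OF cover[OF this], of "indicator D \<tau> * F \<tau>"]
    show "indicator D \<tau> * F \<tau> \<le> (indicator D \<tau> * F \<tau>) * (\<integral>\<^sup>+\<delta>. w (act \<delta> \<tau>) \<partial>count_space (Gamma0 L))"
      by simp
  qed
  also have "\<dots> = (\<integral>\<^sup>+\<tau>. w \<tau> * (\<integral>\<^sup>+\<gamma>. indicator D (act \<gamma> \<tau>) * F (act \<gamma> \<tau>) \<partial>count_space (Gamma0 L)) \<partial>hyperbolic)"
    by (rule nn_integral_unfold_swap) auto
  also have "\<dots> = (\<integral>\<^sup>+\<tau>. 2 * (w \<tau> * F \<tau>) \<partial>hyperbolic)"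
    using AE_orbit_meets_fundamental_domain_twice[OF D] AE_hyperbolic_upper_half_plane
  proof (intro nn_integral_cong_AE, eventually_elim)
    fix \<tau> assume \<tau>: "(\<integral>\<^sup>+\<gamma>. indicator D (act \<gamma> \<tau>) \<partial>count_space (Gamma0 L)) = 2" "Im \<tau> > 0"
    have "(\<integral>\<^sup>+\<gamma>. indicator D (act \<gamma> \<tau>) * F (act \<gamma> \<tau>) \<partial>count_space (Gamma0 L)) =
        (\<integral>\<^sup>+\<gamma>. indicator D (act \<gamma> \<tau>) * F \<tau> \<partial>count_space (Gamma0 L))"
      using \<tau> inv by (intro nn_integral_cong) simp
    also have "\<dots> = 2 * F \<tau>" using \<tau> by (subst nn_integral_multc) auto
    finally show "w \<tau> * (\<integral>\<^sup>+\<gamma>. indicator D (act \<gamma> \<tau>) * F (act \<gamma> \<tau>) \<partial>count_space (Gamma0 L)) = 2 * (w \<tau> * F \<tau>)"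
      by (simp add: mult_ac)
  qed
  also have "\<dots> = 2 * (\<Sum>r\<in>R. \<integral>\<^sup>+\<tau>. indicator strip (act (adjugate2 r) \<tau>) * F \<tau> \<partial>hyperbolic)"
    unfolding w_def sum_distrib_right by (subst nn_integral_cmult, simp, subst nn_integral_sum) auto
  also have "\<dots> < \<infinity>"
  proof -
    have "(\<integral>\<^sup>+\<tau>. indicator strip (act (adjugate2 r) \<tau>) * F \<tau> \<partial>hyperbolic) < \<infinity>" if "r \<in> R" for r
    proof -
      have r: "r \<in> Gamma0 1" "r \<in> SL2Z" "det r = 1" using that R(2) by (auto simp: SL2Z_eq_Gamma0 det_Gamma0)
      define \<phi> where "\<phi> = slash k f (real_mat r)"
      obtain B where B: "\<And>\<tau>. \<tau> \<in> strip \<Longrightarrow> (cmod (\<phi> \<tau>))\<^sup>2 * Im \<tau> powi k \<le> B"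
      proof (rule bounded_on_strip[of \<phi> "real N" k])
        show "\<phi> holomorphic_on upper_half_plane"
          unfolding \<phi>_def using r by (intro holomorphic_slash cusp_formsD(1)[OF f]) auto
        show "\<phi> (\<tau> + of_real (real N)) = \<phi> \<tau>" if "Im \<tau> > 0" for \<tau>
          unfolding \<phi>_def by (rule slash_periodic[OF chi(1) f r(2) that])
        show "(\<phi> \<longlongrightarrow> 0) (filtercomap Im at_top)"
          unfolding \<phi>_def by (rule cusp_formsD(3)[OF f r(2)])
      qed (use chi in auto)
      have "(\<integral>\<^sup>+\<tau>. indicator strip (act (adjugate2 r) \<tau>) * F \<tau> \<partial>hyperbolic) =
          (\<integral>\<^sup>+\<tau>. indicator strip (act (adjugate2 r) (act r \<tau>)) * F (act r \<tau>) \<partial>hyperbolic)"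
        using r by (subst nn_integral_hyperbolic_mobius[symmetric, of "real_mat r"]) auto
      also have "\<dots> \<le> (\<integral>\<^sup>+\<tau>. ennreal B * indicator strip \<tau> \<partial>hyperbolic)"
        using AE_hyperbolic_upper_half_plane
      proof (intro nn_integral_mono_AE, eventually_elim)
        fix \<tau> assume \<tau>: "Im \<tau> > 0"
        have "F (act r \<tau>) = ennreal ((cmod (\<phi> \<tau>))\<^sup>2 * Im \<tau> powi k)"
          using \<tau> r by (simp add: F_def petersson_density_mobius cmod_petersson_density_diag \<phi>_def)
        then show "indicator strip (act (adjugate2 r) (act r \<tau>)) * F (act r \<tau>) \<le> ennreal B * indicator strip \<tau>"
          using B[of \<tau>] \<tau> by (auto simp: act_adjugate2(1)[OF r(1)] indicator_def intro!: ennreal_leI)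
      qed
      also have "\<dots> = ennreal B * emeasure hyperbolic strip"
        by (rule nn_integral_cmult_indicator) simp
      also have "\<dots> < \<infinity>"
        using emeasure_hyperbolic_strip by (simp add: ennreal_mult_less_top)
      finally show ?thesis .
    qed
    then show ?thesis
      using R(1) by (simp add: ennreal_mult_less_top)
  qed
  finally show ?thesis by (simp add: F_def)
qed

section \<open>The Atkin--Lehner involution and the cosets of the level\<close>

lemma matrix_mult_adjugate2:
  "A ** adjugate2 A = mat (det A)" "adjugate2 A ** A = mat (det A)" for A :: "int ^ 2 ^ 2"
  by (simp_all add: adjugate2_def mat2_eq_iff matrix_mult_nth_2 det_2 algebra_simps)

lemma matrix_mult_left_cancel_int:
  fixes A B W :: "int ^ 2 ^ 2"
  assumes "W ** A = W ** B" "det W \<noteq> 0"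
  shows "A = B"
proof -
  have "mat (det W) ** A = mat (det W) ** B"
    using arg_cong[OF assms(1), of "\<lambda>X. adjugate2 W ** X"] by (simp add: matrix_mul_assoc matrix_mult_adjugate2)
  then show ?thesis using assms(2) by (simp add: mat2_eq_iff matrix_mult_nth_2)
qed

lemma matrix_mult_right_cancel_int:
  fixes A B W :: "int ^ 2 ^ 2"
  assumes "A ** W = B ** W" "det W \<noteq> 0"
  shows "A = B"
proof -
  have "A ** mat (det W) = B ** mat (det W)"
    using arg_cong[OF assms(1), of "\<lambda>X. X ** adjugate2 W"] by (simp add: matrix_mult_adjugate2 flip: matrix_mul_assoc)
  then show ?thesis using assms(2) by (simp add: mat2_eq_iff matrix_mult_nth_2)
qed

text \<open>The relation says that the matrix with rows (x, y) and (N, p) has determinant 1; through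
  it the coprimality of p and N enters all explicit matrices.\<close>

locale bezout_level =
  fixes N p :: nat and x y :: int
  assumes N_pos: "N > 0" and prime_p: "prime p" and bezout: "x * int p - y * int N = 1"
begin

lemma p_pos: "p > 0"
  using prime_p by (rule prime_gt_0_nat)

lemma not_p_dvd_N: "\<not> int p dvd int N"
proof
  assume "int p dvd int N"
  then have "int p dvd x * int p - y * int N" by (intro dvd_diff dvd_mult) auto
  then show False using prime_p by (simp add: bezout)
qed

text \<open>The Atkin--Lehner matrix at \<open>p\<close>: it is \<open>bezout_matrix\<close> times \<open>diag(p, 1)\<close>, where
  \<open>bezout_matrix\<close> lies in \<open>\<Gamma>\<^sub>0(N)\<close>, and it normalizes \<open>\<Gamma>\<^sub>0(Np)\<close>.\<close>

definition atkin_lehner :: "int ^ 2 ^ 2" where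
  "atkin_lehner = mat2 (x * int p) y (int N * int p) (int p)"

definition bezout_matrix :: "int ^ 2 ^ 2" where
  "bezout_matrix = mat2 x y (int N) (int p)"

lemma bezout_matrix_Gamma0: "bezout_matrix \<in> Gamma0 N"
  using bezout by (simp add: bezout_matrix_def Gamma0_def SL2Z_def det_2)

lemma det_atkin_lehner: "det atkin_lehner = int p"
proof -
  have "det atkin_lehner = (x * int p - y * int N) * int p"
    by (simp add: atkin_lehner_def det_2 algebra_simps)
  then show ?thesis by (simp add: bezout)
qed

text \<open>With W the Atkin--Lehner matrix, all entries of adj(W) \<gamma> W and of W \<gamma>
  adj(W) are divisible by p, and the lower left ones by N p^2, so both conjugates are integral of
  level Np. The determinant follows from multiplicativity.\<close>

lemma atkin_lehner_conj:
  assumes "\<gamma> \<in> Gamma0 (N * p)"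
  shows "\<exists>\<kappa>\<in>Gamma0 (N * p). atkin_lehner ** \<kappa> = \<gamma> ** atkin_lehner"
    and "\<exists>\<kappa>\<in>Gamma0 (N * p). \<kappa> ** atkin_lehner = atkin_lehner ** \<gamma>"
proof -
  obtain A B C D where \<gamma>: "\<gamma> = mat2 A B (int N * int p * C) D" and det: "A * D - B * (int N * int p * C) = 1"
  proof -
    obtain C where C: "\<gamma>$2$1 = int N * int p * C"
      using assms by (auto simp: Gamma0_def elim!: dvdE)
    have "\<gamma>$1$1 * \<gamma>$2$2 - \<gamma>$1$2 * (int N * int p * C) = 1"
      using assms unfolding C[symmetric] by (simp add: Gamma0_def SL2Z_def det_2)
    moreover have "\<gamma> = mat2 (\<gamma>$1$1) (\<gamma>$1$2) (int N * int p * C) (\<gamma>$2$2)"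
      by (simp add: mat2_eq_iff C)
    ultimately show thesis by (intro that) auto
  qed
  define n q where "n = int N" and "q = int p"
  have xy: "x * q - y * n = 1" using bezout by (simp add: n_def q_def)
  have detW: "det \<kappa> = 1" if "atkin_lehner ** \<kappa> = \<gamma> ** atkin_lehner \<or> \<kappa> ** atkin_lehner = atkin_lehner ** \<gamma>" for \<kappa>
  proof -
    have "det atkin_lehner * det \<kappa> = det atkin_lehner * det \<gamma>"
      using that by (metis det_mul mult.commute)
    then show ?thesis using det_Gamma0[OF assms] p_pos by (simp add: det_atkin_lehner)
  qed
  \<comment> \<open>The entries of adj(W) \<gamma> W divided by p.\<close>
  define \<kappa> where "\<kappa> = mat2 (A * x * q + B * n * q - y * (n * q * C * x + D * n)) (A * y + B * q - y * (n * C * y) - y * D)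
     (n * q * (- A * x - B * n + x * x * q * C + D * x)) (- n * (A * y + B * q) + x * (n * q * C * y + D * q))"
  have W: "atkin_lehner = mat2 (x * q) y (n * q) q" and \<gamma>': "\<gamma> = mat2 A B (n * q * C) D"
    by (simp_all add: atkin_lehner_def \<gamma> n_def q_def)
  \<comment> \<open>Keeping the factor x q - y n makes these polynomial identities, free of side
    conditions; it is set to 1 afterwards.\<close>
  have "(atkin_lehner ** \<kappa>)$1$1 = (x * q - y * n) * (\<gamma> ** atkin_lehner)$1$1"
    "(atkin_lehner ** \<kappa>)$1$2 = (x * q - y * n) * (\<gamma> ** atkin_lehner)$1$2"
    "(atkin_lehner ** \<kappa>)$2$1 = (x * q - y * n) * (\<gamma> ** atkin_lehner)$2$1"
    "(atkin_lehner ** \<kappa>)$2$2 = (x * q - y * n) * (\<gamma> ** atkin_lehner)$2$2"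
    unfolding matrix_mult_nth_2 W \<gamma>' \<kappa>_def mat2_nth by (simp_all add: algebra_simps)
  then have 1: "atkin_lehner ** \<kappa> = \<gamma> ** atkin_lehner"
    by (simp add: mat2_eq_iff xy)
  have "\<kappa> \<in> Gamma0 (N * p)"
    using detW[of \<kappa>] 1 by (simp add: Gamma0_def SL2Z_def) (simp add: \<kappa>_def n_def q_def)
  then show "\<exists>\<kappa>\<in>Gamma0 (N * p). atkin_lehner ** \<kappa> = \<gamma> ** atkin_lehner"
    using 1 by blast
  \<comment> \<open>The entries of W \<gamma> adj(W) divided by p.\<close>
  define \<kappa>' where "\<kappa>' = mat2 (x * q * A + y * (n * q * C) - n * (x * q * B + y * D))
      (- x * y * A - y * y * (n * C) + x * x * q * B + x * y * D)
     (n * q * (A + q * C - n * B - D)) (- y * (n * A + n * q * C) + x * (n * q * B + q * D))"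
  have "(\<kappa>' ** atkin_lehner)$1$1 = (x * q - y * n) * (atkin_lehner ** \<gamma>)$1$1"
    "(\<kappa>' ** atkin_lehner)$1$2 = (x * q - y * n) * (atkin_lehner ** \<gamma>)$1$2"
    "(\<kappa>' ** atkin_lehner)$2$1 = (x * q - y * n) * (atkin_lehner ** \<gamma>)$2$1"
    "(\<kappa>' ** atkin_lehner)$2$2 = (x * q - y * n) * (atkin_lehner ** \<gamma>)$2$2"
    unfolding matrix_mult_nth_2 W \<gamma>' \<kappa>'_def mat2_nth by (simp_all add: algebra_simps)
  then have 2: "\<kappa>' ** atkin_lehner = atkin_lehner ** \<gamma>"
    by (simp add: mat2_eq_iff xy)
  have "\<kappa>' \<in> Gamma0 (N * p)"
    using detW[of \<kappa>'] 2 by (simp add: Gamma0_def SL2Z_def) (simp add: \<kappa>'_def n_def q_def)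
  then show "\<exists>\<kappa>\<in>Gamma0 (N * p). \<kappa> ** atkin_lehner = atkin_lehner ** \<gamma>"
    using 2 by blast
qed

text \<open>Conjugation in the opposite direction is the inverse map; stating the relation with
  \<open>adjugate2\<close> avoids denominators.\<close>

lemma atkin_lehner_conj_bij:
  obtains \<kappa> where "bij_betw \<kappa> (Gamma0 (N * p)) (Gamma0 (N * p))"
    "\<And>\<gamma>. \<gamma> \<in> Gamma0 (N * p) \<Longrightarrow> adjugate2 atkin_lehner ** \<gamma> = \<kappa> \<gamma> ** adjugate2 atkin_lehner"
proof -
  let ?W = atkin_lehner
  have nz: "det ?W \<noteq> 0" using p_pos by (simp add: det_atkin_lehner)
  obtain \<kappa> where \<kappa>: "\<And>\<gamma>. \<gamma> \<in> Gamma0 (N * p) \<Longrightarrow> \<kappa> \<gamma> \<in> Gamma0 (N * p) \<and> ?W ** \<kappa> \<gamma> = \<gamma> ** ?W"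
    using atkin_lehner_conj(1) by metis
  obtain \<kappa>' where \<kappa>': "\<And>\<gamma>. \<gamma> \<in> Gamma0 (N * p) \<Longrightarrow> \<kappa>' \<gamma> \<in> Gamma0 (N * p) \<and> \<kappa>' \<gamma> ** ?W = ?W ** \<gamma>"
    using atkin_lehner_conj(2) by metis
  show ?thesis
  proof (rule that)
    show "bij_betw \<kappa> (Gamma0 (N * p)) (Gamma0 (N * p))"
    proof (rule bij_betwI[of _ _ _ \<kappa>'])
      show "\<kappa>' (\<kappa> \<gamma>) = \<gamma>" if "\<gamma> \<in> Gamma0 (N * p)" for \<gamma>
        by (rule matrix_mult_right_cancel_int[of _ ?W]) (use \<kappa> \<kappa>' that nz in auto)
      show "\<kappa> (\<kappa>' \<gamma>) = \<gamma>" if "\<gamma> \<in> Gamma0 (N * p)" for \<gamma>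
        by (rule matrix_mult_left_cancel_int[of ?W]) (use \<kappa> \<kappa>' that nz in auto)
    qed (use \<kappa> \<kappa>' in auto)
    show "adjugate2 ?W ** \<gamma> = \<kappa> \<gamma> ** adjugate2 ?W" if "\<gamma> \<in> Gamma0 (N * p)" for \<gamma>
    proof (rule matrix_mult_left_cancel_int[OF _ nz])
      have "?W ** (adjugate2 ?W ** \<gamma>) = mat (det ?W) ** \<gamma>"
        by (simp add: matrix_mul_assoc matrix_mult_adjugate2)
      also have "\<dots> = \<gamma> ** mat (det ?W)"
        by (simp add: mat2_eq_iff matrix_mult_nth_2)
      also have "\<dots> = (\<gamma> ** ?W) ** adjugate2 ?W"
        by (simp add: matrix_mult_adjugate2 flip: matrix_mul_assoc)
      also have "\<gamma> ** ?W = ?W ** \<kappa> \<gamma>" using \<kappa>[OF that] by simp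
      finally show "?W ** (adjugate2 ?W ** \<gamma>) = ?W ** (\<kappa> \<gamma> ** adjugate2 ?W)"
        by (simp add: matrix_mul_assoc)
    qed
  qed
qed

text \<open>The indicator \<open>v\<close> of the image of D is again a weight with constant 2:
  conjugation permutes the group, so its orbit sum at \<tau> is that of D at the inverse image of
  \<tau>.\<close>

lemma nn_integral_atkin_lehner:
  assumes D: "fundamental_domain (Gamma0 (N * p)) D"
    and F [measurable]: "F \<in> borel_measurable borel"
    and inv: "\<And>\<gamma> \<tau>. \<lbrakk>\<gamma> \<in> Gamma0 (N * p); Im \<tau> > 0\<rbrakk> \<Longrightarrow> F (act \<gamma> \<tau>) = F \<tau>"
  shows "(\<integral>\<^sup>+\<tau>. indicator D \<tau> * F (act atkin_lehner \<tau>) \<partial>hyperbolic) =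
         (\<integral>\<^sup>+\<tau>. indicator D \<tau> * F \<tau> \<partial>hyperbolic)"
proof -
  let ?W = atkin_lehner
  have W: "det (real_mat ?W) > 0" "det (real_mat (adjugate2 ?W)) > 0"
    using p_pos by (simp_all add: det_atkin_lehner)
  have [measurable]: "D \<in> sets borel" using D by (simp add: fundamental_domain_def)
  obtain \<kappa> where \<kappa>: "bij_betw \<kappa> (Gamma0 (N * p)) (Gamma0 (N * p))"
    "\<And>\<gamma>. \<gamma> \<in> Gamma0 (N * p) \<Longrightarrow> adjugate2 ?W ** \<gamma> = \<kappa> \<gamma> ** adjugate2 ?W"
    using atkin_lehner_conj_bij by blast
  define v :: "complex \<Rightarrow> ennreal" where "v = (\<lambda>\<tau>. indicator D (act (adjugate2 ?W) \<tau>))"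
  have [measurable]: "v \<in> borel_measurable borel" unfolding v_def by measurable
  have "(\<integral>\<^sup>+\<tau>. v \<tau> * F \<tau> \<partial>hyperbolic) = (\<integral>\<^sup>+\<tau>. v (act ?W \<tau>) * F (act ?W \<tau>) \<partial>hyperbolic)"
    by (subst nn_integral_hyperbolic_mobius[OF W(1)]) auto
  also have "\<dots> = (\<integral>\<^sup>+\<tau>. indicator D \<tau> * F (act ?W \<tau>) \<partial>hyperbolic)"
    using AE_hyperbolic_upper_half_plane
    by (intro nn_integral_cong_AE) (auto elim!: eventually_mono simp: v_def real_mat_adjugate2 mobius_adjugate2(1)[OF W(1)])
  finally have *: "(\<integral>\<^sup>+\<tau>. indicator D \<tau> * F (act ?W \<tau>) \<partial>hyperbolic) = (\<integral>\<^sup>+\<tau>. v \<tau> * F \<tau> \<partial>hyperbolic)" ..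
  note AE2 = AE_orbit_meets_fundamental_domain_twice[OF D]
  show ?thesis
    unfolding *
  proof (rule nn_integral_invariant_eq[OF _ _ F _ AE2 _ _ inv])
    show "AE \<tau> in hyperbolic. (\<integral>\<^sup>+\<gamma>. v (act \<gamma> \<tau>) \<partial>count_space (Gamma0 (N * p))) = 2"
      using AE_hyperbolic_mobius[OF W(2) AE2] AE_hyperbolic_upper_half_plane
    proof eventually_elim
      fix \<tau> assume \<tau>: "(\<integral>\<^sup>+\<gamma>. indicator D (act \<gamma> (act (adjugate2 ?W) \<tau>)) \<partial>count_space (Gamma0 (N * p))) = 2" "Im \<tau> > 0"
      have "v (act \<gamma> \<tau>) = indicator D (act (\<kappa> \<gamma>) (act (adjugate2 ?W) \<tau>))" if "\<gamma> \<in> Gamma0 (N * p)" for \<gamma>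
      proof -
        have "\<kappa> \<gamma> \<in> Gamma0 (N * p)" using \<kappa>(1) that by (auto simp: bij_betw_def)
        then have "act (adjugate2 ?W) (act \<gamma> \<tau>) = act (\<kappa> \<gamma>) (act (adjugate2 ?W) \<tau>)"
          using \<kappa>(2)[OF that] that W \<tau>(2)
          by (simp add: det_Gamma0 flip: mobius_mult real_mat_mult del: det_adjugate2)
        then show ?thesis by (simp add: v_def)
      qed
      then have "(\<integral>\<^sup>+\<gamma>. v (act \<gamma> \<tau>) \<partial>count_space (Gamma0 (N * p))) =
          (\<integral>\<^sup>+\<gamma>. indicator D (act (\<kappa> \<gamma>) (act (adjugate2 ?W) \<tau>)) \<partial>count_space (Gamma0 (N * p)))"
        by (intro nn_integral_cong) simp
      also have "\<dots> = 2"
        using nn_integral_bij_count_space[OF \<kappa>(1), of "\<lambda>\<gamma>. indicator D (act \<gamma> (act (adjugate2 ?W) \<tau>))"] \<tau>(1) by simp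
      finally show "(\<integral>\<^sup>+\<gamma>. v (act \<gamma> \<tau>) \<partial>count_space (Gamma0 (N * p))) = 2" .
    qed
  qed auto
qed

text \<open>For j < p this is \<open>bezout_matrix\<close> times the translation by j. Modulo p the
  bottom rows are (N, N j) for j < p and (0, 1) for the identity, which serves the index p: the p +
  1 points of the projective line over the field with p elements.\<close>

definition coset_rep :: "nat \<Rightarrow> int ^ 2 ^ 2" where
  "coset_rep j = (if j < p then mat2 x (x * int j + y) (int N) (int N * int j + int p) else mat 1)"

lemma coset_rep_Gamma0: "coset_rep j \<in> Gamma0 N"
proof (cases "j < p")
  case True
  have "det (coset_rep j) = x * int p - y * int N"
    using True by (simp add: coset_rep_def det_2 algebra_simps)
  then show ?thesis using True bezout by (simp add: Gamma0_def SL2Z_def) (simp add: coset_rep_def)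
qed (simp add: coset_rep_def)

text \<open>With bottom row (N c, d) of \<gamma>, membership for j < p is the congruence N c j = d
  modulo p. It has exactly one solution if p does not divide c. If p divides c, then p does not
  divide d by the determinant, so there is none and only the identity coset remains.\<close>

lemma coset_rep_unique:
  assumes \<gamma>: "\<gamma> \<in> Gamma0 N"
  shows "\<exists>!j. j \<in> {..p} \<and> \<gamma> ** adjugate2 (coset_rep j) \<in> Gamma0 (N * p)"
proof -
  obtain c where c: "\<gamma>$2$1 = int N * c" using \<gamma> by (auto simp: Gamma0_def)
  define d where "d = \<gamma>$2$2"
  have det: "\<gamma>$1$1 * d - \<gamma>$1$2 * (int N * c) = 1"
    using det_Gamma0[OF \<gamma>] by (simp add: det_2 c d_def)
  have mem: "\<gamma> ** adjugate2 (coset_rep j) \<in> Gamma0 (N * p) \<longleftrightarrow>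
     (if j < p then [int N * c * int j = d] (mod int p) else int p dvd c)" for j
  proof -
    have "det (\<gamma> ** adjugate2 (coset_rep j)) = 1"
      using det_Gamma0[OF \<gamma>] det_Gamma0[OF coset_rep_Gamma0] by (simp add: det_mul)
    then have "\<gamma> ** adjugate2 (coset_rep j) \<in> Gamma0 (N * p) \<longleftrightarrow> int N * int p dvd (\<gamma> ** adjugate2 (coset_rep j))$2$1"
      by (simp add: Gamma0_def SL2Z_def)
    also have "(\<gamma> ** adjugate2 (coset_rep j))$2$1 = int N * (if j < p then int N * c * int j - d + int p * c else c)"
      by (simp add: matrix_mult_nth_2 adjugate2_def coset_rep_def c d_def[symmetric] algebra_simps)
    also have "int N * int p dvd \<dots> \<longleftrightarrow> (if j < p then int p dvd int N * c * int j - d + int p * c else int p dvd c)"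
      using N_pos by simp
    also have "\<dots> \<longleftrightarrow> (if j < p then [int N * c * int j = d] (mod int p) else int p dvd c)"
      by (simp add: cong_iff_dvd_diff dvd_add_left_iff)
    finally show ?thesis .
  qed
  show ?thesis
  proof (cases "int p dvd c")
    case True
    have "\<not> [int N * c * int j = d] (mod int p)" for j
    proof
      assume "[int N * c * int j = d] (mod int p)"
      then have "int p dvd d" using True by (simp add: cong_dvd_iff[symmetric])
      then have "int p dvd \<gamma>$1$1 * d - \<gamma>$1$2 * (int N * c)"
        using True by (intro dvd_diff dvd_mult) auto
      then show False using prime_p by (simp add: det)
    qed
    then show ?thesis using True by (intro ex1I[of _ p]) (auto simp: mem split: if_splits)
  next
    case False
    have "prime (int p)" using prime_p by simp
    then have "\<not> int p dvd int N * c"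
      using False not_p_dvd_N by (simp add: prime_dvd_mult_iff)
    then have cop: "coprime (int N * c) (int p)"
      using \<open>prime (int p)\<close> prime_imp_coprime coprime_commute by metis
    then obtain e where e: "[int N * c * e = 1] (mod int p)"
      using cong_solve_coprime_int by blast
    define j where "j = nat ((e * d) mod int p)"
    have j: "int j = (e * d) mod int p" "j < p" using p_pos by (simp_all add: j_def nat_less_iff)
    have "[int N * c * int j = int N * c * (e * d)] (mod int p)"
      unfolding j by (intro cong_mult cong_refl) (simp add: cong_def)
    also have "int N * c * (e * d) = (int N * c * e) * d" by simp
    also have "[(int N * c * e) * d = 1 * d] (mod int p)" by (intro cong_mult e cong_refl)
    finally have sol: "[int N * c * int j = d] (mod int p)" by simp
    show ?thesis
    proof (rule ex1I[of _ j])
      fix i assume i: "i \<in> {..p} \<and> \<gamma> ** adjugate2 (coset_rep i) \<in> Gamma0 (N * p)"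
      then have "i < p" "[int N * c * int i = d] (mod int p)"
        using False by (auto simp: mem split: if_splits)
      then have "[int N * c * int i = int N * c * int j] (mod int p)"
        using sol by (metis cong_sym cong_trans)
      then have "[int i = int j] (mod int p)"
        using cop by (simp add: cong_mult_lcancel)
      then show "i = j" using \<open>i < p\<close> j(2) by (simp add: cong_def)
    qed (use sol j in \<open>auto simp: mem\<close>)
  qed
qed

text \<open>By \<open>coset_rep_unique\<close> the right cosets \<open>K j\<close> partition the
  group, so their indicators add up to that of Gamma0(N).\<close>

lemma nn_integral_Gamma0_cosets:
  "(\<integral>\<^sup>+\<gamma>. g \<gamma> \<partial>count_space (Gamma0 N)) =
   (\<Sum>j\<le>p. \<integral>\<^sup>+\<gamma>. g (\<gamma> ** coset_rep j) \<partial>count_space (Gamma0 (N * p)))"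
proof -
  define K where "K = (\<lambda>j. (\<lambda>\<gamma>. \<gamma> ** coset_rep j) ` Gamma0 (N * p))"
  have mem: "\<gamma> \<in> K j \<longleftrightarrow> \<gamma> ** adjugate2 (coset_rep j) \<in> Gamma0 (N * p)" for \<gamma> j
  proof
    assume "\<gamma> \<in> K j"
    then show "\<gamma> ** adjugate2 (coset_rep j) \<in> Gamma0 (N * p)"
      using matrix_adjugate2(2)[OF det_Gamma0[OF coset_rep_Gamma0]]
      by (auto simp: K_def simp flip: matrix_mul_assoc)
  next
    assume "\<gamma> ** adjugate2 (coset_rep j) \<in> Gamma0 (N * p)"
    moreover have "\<gamma> = (\<gamma> ** adjugate2 (coset_rep j)) ** coset_rep j"
      using matrix_adjugate2(1)[OF det_Gamma0[OF coset_rep_Gamma0]] by (simp flip: matrix_mul_assoc)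
    ultimately show "\<gamma> \<in> K j" unfolding K_def by blast
  qed
  have sub: "K j \<subseteq> Gamma0 N" for j
    using Gamma0_mono[of N "N * p"] coset_rep_Gamma0 by (auto simp: K_def intro!: Gamma0_mult)
  have ind: "(\<Sum>j\<le>p. indicator (K j) \<gamma>) = (indicator (Gamma0 N) \<gamma> :: ennreal)" for \<gamma>
  proof (cases "\<gamma> \<in> Gamma0 N")
    case True
    then obtain j where j: "j \<le> p" "\<gamma> \<in> K j" "\<And>i. i \<le> p \<Longrightarrow> \<gamma> \<in> K i \<Longrightarrow> i = j"
      using coset_rep_unique[OF True] unfolding mem[symmetric] by auto
    have "\<gamma> \<in> K i \<longleftrightarrow> i = j" if "i \<le> p" for i
      using j that by blast
    then have "(\<Sum>i\<le>p. indicator (K i) \<gamma>) = (\<Sum>i\<le>p. if i = j then 1 else 0 :: ennreal)"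
      by (intro sum.cong) (simp_all add: indicator_def)
    then show ?thesis using j(1) True by simp
  next
    case False
    then show ?thesis using sub by (auto simp: indicator_def intro!: sum.neutral)
  qed
  have "(\<integral>\<^sup>+\<gamma>. g (\<gamma> ** coset_rep j) \<partial>count_space (Gamma0 (N * p))) = (\<integral>\<^sup>+\<gamma>. g \<gamma> * indicator (K j) \<gamma> \<partial>count_space UNIV)" for j
  proof -
    have "inj_on (\<lambda>\<gamma>. \<gamma> ** coset_rep j) (Gamma0 (N * p))"
      using det_Gamma0[OF coset_rep_Gamma0[of j]] by (intro inj_onI) (rule matrix_mult_right_cancel_int, auto)
    then have "bij_betw (\<lambda>\<gamma>. \<gamma> ** coset_rep j) (Gamma0 (N * p)) (K j)"
      by (simp add: K_def inj_on_imp_bij_betw)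
    from nn_integral_bij_count_space[OF this, of g] show ?thesis
      by (simp add: nn_integral_count_space_indicator)
  qed
  then have "(\<Sum>j\<le>p. \<integral>\<^sup>+\<gamma>. g (\<gamma> ** coset_rep j) \<partial>count_space (Gamma0 (N * p))) =
     (\<integral>\<^sup>+\<gamma>. (\<Sum>j\<le>p. g \<gamma> * indicator (K j) \<gamma>) \<partial>count_space UNIV)"
    by (simp only:) (rule nn_integral_sum[symmetric], simp)
  also have "\<dots> = (\<integral>\<^sup>+\<gamma>. g \<gamma> * indicator (Gamma0 N) \<gamma> \<partial>count_space UNIV)"
    by (simp only: ind sum_distrib_left[symmetric])
  also have "\<dots> = (\<integral>\<^sup>+\<gamma>. g \<gamma> \<partial>count_space (Gamma0 N))"
    by (simp add: nn_integral_count_space_indicator)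
  finally show ?thesis ..
qed

text \<open>Inversion turns the right cosets into left cosets of the inverse
  representatives.\<close>

lemma nn_integral_Gamma0_left_cosets:
  "(\<integral>\<^sup>+\<gamma>. g \<gamma> \<partial>count_space (Gamma0 N)) =
   (\<Sum>j\<le>p. \<integral>\<^sup>+\<gamma>. g (adjugate2 (coset_rep j) ** \<gamma>) \<partial>count_space (Gamma0 (N * p)))"
proof -
  have "(\<integral>\<^sup>+\<gamma>. g \<gamma> \<partial>count_space (Gamma0 N)) = (\<integral>\<^sup>+\<gamma>. g (adjugate2 \<gamma>) \<partial>count_space (Gamma0 N))"
    by (rule nn_integral_bij_count_space[OF bij_betw_adjugate2_Gamma0, symmetric])
  also have "\<dots> = (\<Sum>j\<le>p. \<integral>\<^sup>+\<gamma>. g (adjugate2 (coset_rep j) ** adjugate2 \<gamma>) \<partial>count_space (Gamma0 (N * p)))"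
    by (subst nn_integral_Gamma0_cosets) (simp add: adjugate2_mult)
  also have "\<dots> = (\<Sum>j\<le>p. \<integral>\<^sup>+\<gamma>. g (adjugate2 (coset_rep j) ** \<gamma>) \<partial>count_space (Gamma0 (N * p)))"
  proof (intro sum.cong refl)
    fix j
    show "(\<integral>\<^sup>+\<gamma>. g (adjugate2 (coset_rep j) ** adjugate2 \<gamma>) \<partial>count_space (Gamma0 (N * p))) =
        (\<integral>\<^sup>+\<gamma>. g (adjugate2 (coset_rep j) ** \<gamma>) \<partial>count_space (Gamma0 (N * p)))"
      by (rule nn_integral_bij_count_space[OF bij_betw_adjugate2_Gamma0])
  qed
  finally show ?thesis .
qed

text \<open>Two weights with constant 2 (p + 1) are compared: p + 1 times the indicator of D, and
  the sum \<open>w\<close> of the indicators of the images of D under the coset representatives. For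
  \<open>w\<close>, the orbit sums over the left cosets assemble to one orbit sum over Gamma0(N),
  and splitting that into right cosets gives the value 2 at each of the p + 1 points
  \<open>act (coset_rep j) \<tau>\<close>.\<close>

lemma nn_integral_trace:
  assumes D: "fundamental_domain (Gamma0 (N * p)) D"
    and F [measurable]: "F \<in> borel_measurable borel"
    and inv: "\<And>\<gamma> \<tau>. \<lbrakk>\<gamma> \<in> Gamma0 (N * p); Im \<tau> > 0\<rbrakk> \<Longrightarrow> F (act \<gamma> \<tau>) = F \<tau>"
  shows "(\<Sum>j\<le>p. \<integral>\<^sup>+\<tau>. indicator D \<tau> * F (act (coset_rep j) \<tau>) \<partial>hyperbolic) =
         of_nat (p + 1) * (\<integral>\<^sup>+\<tau>. indicator D \<tau> * F \<tau> \<partial>hyperbolic)"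
proof -
  let ?\<Gamma> = "Gamma0 (N * p)" and ?\<delta> = coset_rep
  have [measurable]: "D \<in> sets borel" using D by (simp add: fundamental_domain_def)
  have \<delta>: "det (real_mat (?\<delta> j)) > 0" for j
    using det_Gamma0[OF coset_rep_Gamma0] by simp
  define v w :: "complex \<Rightarrow> ennreal"
    where "v = (\<lambda>\<tau>. of_nat (p + 1) * indicator D \<tau>)"
      and "w = (\<lambda>\<tau>. \<Sum>j\<le>p. indicator D (act (adjugate2 (?\<delta> j)) \<tau>))"
  have [measurable]: "v \<in> borel_measurable borel" "w \<in> borel_measurable borel"
    unfolding v_def w_def by measurable
  note AE2 = AE_orbit_meets_fundamental_domain_twice[OF D]
  have v: "AE \<tau> in hyperbolic. (\<integral>\<^sup>+\<gamma>. v (act \<gamma> \<tau>) \<partial>count_space ?\<Gamma>) = of_nat (p + 1) * 2"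
    using AE2 by (auto elim!: eventually_mono simp: v_def nn_integral_cmult)
  have "AE \<tau> in hyperbolic. \<forall>j\<in>{..p}. (\<integral>\<^sup>+\<gamma>. indicator D (act \<gamma> (act (?\<delta> j) \<tau>)) \<partial>count_space ?\<Gamma>) = 2"
    by (intro AE_finite_allI AE_hyperbolic_mobius[OF \<delta> AE2]) auto
  then have w: "AE \<tau> in hyperbolic. (\<integral>\<^sup>+\<gamma>. w (act \<gamma> \<tau>) \<partial>count_space ?\<Gamma>) = of_nat (p + 1) * 2"
    using AE_hyperbolic_upper_half_plane
  proof eventually_elim
    fix \<tau> assume \<tau>: "\<forall>j\<in>{..p}. (\<integral>\<^sup>+\<gamma>. indicator D (act \<gamma> (act (?\<delta> j) \<tau>)) \<partial>count_space ?\<Gamma>) = 2" "Im \<tau> > 0"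
    have "(\<integral>\<^sup>+\<gamma>. w (act \<gamma> \<tau>) \<partial>count_space ?\<Gamma>) =
        (\<Sum>j\<le>p. \<integral>\<^sup>+\<gamma>. indicator D (act (adjugate2 (?\<delta> j)) (act \<gamma> \<tau>)) \<partial>count_space ?\<Gamma>)"
      unfolding w_def by (rule nn_integral_sum) simp
    also have "\<dots> = (\<Sum>j\<le>p. \<integral>\<^sup>+\<gamma>. indicator D (act (adjugate2 (?\<delta> j) ** \<gamma>) \<tau>) \<partial>count_space ?\<Gamma>)"
      using act_mult[OF Gamma0_adjugate2[OF coset_rep_Gamma0] _ \<tau>(2)]
      by (intro sum.cong refl nn_integral_cong) simp
    also have "\<dots> = (\<integral>\<^sup>+\<gamma>. indicator D (act \<gamma> \<tau>) \<partial>count_space (Gamma0 N))"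
      by (rule nn_integral_Gamma0_left_cosets[symmetric])
    also have "\<dots> = (\<Sum>j\<le>p. \<integral>\<^sup>+\<gamma>. indicator D (act (\<gamma> ** ?\<delta> j) \<tau>) \<partial>count_space ?\<Gamma>)"
      by (rule nn_integral_Gamma0_cosets)
    also have "\<dots> = (\<Sum>j\<le>p. \<integral>\<^sup>+\<gamma>. indicator D (act \<gamma> (act (?\<delta> j) \<tau>)) \<partial>count_space ?\<Gamma>)"
      using act_mult[OF _ coset_rep_Gamma0 \<tau>(2)]
      by (intro sum.cong refl nn_integral_cong) simp
    also have "\<dots> = (\<Sum>j\<le>p. 2)"
      using \<tau>(1) by (intro sum.cong) auto
    finally show "(\<integral>\<^sup>+\<gamma>. w (act \<gamma> \<tau>) \<partial>count_space ?\<Gamma>) = of_nat (p + 1) * 2"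
      by simp
  qed
  have "of_nat (p + 1) * (\<integral>\<^sup>+\<tau>. indicator D \<tau> * F \<tau> \<partial>hyperbolic) = (\<integral>\<^sup>+\<tau>. v \<tau> * F \<tau> \<partial>hyperbolic)"
    unfolding v_def mult.assoc by (rule nn_integral_cmult[symmetric]) simp
  also have "\<dots> = (\<integral>\<^sup>+\<tau>. w \<tau> * F \<tau> \<partial>hyperbolic)"
    by (rule nn_integral_invariant_eq[OF _ _ F v w _ _ inv]) (auto simp: ennreal_mult_eq_top_iff)
  also have "\<dots> = (\<Sum>j\<le>p. \<integral>\<^sup>+\<tau>. indicator D (act (adjugate2 (?\<delta> j)) \<tau>) * F \<tau> \<partial>hyperbolic)"
    unfolding w_def sum_distrib_right by (rule nn_integral_sum) simp
  also have "\<dots> = (\<Sum>j\<le>p. \<integral>\<^sup>+\<tau>. indicator D \<tau> * F (act (?\<delta> j) \<tau>) \<partial>hyperbolic)"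
  proof (intro sum.cong refl)
    fix j
    have "(\<integral>\<^sup>+\<tau>. indicator D (act (adjugate2 (?\<delta> j)) \<tau>) * F \<tau> \<partial>hyperbolic) =
       (\<integral>\<^sup>+\<tau>. indicator D (act (adjugate2 (?\<delta> j)) (act (?\<delta> j) \<tau>)) * F (act (?\<delta> j) \<tau>) \<partial>hyperbolic)"
      by (subst nn_integral_hyperbolic_mobius[OF \<delta>[of j], symmetric]) auto
    also have "\<dots> = (\<integral>\<^sup>+\<tau>. indicator D \<tau> * F (act (?\<delta> j) \<tau>) \<partial>hyperbolic)"
      using AE_hyperbolic_upper_half_plane
      by (intro nn_integral_cong_AE) (auto elim!: eventually_mono simp: act_adjugate2(1)[OF coset_rep_Gamma0])
    finally show "(\<integral>\<^sup>+\<tau>. indicator D (act (adjugate2 (?\<delta> j)) \<tau>) * F \<tau> \<partial>hyperbolic) =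
       (\<integral>\<^sup>+\<tau>. indicator D \<tau> * F (act (?\<delta> j) \<tau>) \<partial>hyperbolic)" .
  qed
  finally show ?thesis ..
qed

end

section \<open>The Petersson product of the lifted forms\<close>

text \<open>Assumption \<open>nn\<close>, for all \<open>u\<close> at once, says that the
  distributions of F along the maps h i add up to c times the distribution of F. Taking the norm for
  \<open>u\<close> gives integrability; positive and negative parts of Re and Im give the
  integrals.\<close>

lemma integral_sum_transfer:
  fixes F :: "'a \<Rightarrow> complex" and M :: "'a measure"
  assumes I: "finite I" and h: "\<And>i. i \<in> I \<Longrightarrow> h i \<in> measurable M M"
    and c: "c \<ge> 0" and F: "integrable M F"
    and nn: "\<And>u :: complex \<Rightarrow> ennreal. u \<in> borel_measurable borel \<Longrightarrow>
      (\<Sum>i\<in>I. \<integral>\<^sup>+x. u (F (h i x)) \<partial>M) = ennreal c * (\<integral>\<^sup>+x. u (F x) \<partial>M)"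
  shows "\<And>i. i \<in> I \<Longrightarrow> integrable M (\<lambda>x. F (h i x))"
    and "(\<Sum>i\<in>I. \<integral>x. F (h i x) \<partial>M) = of_real c * (\<integral>x. F x \<partial>M)"
proof -
  have [measurable]: "F \<in> borel_measurable M" using F by auto
  have Fh [measurable]: "(\<lambda>x. F (h i x)) \<in> borel_measurable M" if "i \<in> I" for i
    using measurable_compose[OF h[OF that], of F borel] by simp
  have fin: "(\<Sum>i\<in>I. \<integral>\<^sup>+x. ennreal (cmod (F (h i x))) \<partial>M) < \<infinity>"
    using F c by (subst nn) (auto simp: integrable_iff_bounded ennreal_mult_less_top)
  show int: "integrable M (\<lambda>x. F (h i x))" if "i \<in> I" for i
    unfolding integrable_iff_bounded using Fh[OF that] fin that I by auto
  have key: "(\<Sum>i\<in>I. \<integral>x. r (F (h i x)) \<partial>M) = c * (\<integral>x. r (F x) \<partial>M)"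
    if r: "bounded_linear r" for r :: "complex \<Rightarrow> real"
  proof -
    have [measurable]: "r \<in> borel_measurable borel"
      using r by (intro borel_measurable_continuous_onI linear_continuous_on)
    have intr: "integrable M (\<lambda>x. r (F x))" "\<And>i. i \<in> I \<Longrightarrow> integrable M (\<lambda>x. r (F (h i x)))"
      using integrable_bounded_linear[OF r] F int by auto
    \<comment> \<open>\<open>s\<close> becomes 1 and -1: as \<open>ennreal\<close> sends negative
      reals to 0, this selects the positive and the negative part.\<close>
    have part: "(\<Sum>i\<in>I. enn2real (\<integral>\<^sup>+x. ennreal (s * r (F (h i x))) \<partial>M)) =
        c * enn2real (\<integral>\<^sup>+x. ennreal (s * r (F x)) \<partial>M)" for s
    proof -
      have "(\<integral>\<^sup>+x. ennreal (s * r (F (h i x))) \<partial>M) < \<infinity>" if "i \<in> I" for i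
      proof -
        have "integrable M (\<lambda>x. s * r (F (h i x)))"
          using intr(2)[OF that] by (rule integrable_mult_right)
        then have "(\<integral>\<^sup>+x. ennreal (norm (s * r (F (h i x)))) \<partial>M) < \<infinity>"
          by (simp only: integrable_iff_bounded)
        then show ?thesis
          by (rule le_less_trans[rotated]) (intro nn_integral_mono ennreal_leI, simp)
      qed
      then have "(\<Sum>i\<in>I. enn2real (\<integral>\<^sup>+x. ennreal (s * r (F (h i x))) \<partial>M)) =
          enn2real (\<Sum>i\<in>I. \<integral>\<^sup>+x. ennreal (s * r (F (h i x))) \<partial>M)"
        by (subst enn2real_sum) auto
      also have "(\<Sum>i\<in>I. \<integral>\<^sup>+x. ennreal (s * r (F (h i x))) \<partial>M) = ennreal c * (\<integral>\<^sup>+x. ennreal (s * r (F x)) \<partial>M)"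
        using nn[of "\<lambda>z. ennreal (s * r z)"] by simp
      finally show ?thesis using c by (simp add: enn2real_mult)
    qed
    have "(\<Sum>i\<in>I. \<integral>x. r (F (h i x)) \<partial>M) =
      (\<Sum>i\<in>I. enn2real (\<integral>\<^sup>+x. ennreal (1 * r (F (h i x))) \<partial>M)) -
      (\<Sum>i\<in>I. enn2real (\<integral>\<^sup>+x. ennreal ((-1) * r (F (h i x))) \<partial>M))"
      unfolding sum_subtractf[symmetric] using intr(2) by (intro sum.cong refl) (simp add: real_lebesgue_integral_def)
    also have "\<dots> = c * (\<integral>x. r (F x) \<partial>M)"
      unfolding part using intr(1) by (simp add: real_lebesgue_integral_def right_diff_distrib)
    finally show ?thesis .
  qed
  show "(\<Sum>i\<in>I. \<integral>x. F (h i x) \<partial>M) = of_real c * (\<integral>x. F x \<partial>M)"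
  proof (rule complex_eqI)
    show "Re (\<Sum>i\<in>I. \<integral>x. F (h i x) \<partial>M) = Re (of_real c * (\<integral>x. F x \<partial>M))"
      using key[OF bounded_linear_Re] F int by simp
    show "Im (\<Sum>i\<in>I. \<integral>x. F (h i x) \<partial>M) = Im (of_real c * (\<integral>x. F x \<partial>M))"
      using key[OF bounded_linear_Im] F int by simp
  qed
qed

text \<open>A factor y^(-2) passes from the integrand to the measure; the cut-off in
  \<open>petersson_density\<close> is not felt since D lies in the upper half plane.\<close>

lemma petersson_eq_integral_density:
  assumes D: "D = (SOME D. fundamental_domain (Gamma0 L) D)"
    and [measurable]: "petersson_density k f g \<in> borel_measurable borel"
  shows "petersson k L f g = (\<integral>\<tau>. petersson_density k f g \<tau> \<partial>density hyperbolic (indicator D))"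
proof -
  have D': "fundamental_domain (Gamma0 L) D"
    unfolding D by (rule fundamental_domain_Eps)
  then have [measurable]: "D \<in> sets borel" and sub: "D \<subseteq> upper_half_plane"
    by (auto simp: fundamental_domain_def)
  have "density hyperbolic (indicator D) = density lborel (\<lambda>\<tau>. ennreal (indicator D \<tau> / (Im \<tau>)\<^sup>2))"
    unfolding hyperbolic_def using sub
    by (subst density_density_eq) (auto intro!: density_cong AE_I2 simp: indicator_def)
  then have "(\<integral>\<tau>. petersson_density k f g \<tau> \<partial>density hyperbolic (indicator D)) =
      (\<integral>\<tau>. (indicator D \<tau> / (Im \<tau>)\<^sup>2) *\<^sub>R petersson_density k f g \<tau> \<partial>lborel)"
    by (simp add: integral_density)
  also have "\<dots> = (\<integral>\<tau>. indicator D \<tau> *\<^sub>R (f \<tau> * cnj (g \<tau>) * of_real (Im \<tau> powi (k - 2))) \<partial>lborel)"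
  proof (intro Bochner_Integration.integral_cong refl)
    fix \<tau>
    show "(indicator D \<tau> / (Im \<tau>)\<^sup>2) *\<^sub>R petersson_density k f g \<tau> =
       indicator D \<tau> *\<^sub>R (f \<tau> * cnj (g \<tau>) * of_real (Im \<tau> powi (k - 2)))"
    proof (cases "\<tau> \<in> D")
      case True
      then have "Im \<tau> > 0" using sub by (auto simp: upper_half_plane_def)
      then have "Im \<tau> powi (k - 2) = Im \<tau> powi k / (Im \<tau>)\<^sup>2"
        by (simp add: power_int_diff)
      then show ?thesis
        using True \<open>Im \<tau> > 0\<close> by (simp add: petersson_density_def scaleR_conv_of_real)
    qed simp
  qed
  also have "\<dots> = petersson k L f g"
    by (simp add: petersson_def set_lebesgue_integral_def D)
  finally show ?thesis ..
qed

text \<open>From |a b| <= |a|^2 + |b|^2 the mixed density is dominated by the two diagonal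
  ones.\<close>

lemma integrable_petersson_density:
  assumes [measurable]: "D \<in> sets borel"
    and cont: "continuous_on upper_half_plane f" "continuous_on upper_half_plane g"
    and fin: "(\<integral>\<^sup>+\<tau>. indicator D \<tau> * ennreal (cmod (petersson_density k f f \<tau>)) \<partial>hyperbolic) < \<infinity>"
      "(\<integral>\<^sup>+\<tau>. indicator D \<tau> * ennreal (cmod (petersson_density k g g \<tau>)) \<partial>hyperbolic) < \<infinity>"
  shows "integrable (density hyperbolic (indicator D)) (petersson_density k f g)"
proof -
  note [measurable] = measurable_petersson_density[OF cont] measurable_petersson_density[OF cont(1) cont(1)]
    measurable_petersson_density[OF cont(2) cont(2)]
  have le: "cmod (petersson_density k f g \<tau>) \<le> cmod (petersson_density k f f \<tau>) + cmod (petersson_density k g g \<tau>)" for \<tau>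
  proof (cases "Im \<tau> > 0")
    case True
    have "cmod (f \<tau>) * cmod (g \<tau>) \<le> (cmod (f \<tau>))\<^sup>2 + (cmod (g \<tau>))\<^sup>2"
      using sum_squares_bound[of "cmod (f \<tau>)" "cmod (g \<tau>)"] mult_nonneg_nonneg[OF norm_ge_zero norm_ge_zero, of "f \<tau>" "g \<tau>"]
      unfolding mult.assoc by linarith
    then have "cmod (f \<tau>) * cmod (g \<tau>) * Im \<tau> powi k \<le> ((cmod (f \<tau>))\<^sup>2 + (cmod (g \<tau>))\<^sup>2) * Im \<tau> powi k"
      using True by (intro mult_right_mono) auto
    then show ?thesis
      using True by (simp add: cmod_petersson_density_diag distrib_right)
         (simp add: petersson_density_def norm_mult norm_power_int)
  qed (simp add: petersson_density_def)
  have "(\<integral>\<^sup>+\<tau>. ennreal (cmod (petersson_density k f g \<tau>)) \<partial>density hyperbolic (indicator D)) =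
     (\<integral>\<^sup>+\<tau>. indicator D \<tau> * ennreal (cmod (petersson_density k f g \<tau>)) \<partial>hyperbolic)"
    by (simp add: nn_integral_density)
  also have "\<dots> \<le> (\<integral>\<^sup>+\<tau>. indicator D \<tau> * ennreal (cmod (petersson_density k f f \<tau>)) +
      indicator D \<tau> * ennreal (cmod (petersson_density k g g \<tau>)) \<partial>hyperbolic)"
    using le by (intro nn_integral_mono) (auto simp: indicator_def simp flip: ennreal_plus intro!: ennreal_leI)
  also have "\<dots> < \<infinity>"
    using fin by (subst nn_integral_add) auto
  finally show ?thesis
    by (simp add: integrable_iff_bounded)
qed

text \<open>The oldform p^(k/2) f(p \<tau>).\<close>

definition prime_lift :: "int \<Rightarrow> nat \<Rightarrow> (complex \<Rightarrow> complex) \<Rightarrow> complex \<Rightarrow> complex" where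
  "prime_lift k p f = slash k f (mat2 (real p) 0 0 1)"

lemma hecke_T_prime:
  assumes "prime p" "chi 1 = 1"
  shows "hecke_T k chi p f \<tau> = hecke_U k p f \<tau> +
     of_real (real p powr (of_int k / 2 - 1)) * chi (int p) * prime_lift k p f \<tau>"
proof -
  have "a * d = p \<longleftrightarrow> (a = 1 \<and> d = p) \<or> (a = p \<and> d = 1)" for a d
    using prime_product[of a d] assms(1) by auto
  then have "{(a, d). a * d = p} = {(1, p), (p, 1)}"
    by auto
  moreover have "p \<noteq> 1" using assms(1) by auto
  ultimately show ?thesis
    using assms(2) by (simp add: hecke_T_def hecke_U_def prime_lift_def distrib_left mult.assoc)
qed

section \<open>Densities of lifted forms under the Atkin--Lehner matrix and the coset
  representatives\<close>

context bezout_level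
begin

lemma petersson_density_prime_lift:
  assumes "Im \<tau> > 0"
  shows "petersson_density k (prime_lift k p f) (prime_lift k p g) \<tau> =
         petersson_density k f g (mobius (mat2 (real p) 0 0 1) \<tau>)"
  unfolding prime_lift_def using p_pos assms
  by (intro petersson_density_mobius[symmetric]) (simp_all add: det_2)

text \<open>The factor \<open>bezout_matrix\<close> leaves the density invariant, so only diag(p, 1)
  is felt.\<close>

lemma petersson_density_atkin_lehner:
  assumes chi: "dirichlet_character N chi"
    and f: "f \<in> cusp_forms k N chi" and g: "g \<in> cusp_forms k N chi" and \<tau>: "Im \<tau> > 0"
  shows "petersson_density k f g (act atkin_lehner \<tau>) =
         petersson_density k (prime_lift k p f) (prime_lift k p g) \<tau>"
proof -
  have det: "det (mat2 (real p) 0 0 1) > 0" using p_pos by (simp add: det_2)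
  have "real_mat atkin_lehner = real_mat bezout_matrix ** mat2 (real p) 0 0 1"
    by (simp add: mat2_eq_iff matrix_mult_nth_2 atkin_lehner_def bezout_matrix_def)
  then have "act atkin_lehner \<tau> = act bezout_matrix (mobius (mat2 (real p) 0 0 1) \<tau>)"
    using mobius_mult[OF _ det \<tau>, of "real_mat bezout_matrix"] det_Gamma0[OF bezout_matrix_Gamma0] by simp
  then show ?thesis
    using petersson_density_invariant[OF chi N_pos f g bezout_matrix_Gamma0 mobius_in_upper_half_plane[OF det \<tau>]]
    by (simp add: petersson_density_prime_lift[OF \<tau>])
qed

text \<open>Conjugation by diag(p, 1) divides the lower left entry by p, which leaves it divisible
  by N, and fixes the lower right entry, on which the character depends.\<close>

lemma slash_prime_lift:
  assumes f: "f \<in> cusp_forms k N chi" and \<gamma>: "\<gamma> \<in> Gamma0 (N * p)" and \<tau>: "Im \<tau> > 0"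
  shows "slash k (prime_lift k p f) (real_mat \<gamma>) \<tau> = chi (\<gamma>$2$2) * prime_lift k p f \<tau>"
proof -
  let ?\<alpha> = "mat2 (real p) 0 0 1 :: real ^ 2 ^ 2"
  have det: "det ?\<alpha> > 0" using p_pos by (simp add: det_2)
  obtain C where C: "\<gamma>$2$1 = int N * int p * C"
    using \<gamma> by (auto simp: Gamma0_def elim!: dvdE)
  define \<gamma>' where "\<gamma>' = mat2 (\<gamma>$1$1) (int p * \<gamma>$1$2) (int N * C) (\<gamma>$2$2)"
  have \<gamma>': "\<gamma>' \<in> Gamma0 N"
    using det_Gamma0[OF \<gamma>] by (simp add: Gamma0_def SL2Z_def det_2 \<gamma>'_def C algebra_simps)
  have comm: "?\<alpha> ** real_mat \<gamma> = real_mat \<gamma>' ** ?\<alpha>"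
    by (simp add: mat2_eq_iff matrix_mult_nth_2 \<gamma>'_def C)
  have "slash k (prime_lift k p f) (real_mat \<gamma>) \<tau> = slash k f (?\<alpha> ** real_mat \<gamma>) \<tau>"
    unfolding prime_lift_def using det det_Gamma0[OF \<gamma>] \<tau> by (intro slash_mult[symmetric]) auto
  also have "\<dots> = slash k (slash k f (real_mat \<gamma>')) ?\<alpha> \<tau>"
    unfolding comm using det det_Gamma0[OF \<gamma>'] \<tau> by (intro slash_mult) auto
  also have "\<dots> = slash k (\<lambda>\<tau>. chi (\<gamma>$2$2) * f \<tau>) ?\<alpha> \<tau>"
    using det \<tau> cusp_formsD(2)[OF f \<gamma>'] by (intro slash_cong) (auto simp: \<gamma>'_def)
  also have "\<dots> = chi (\<gamma>$2$2) * prime_lift k p f \<tau>"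
    by (simp add: slash_def prime_lift_def)
  finally show ?thesis .
qed

lemma petersson_density_lift_invariant:
  assumes chi: "dirichlet_character N chi"
    and f: "f \<in> cusp_forms k N chi" and g: "g \<in> cusp_forms k N chi"
    and \<gamma>: "\<gamma> \<in> Gamma0 (N * p)" and \<tau>: "Im \<tau> > 0"
  shows "petersson_density k f (prime_lift k p g) (act \<gamma> \<tau>) = petersson_density k f (prime_lift k p g) \<tau>"
proof -
  have \<gamma>N: "\<gamma> \<in> Gamma0 N" using \<gamma> Gamma0_mono[of N "N * p"] by auto
  have "chi (\<gamma>$2$2) * cnj (chi (\<gamma>$2$2)) = 1"
    by (intro dirichlet_character_mult_cnj[OF chi N_pos] Gamma0_coprime \<gamma>N)
  moreover have "petersson_density k f (prime_lift k p g) (act \<gamma> \<tau>) =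
      petersson_density k (slash k f (real_mat \<gamma>)) (slash k (prime_lift k p g) (real_mat \<gamma>)) \<tau>"
    using \<gamma> \<tau> by (intro petersson_density_mobius) (simp_all add: det_Gamma0)
  moreover have "\<dots> = (chi (\<gamma>$2$2) * cnj (chi (\<gamma>$2$2))) * petersson_density k f (prime_lift k p g) \<tau>"
    unfolding petersson_density_def
    by (simp add: cusp_formsD(2)[OF f \<gamma>N \<tau>] slash_prime_lift[OF g \<gamma> \<tau>])
  ultimately show ?thesis by simp
qed

text \<open>For \<open>j < p\<close> one has \<open>diag(p, 1) coset_rep(j) = (px y; N 1) (1 j; 0 p)\<close>, with the first
  factor in \<open>\<Gamma>\<^sub>0(N)\<close>: the cosets thus run through the matrices that define \<open>T\<^sub>p\<close>.\<close>

lemma petersson_density_coset_rep: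
  assumes chi: "dirichlet_character N chi"
    and f: "f \<in> cusp_forms k N chi" and g: "g \<in> cusp_forms k N chi" and \<tau>: "Im \<tau> > 0" and j: "j < p"
  shows "petersson_density k f (prime_lift k p g) (act (coset_rep j) \<tau>) =
         chi (int p) * petersson_density k f (slash k g (mat2 1 (real j) 0 (real p))) \<tau>"
proof -
  let ?\<alpha> = "mat2 (real p) 0 0 1 :: real ^ 2 ^ 2" and ?\<beta> = "mat2 1 (real j) 0 (real p) :: real ^ 2 ^ 2"
  have "det ?\<alpha> > 0" "det ?\<beta> > 0"
    using p_pos by (simp_all add: det_2)
  moreover have "det (real_mat (coset_rep j)) > 0"
    using det_Gamma0[OF coset_rep_Gamma0] by simp
  ultimately have det: "det ?\<alpha> > 0" "det ?\<beta> > 0" "det (real_mat (coset_rep j)) > 0"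
    by blast+
  define \<gamma> where "\<gamma> = mat2 (int p * x) y (int N) 1"
  have \<gamma>: "\<gamma> \<in> Gamma0 N"
    using bezout by (simp add: Gamma0_def SL2Z_def det_2 \<gamma>_def mult.commute)
  have eq: "?\<alpha> ** real_mat (coset_rep j) = real_mat \<gamma> ** ?\<beta>"
    using j by (simp add: mat2_eq_iff matrix_mult_nth_2 \<gamma>_def coset_rep_def algebra_simps)
  \<comment> \<open>\<open>coset_rep j\<close> has lower right entry N j + p, so \<open>f\<close>
    yields the value at p; \<open>\<gamma>\<close> has lower right entry 1, so \<open>g\<close>
    yields the value 1.\<close>
  have "chi (int N * int j + int p) = chi (int p)"
    using dirichlet_character_add_mult[OF chi, of "int p" "int j"] by (simp add: add.commute)
  then have 1: "slash k f (real_mat (coset_rep j)) \<tau> = chi (int p) * f \<tau>"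
    using cusp_formsD(2)[OF f coset_rep_Gamma0 \<tau>, of j] j by (simp add: coset_rep_def)
  have "slash k (prime_lift k p g) (real_mat (coset_rep j)) \<tau> = slash k g (?\<alpha> ** real_mat (coset_rep j)) \<tau>"
    unfolding prime_lift_def using det \<tau> by (intro slash_mult[symmetric]) auto
  also have "\<dots> = slash k (slash k g (real_mat \<gamma>)) ?\<beta> \<tau>"
    unfolding eq using det det_Gamma0[OF \<gamma>] \<tau> by (intro slash_mult) auto
  also have "\<dots> = slash k g ?\<beta> \<tau>"
    using det \<tau> cusp_formsD(2)[OF g \<gamma>] dirichlet_character_one[OF chi]
    by (intro slash_cong) (auto simp: \<gamma>_def)
  finally have 2: "slash k (prime_lift k p g) (real_mat (coset_rep j)) \<tau> = slash k g ?\<beta> \<tau>" .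
  show ?thesis
    unfolding petersson_density_mobius[OF det(3) \<tau>] using \<tau> 1 2 by (simp add: petersson_density_def)
qed

lemma continuous_on_cusp_form:
  assumes "f \<in> cusp_forms k N chi"
  shows "continuous_on upper_half_plane f" and "continuous_on upper_half_plane (prime_lift k p f)"
  unfolding prime_lift_def using p_pos
  by (auto intro!: holomorphic_on_imp_continuous_on holomorphic_slash cusp_formsD(1)[OF assms] simp: det_2)

section \<open>Integrals over an arbitrary fundamental domain of level Np\<close>

context
  fixes k :: int and chi :: "int \<Rightarrow> complex" and D :: "complex set"
  assumes chi: "dirichlet_character N chi"
    and D: "fundamental_domain (Gamma0 (N * p)) D"
begin

lemma D_borel [measurable]: "D \<in> sets borel"
  using D by (simp add: fundamental_domain_def)

abbreviation "petersson_measure \<equiv> density hyperbolic (indicator D)"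

lemma AE_petersson_measure: "AE \<tau> in petersson_measure. Im \<tau> > 0"
  using AE_hyperbolic_upper_half_plane by (subst AE_density) (auto elim!: eventually_mono)

lemma measurable_act_petersson_measure: "act \<gamma> \<in> measurable petersson_measure petersson_measure"
  by (simp cong: measurable_cong_sets)

lemma cusp_form_density_finite:
  assumes f: "f \<in> cusp_forms k N chi"
  shows "(\<integral>\<^sup>+\<tau>. indicator D \<tau> * ennreal (cmod (petersson_density k f f \<tau>)) \<partial>hyperbolic) < \<infinity>"
  using p_pos N_pos by (intro nn_integral_petersson_density_finite[OF chi N_pos f _ _ D]) auto

lemma measurable_cusp_form_density:
  assumes f: "f \<in> cusp_forms k N chi" and g: "g \<in> cusp_forms k N chi"
  shows "petersson_density k f g \<in> borel_measurable borel"
    and "petersson_density k f (prime_lift k p g) \<in> borel_measurable borel"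
    and "petersson_density k (prime_lift k p f) g \<in> borel_measurable borel"
    and "petersson_density k (prime_lift k p f) (prime_lift k p g) \<in> borel_measurable borel"
  by (intro measurable_petersson_density continuous_on_cusp_form[OF f] continuous_on_cusp_form[OF g])+

text \<open>The lift has the density of \<open>f\<close> moved by the Atkin--Lehner matrix, so the
  finiteness for \<open>f\<close> carries over.\<close>

lemma prime_lift_density_finite:
  assumes f: "f \<in> cusp_forms k N chi"
  shows "(\<integral>\<^sup>+\<tau>. indicator D \<tau> * ennreal (cmod (petersson_density k (prime_lift k p f) (prime_lift k p f) \<tau>)) \<partial>hyperbolic) < \<infinity>"
proof -
  note [measurable] = measurable_cusp_form_density[OF f f]
  have "(\<integral>\<^sup>+\<tau>. indicator D \<tau> * ennreal (cmod (petersson_density k (prime_lift k p f) (prime_lift k p f) \<tau>)) \<partial>hyperbolic) =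
      (\<integral>\<^sup>+\<tau>. indicator D \<tau> * ennreal (cmod (petersson_density k f f (act atkin_lehner \<tau>))) \<partial>hyperbolic)"
    using AE_hyperbolic_upper_half_plane
    by (intro nn_integral_cong_AE) (auto elim!: eventually_mono simp: petersson_density_atkin_lehner[OF chi f f])
  also have "\<dots> = (\<integral>\<^sup>+\<tau>. indicator D \<tau> * ennreal (cmod (petersson_density k f f \<tau>)) \<partial>hyperbolic)"
    using petersson_density_invariant[OF chi N_pos f f] Gamma0_mono[of N "N * p"]
    by (intro nn_integral_atkin_lehner[OF D]) auto
  finally show ?thesis using cusp_form_density_finite[OF f] by simp
qed

lemma integrable_cusp_form_density:
  assumes f: "f \<in> cusp_forms k N chi" and g: "g \<in> cusp_forms k N chi"
  shows "integrable petersson_measure (petersson_density k f g)"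
    and "integrable petersson_measure (petersson_density k f (prime_lift k p g))"
    and "integrable petersson_measure (petersson_density k (prime_lift k p f) g)"
    and "integrable petersson_measure (petersson_density k (prime_lift k p f) (prime_lift k p g))"
  by (intro integrable_petersson_density D_borel continuous_on_cusp_form[OF f] continuous_on_cusp_form[OF g]
      cusp_form_density_finite[OF f] cusp_form_density_finite[OF g]
      prime_lift_density_finite[OF f] prime_lift_density_finite[OF g])+

lemma integral_prime_lift_prime_lift:
  assumes f: "f \<in> cusp_forms k N chi" and g: "g \<in> cusp_forms k N chi"
  shows "(\<integral>\<tau>. petersson_density k (prime_lift k p f) (prime_lift k p g) \<tau> \<partial>petersson_measure) =
         (\<integral>\<tau>. petersson_density k f g \<tau> \<partial>petersson_measure)"
proof -
  note [measurable] = measurable_cusp_form_density[OF f g]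
  \<comment> \<open>A one-element index set with constant 1 specializes
    \<open>integral_sum_transfer\<close> to a single substitution.\<close>
  have "(\<Sum>i\<in>{()}. \<integral>\<tau>. petersson_density k f g (act atkin_lehner \<tau>) \<partial>petersson_measure) =
     of_real 1 * (\<integral>\<tau>. petersson_density k f g \<tau> \<partial>petersson_measure)"
  proof (rule integral_sum_transfer(2))
    fix u :: "complex \<Rightarrow> ennreal" assume [measurable]: "u \<in> borel_measurable borel"
    have "(\<integral>\<^sup>+\<tau>. indicator D \<tau> * u (petersson_density k f g (act atkin_lehner \<tau>)) \<partial>hyperbolic) =
       (\<integral>\<^sup>+\<tau>. indicator D \<tau> * u (petersson_density k f g \<tau>) \<partial>hyperbolic)"
      using petersson_density_invariant[OF chi N_pos f g] Gamma0_mono[of N "N * p"]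
      by (intro nn_integral_atkin_lehner[OF D]) auto
    then show "(\<Sum>i\<in>{()}. \<integral>\<^sup>+\<tau>. u (petersson_density k f g (act atkin_lehner \<tau>)) \<partial>petersson_measure) =
       ennreal 1 * (\<integral>\<^sup>+\<tau>. u (petersson_density k f g \<tau>) \<partial>petersson_measure)"
      by (simp add: nn_integral_density)
  qed (auto intro: integrable_cusp_form_density f g measurable_act_petersson_measure)
  moreover have "(\<integral>\<tau>. petersson_density k f g (act atkin_lehner \<tau>) \<partial>petersson_measure) =
      (\<integral>\<tau>. petersson_density k (prime_lift k p f) (prime_lift k p g) \<tau> \<partial>petersson_measure)"
    using AE_petersson_measure
    by (intro integral_cong_AE) (auto elim!: eventually_mono simp: petersson_density_atkin_lehner[OF chi f g])
  ultimately show ?thesis by simp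
qed

text \<open>The p nontrivial cosets turn the lift of \<open>g\<close> into the summands of
  \<open>hecke_U\<close>, so the eigenvalue equation makes the coset sum a pointwise multiple of the
  density of f and g. Integrated, the same coset sum is p + 1 times the mixed pairing.\<close>

lemma integral_form_prime_lift:
  fixes lam :: complex
  assumes f: "f \<in> cusp_forms k N chi" and g: "g \<in> cusp_forms k N chi"
    and eig: "eigenfunction (hecke_T k chi p) g lam"
  shows "(of_nat p + 1) * (\<integral>\<tau>. petersson_density k f (prime_lift k p g) \<tau> \<partial>petersson_measure) =
     chi (int p) * cnj lam / of_real (real p powr (of_int k / 2 - 1)) * (\<integral>\<tau>. petersson_density k f g \<tau> \<partial>petersson_measure)"
proof -
  define c where "c = real p powr (of_int k / 2 - 1)"
  define F where "F = petersson_density k f (prime_lift k p g)"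
  have c: "c > 0" using p_pos by (simp add: c_def)
  note [measurable] = measurable_cusp_form_density[OF f g]
  have F [measurable]: "F \<in> borel_measurable borel" by (simp add: F_def measurable_cusp_form_density f g)
  have chi_p: "chi (int p) * cnj (chi (int p)) = 1"
    using not_p_dvd_N prime_p by (intro dirichlet_character_mult_cnj[OF chi N_pos] prime_imp_coprime) auto
  have sum: "(\<Sum>j\<le>p. F (act (coset_rep j) \<tau>)) = chi (int p) * cnj lam / of_real c * petersson_density k f g \<tau>"
    if \<tau>: "Im \<tau> > 0" for \<tau>
  proof -
    define S where "S = (\<Sum>j<p. slash k g (mat2 1 (real j) 0 (real p)) \<tau>)"
    have "lam * g \<tau> = of_real c * (S + chi (int p) * prime_lift k p g \<tau>)"
      using eig hecke_T_prime[where chi = chi, OF prime_p dirichlet_character_one[OF chi], of k g \<tau>] \<tau>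
      by (simp add: eigenfunction_def upper_half_plane_def hecke_U_def S_def c_def algebra_simps)
    then have "S = lam * g \<tau> / of_real c - chi (int p) * prime_lift k p g \<tau>"
      using c by (simp add: field_simps)
    then have S: "cnj S = cnj lam * cnj (g \<tau>) / of_real c - cnj (chi (int p)) * cnj (prime_lift k p g \<tau>)"
      by simp
    have "(\<Sum>j\<le>p. F (act (coset_rep j) \<tau>)) = (\<Sum>j<p. F (act (coset_rep j) \<tau>)) + F (act (coset_rep p) \<tau>)"
      by (simp add: lessThan_Suc_atMost[symmetric])
    also have "F (act (coset_rep p) \<tau>) = F \<tau>"
      by (simp add: coset_rep_def)
    also have "(\<Sum>j<p. F (act (coset_rep j) \<tau>)) =
       (\<Sum>j<p. chi (int p) * petersson_density k f (slash k g (mat2 1 (real j) 0 (real p))) \<tau>)"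
      unfolding F_def using petersson_density_coset_rep[OF chi f g \<tau>] by (intro sum.cong) auto
    also have "\<dots> = chi (int p) * (f \<tau> * cnj S * of_real (Im \<tau> powi k))"
      using \<tau> by (simp add: petersson_density_def S_def sum_distrib_left sum_distrib_right)
    \<comment> \<open>The lift inside \<open>S\<close> enters with coefficient minus chi(p) times
      its conjugate, that is -1, and cancels the term of the identity coset.\<close>
    also have "\<dots> + F \<tau> = chi (int p) * cnj lam / of_real c * petersson_density k f g \<tau> +
       (1 - chi (int p) * cnj (chi (int p))) * (f \<tau> * cnj (prime_lift k p g \<tau>) * of_real (Im \<tau> powi k))"
      unfolding S using \<tau> by (simp add: F_def petersson_density_def algebra_simps)
    finally show ?thesis by (simp add: chi_p)
  qed
  have transfer: "(\<Sum>j\<le>p. \<integral>\<^sup>+\<tau>. u (F (act (coset_rep j) \<tau>)) \<partial>petersson_measure) =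
       ennreal (real (p + 1)) * (\<integral>\<^sup>+\<tau>. u (F \<tau>) \<partial>petersson_measure)"
    if [measurable]: "u \<in> borel_measurable borel" for u :: "complex \<Rightarrow> ennreal"
  proof -
    have "(\<Sum>j\<le>p. \<integral>\<^sup>+\<tau>. indicator D \<tau> * u (F (act (coset_rep j) \<tau>)) \<partial>hyperbolic) =
       of_nat (p + 1) * (\<integral>\<^sup>+\<tau>. indicator D \<tau> * u (F \<tau>) \<partial>hyperbolic)"
      using petersson_density_lift_invariant[OF chi f g] by (intro nn_integral_trace[OF D]) (auto simp: F_def)
    then show ?thesis
      by (simp add: nn_integral_density ennreal_of_nat_eq_real_of_nat)
  qed
  have F_int: "integrable petersson_measure F"
    unfolding F_def by (rule integrable_cusp_form_density[OF f g])
  note T = integral_sum_transfer[where I = "{..p}" and h = "\<lambda>j. act (coset_rep j)" and F = F,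
      OF finite_atMost measurable_act_petersson_measure _ F_int transfer]
  have "of_real (real (p + 1)) * (\<integral>\<tau>. F \<tau> \<partial>petersson_measure) =
      (\<Sum>j\<le>p. \<integral>\<tau>. F (act (coset_rep j) \<tau>) \<partial>petersson_measure)"
    using T(2) by simp
  also have "\<dots> = (\<integral>\<tau>. (\<Sum>j\<le>p. F (act (coset_rep j) \<tau>)) \<partial>petersson_measure)"
    using T(1) by (intro Bochner_Integration.integral_sum[symmetric]) auto
  also have "\<dots> = (\<integral>\<tau>. chi (int p) * cnj lam / of_real c * petersson_density k f g \<tau> \<partial>petersson_measure)"
    using AE_petersson_measure by (intro integral_cong_AE) (auto elim!: eventually_mono simp: sum)
  also have "\<dots> = chi (int p) * cnj lam / of_real c * (\<integral>\<tau>. petersson_density k f g \<tau> \<partial>petersson_measure)"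
    by (rule integral_mult_right_zero)
  finally show ?thesis by (simp add: F_def c_def add.commute)
qed

text \<open>Hermitian symmetry reduces this to the other mixed pairing with f and g
  exchanged.\<close>

lemma integral_prime_lift_form:
  fixes lam :: complex
  assumes f: "f \<in> cusp_forms k N chi" and g: "g \<in> cusp_forms k N chi"
    and eig: "eigenfunction (hecke_T k chi p) f lam"
  shows "(of_nat p + 1) * (\<integral>\<tau>. petersson_density k (prime_lift k p f) g \<tau> \<partial>petersson_measure) =
     cnj (chi (int p)) * lam / of_real (real p powr (of_int k / 2 - 1)) * (\<integral>\<tau>. petersson_density k f g \<tau> \<partial>petersson_measure)"
proof -
  have swap: "(\<integral>\<tau>. petersson_density k a b \<tau> \<partial>petersson_measure) =
      cnj (\<integral>\<tau>. petersson_density k b a \<tau> \<partial>petersson_measure)" for a b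
  proof -
    have "petersson_density k a b = (\<lambda>\<tau>. cnj (petersson_density k b a \<tau>))"
      by (auto simp: fun_eq_iff petersson_density_def)
    then show ?thesis by (simp only: Bochner_Integration.integral_cnj)
  qed
  show ?thesis
    using arg_cong[OF integral_form_prime_lift[OF g f eig], of cnj]
    by (simp add: swap[of "prime_lift k p f" g] swap[of f g])
qed

lemma integral_hecke_U:
  fixes lam_f lam_g :: complex
  assumes f: "f \<in> cusp_forms k N chi" and g: "g \<in> cusp_forms k N chi"
    and eig_f: "eigenfunction (hecke_T k chi p) f lam_f"
    and eig_g: "eigenfunction (hecke_T k chi p) g lam_g"
  shows "petersson_density k (hecke_U k p f) (hecke_U k p g) \<in> borel_measurable borel"
    and "(\<integral>\<tau>. petersson_density k (hecke_U k p f) (hecke_U k p g) \<tau> \<partial>petersson_measure) =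
      (of_nat p powi (k - 2) + (of_nat p - 1) * lam_f * cnj lam_g / (of_nat p + 1)) *
      (\<integral>\<tau>. petersson_density k f g \<tau> \<partial>petersson_measure)"
proof -
  define c where "c = real p powr (of_int k / 2 - 1)"
  define e where "e = of_real c * chi (int p)"
  define f' g' where "f' = prime_lift k p f" and "g' = prime_lift k p g"
  define I where "I = (\<integral>\<tau>. petersson_density k f g \<tau> \<partial>petersson_measure)"
  define P :: complex where "P = of_nat p + 1"
  have c: "c > 0" using p_pos by (simp add: c_def)
  have "P = of_nat (Suc p)" by (simp add: P_def)
  then have P: "P \<noteq> 0" by (simp only: of_nat_eq_0_iff)
  have chi_p: "chi (int p) * cnj (chi (int p)) = 1"
    using not_p_dvd_N prime_p by (intro dirichlet_character_mult_cnj[OF chi N_pos] prime_imp_coprime) auto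
  have c2: "of_real c * of_real c = (of_nat p powi (k - 2) :: complex)"
  proof -
    have "c * c = real p powr of_int (k - 2)"
      by (simp add: c_def powr_add[symmetric])
    also have "\<dots> = real p powi (k - 2)"
      using p_pos powr_real_of_int'[of "real p" "k - 2"] by simp
    finally have "of_real (c * c) = (of_real (real p powi (k - 2)) :: complex)" by simp
    then show ?thesis by simp
  qed
  have U: "hecke_U k p h \<tau> = lam * h \<tau> - e * prime_lift k p h \<tau>"
    if "eigenfunction (hecke_T k chi p) h lam" "Im \<tau> > 0" for h lam \<tau>
    using that hecke_T_prime[where chi = chi, OF prime_p dirichlet_character_one[OF chi], of k h \<tau>]
    by (simp add: eigenfunction_def upper_half_plane_def e_def c_def)
  have expand: "petersson_density k (hecke_U k p f) (hecke_U k p g) = (\<lambda>\<tau>.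
      lam_f * cnj lam_g * petersson_density k f g \<tau> - lam_f * cnj e * petersson_density k f g' \<tau>
      - e * cnj lam_g * petersson_density k f' g \<tau> + e * cnj e * petersson_density k f' g' \<tau>)"
    by (rule ext) (simp add: petersson_density_def U[OF eig_f] U[OF eig_g] f'_def g'_def algebra_simps)
  note [measurable] = measurable_cusp_form_density[OF f g, folded f'_def g'_def]
  note int = integrable_cusp_form_density[OF f g, folded f'_def g'_def]
  show "petersson_density k (hecke_U k p f) (hecke_U k p g) \<in> borel_measurable borel"
    unfolding expand by measurable
  have fg': "(\<integral>\<tau>. petersson_density k f g' \<tau> \<partial>petersson_measure) = chi (int p) * cnj lam_g / of_real c * I / P"
    using arg_cong[OF integral_form_prime_lift[OF f g eig_g, folded I_def c_def g'_def P_def], of "\<lambda>z. z / P"] P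
    by simp
  have f'g: "(\<integral>\<tau>. petersson_density k f' g \<tau> \<partial>petersson_measure) = cnj (chi (int p)) * lam_f / of_real c * I / P"
    using arg_cong[OF integral_prime_lift_form[OF f g eig_f, folded I_def c_def f'_def P_def], of "\<lambda>z. z / P"] P
    by simp
  have f'g': "(\<integral>\<tau>. petersson_density k f' g' \<tau> \<partial>petersson_measure) = I"
    using integral_prime_lift_prime_lift[OF f g] by (simp add: I_def f'_def g'_def)
  have "(\<integral>\<tau>. petersson_density k (hecke_U k p f) (hecke_U k p g) \<tau> \<partial>petersson_measure) =
     lam_f * cnj lam_g * I - lam_f * cnj e * (\<integral>\<tau>. petersson_density k f g' \<tau> \<partial>petersson_measure)
     - e * cnj lam_g * (\<integral>\<tau>. petersson_density k f' g \<tau> \<partial>petersson_measure)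
     + e * cnj e * (\<integral>\<tau>. petersson_density k f' g' \<tau> \<partial>petersson_measure)"
    unfolding expand using int by (simp add: I_def)
  \<comment> \<open>In each mixed term the \<open>c\<close> inside \<open>e\<close> cancels the
    division by \<open>c\<close>, so both equal the same multiple of I / P; this gives the 2 and
    hence P - 2 = p - 1.\<close>
  also have "\<dots> = lam_f * cnj lam_g * I - 2 * (lam_f * cnj lam_g) * (chi (int p) * cnj (chi (int p))) * I / P
     + (of_real c * of_real c) * (chi (int p) * cnj (chi (int p))) * I"
    unfolding fg' f'g f'g' using c by (simp add: e_def field_simps)
  also have "\<dots> = (of_nat p powi (k - 2) + (P - 2) * lam_f * cnj lam_g / P) * I"
    unfolding chi_p c2 using P by (simp add: field_simps)
  also have "P - 2 = of_nat p - 1" by (simp add: P_def)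
  finally show "(\<integral>\<tau>. petersson_density k (hecke_U k p f) (hecke_U k p g) \<tau> \<partial>petersson_measure) =
      (of_nat p powi (k - 2) + (of_nat p - 1) * lam_f * cnj lam_g / (of_nat p + 1)) *
      (\<integral>\<tau>. petersson_density k f g \<tau> \<partial>petersson_measure)"
    by (simp add: P_def I_def)
qed

end

end

theorem theorem5p5:
  fixes N p :: nat and k :: int and chi :: "int \<Rightarrow> complex"
    and f g :: "complex \<Rightarrow> complex" and lam_f lam_g :: complex
  assumes "N > 0" and "dirichlet_character N chi"
    and "prime p" and "\<not> p dvd N"
    and "f \<in> cusp_forms k N chi" and "g \<in> cusp_forms k N chi"
    and "eigenfunction (hecke_T k chi p) f lam_f"
    and "eigenfunction (hecke_T k chi p) g lam_g"
  shows "petersson k (N * p) (hecke_U k p f) (hecke_U k p g) =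
    (of_nat p powi (k - 2) + (of_nat p - 1) * lam_f * cnj lam_g / (of_nat p + 1)) *
    petersson k (N * p) f g"
proof -
  have "coprime (int p) (int N)"
    using assms(3,4) by (simp add: prime_imp_coprime)
  then obtain u v where "u * int p + v * int N = 1"
    using bezout_int[of "int p" "int N"] by auto
  \<comment> \<open>The sign turns the Bezout sum into the difference that occurs as a
    determinant.\<close>
  then interpret bezout_level N p u "- v"
    using assms by unfold_locales auto
  define D where "D = (SOME D. fundamental_domain (Gamma0 (N * p)) D)"
  have D: "fundamental_domain (Gamma0 (N * p)) D"
    unfolding D_def by (rule fundamental_domain_Eps)
  note U = integral_hecke_U[OF assms(2) D assms(5-8)]
  show ?thesis
    unfolding petersson_eq_integral_density[OF D_def U(1)]
      petersson_eq_integral_density[OF D_def measurable_cusp_form_density(1)[OF assms(2) D assms(5,6)]]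
    by (rule U(2))
qed

end
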